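(* Let $M=\Gamma\backslash\mathbf{H}_1$ be the compact quotient of the Heisenberg group described in the context, endowed with the Lebesgue measure and the vector fields $X_1=\partial_x$ and $Y_1=\partial_y-x\partial_z$. Let $\mathscr{H}^3$ denote the $3$-dimensional Hausdorff measure with respect to the associated sub-Riemannian distance on $M$. There exist an open subset $\Omega\subset M$, constants $c_1,c_2>0$, and sequences of eigenfunctions $(\varphi_{1,m})_{m\in\mathbb{N}}$ and $(\varphi_{2,m})_{m\in\mathbb{N}}$ of $-\Delta_\Omega$, with respective eigenvalues $(\lambda_{1,m})_{m\in\mathbb{N}}$ and $(\lambda_{2,m})_{m\in\mathbb{N}}$ tending to $+\infty$, such that for all $m$ $$\mathscr{H}^{3}(Z_{\varphi_{1,m}})\leq c_1\sqrt{\lambda_{1,m}}\qquad\text{and}\qquad \mathscr{H}^{3}(Z_{\varphi_{2,m}})\geq c_2\,\lambda_{2,m}.$$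
   Context: $\mathbf{H}_1$ is $\mathbb{R}^3$ with the group law $(x,y,z)\cdot(x',y',z')=(x+x',\,y+y',\,z+z'-xy')$, and $\Gamma=(\sqrt{2\pi}\,\mathbb{Z})^2\times 2\pi\mathbb{Z}$ is a lattice in it. The vector fields $X_1=\partial_x$ and $Y_1=\partial_y-x\partial_z$ are left-invariant on $\mathbf{H}_1$ and hence descend to the compact left quotient $M=\Gamma\backslash\mathbf{H}_1$; so does the Lebesgue measure $\mu=dx\,dy\,dz$. The sub-Laplacian is $\Delta=X_1^2+Y_1^2$. For an open set $\Omega\subset M$, $\Delta_\Omega$ is the Friedrichs extension of $\Delta:C_c^\infty(\Omega)\to C_c^\infty(\Omega)$ in $L^2(\Omega,\mu)$. Explicitly: the form domain $\mathcal{D}(\widehat q_\Omega)$ is the set of $v\in L^2(\Omega,\mu)$ for which there are $v_n\in C_c^\infty(\Omega)$ with $v_n\to v$ in $L^2$ and $\|X_1(v_n-v_\ell)\|_{L^2}^2+\|Y_1(v_n-v_\ell)\|_{L^2}^2\to0$ as $n,\ell\to\infty$; $\mathcal{D}(\Delta_\Omega)$ is the set of $v\in\mathcal{D}(\widehat q_\Omega)$ for which there is $f\in L^2(\Omega,\mu)$ with $-(X_1v,X_1w)_{L^2}-(Y_1v,Y_1w)_{L^2}=(f,w)_{L^2}$ for all $w\in\mathcal{D}(\widehat q_\Omega)$, and then $\Delta_\Omega v=f$. The nodal set of a function $f$ (continuous on $\overline\Omega$) is $Z_f=\{f=0\}\subset\overline\Omega$. Eigenfunctions are real-valued and not identically zero.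 The sub-Riemannian metric is $g_q(v)=\inf\{u_1^2+u_2^2 : v=u_1X_1(q)+u_2Y_1(q)\}$ for $q\in M$, $v\in T_qM$ ($+\infty$ if there is no such $(u_1,u_2)$), and the sub-Riemannian distance $d(q,q')$ is the infimum of $\int\sqrt{g_{\gamma(t)}(\dot\gamma(t))}\,dt$ over absolutely continuous curves $\gamma$ from $q$ to $q'$. *)

theory Defs
  imports "HOL-Analysis.Analysis"
begin

section \<open>The Heisenberg group and its compact quotient\<close>

type_synonym heis = "real \<times> real \<times> real"

fun heis_mult :: "heis \<Rightarrow> heis \<Rightarrow> heis" where
  "heis_mult (x, y, z) (x', y', z') = (x + x', y + y', z + z' - x * y')"

definition heis_lattice :: "heis set" where
  "heis_lattice =
     {(sqrt (2 * pi) * of_int a, sqrt (2 * pi) * of_int b, 2 * pi * of_int c) | a b c. True}"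

lemma heis_mult_assoc: "heis_mult (heis_mult p q) r = heis_mult p (heis_mult q r)"
  by (cases p, cases q, cases r) (simp add: algebra_simps)

lemma heis_mult_zero [simp]: "heis_mult 0 p = p" "heis_mult p 0 = p"
  by (cases p, simp add: zero_prod_def)+

lemma heis_lattice_zero: "0 \<in> heis_lattice"
  unfolding heis_lattice_def zero_prod_def by (force intro: exI[of _ "0::int"])

lemma heis_lattice_mult:
  assumes "g \<in> heis_lattice" "h \<in> heis_lattice"
  shows "heis_mult g h \<in> heis_lattice"
proof -
  obtain a b c where g: "g = (sqrt (2*pi) * of_int a, sqrt (2*pi) * of_int b, 2*pi * of_int c)"
    using assms(1) unfolding heis_lattice_def by auto
  obtain a' b' c' where h: "h = (sqrt (2*pi) * of_int a', sqrt (2*pi) * of_int b', 2*pi * of_int c')"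
    using assms(2) unfolding heis_lattice_def by auto
  have s: "sqrt (2*pi) * sqrt (2*pi) = 2*pi" by simp
  have "(sqrt (2*pi) * of_int a) * (sqrt (2*pi) * of_int b')
      = (sqrt (2*pi) * sqrt (2*pi)) * (of_int a * of_int b')" by (simp only: ac_simps)
  then have "heis_mult g h = (sqrt (2*pi) * of_int (a + a'), sqrt (2*pi) * of_int (b + b'),
      2*pi * of_int (c + c' - a * b'))"
    unfolding g h s by (simp add: algebra_simps)
  then show ?thesis unfolding heis_lattice_def by blast
qed

lemma heis_lattice_inverse:
  assumes "g \<in> heis_lattice"
  shows "\<exists>h\<in>heis_lattice. heis_mult h g = 0"
proof -
  obtain a b c where g: "g = (sqrt (2*pi) * of_int a, sqrt (2*pi) * of_int b, 2*pi * of_int c)"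
    using assms unfolding heis_lattice_def by auto
  let ?h = "(sqrt (2*pi) * of_int (-a), sqrt (2*pi) * of_int (-b), 2*pi * of_int (-c - a*b)) :: heis"
  have s: "sqrt (2*pi) * sqrt (2*pi) = 2*pi" by simp
  have "(sqrt (2*pi) * of_int a) * (sqrt (2*pi) * of_int b)
      = (sqrt (2*pi) * sqrt (2*pi)) * (of_int a * of_int b)" by (simp only: ac_simps)
  then have "heis_mult ?h g = 0"
    unfolding g s by (simp add: algebra_simps zero_prod_def)
  moreover have "?h \<in> heis_lattice" unfolding heis_lattice_def by blast
  ultimately show ?thesis by blast
qed

definition heis_rel :: "heis \<Rightarrow> heis \<Rightarrow> bool" where
  "heis_rel p q \<longleftrightarrow> (\<exists>g\<in>heis_lattice. q = heis_mult g p)"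

lemma equivp_heis_rel: "equivp heis_rel"
proof (rule equivpI)
  show "reflp heis_rel"
    unfolding reflp_def heis_rel_def using heis_lattice_zero heis_mult_zero(1) by metis
  show "symp heis_rel"
    unfolding symp_def heis_rel_def
    by (metis heis_lattice_inverse heis_mult_assoc heis_mult_zero(1))
  show "transp heis_rel"
    unfolding transp_def heis_rel_def by (metis heis_lattice_mult heis_mult_assoc)
qed

quotient_type heis_mfd = heis / heis_rel
  morphisms rep_mfd proj_mfd
  by (rule equivp_heis_rel)

lemma proj_mfd_eq_iff: "proj_mfd p = proj_mfd q \<longleftrightarrow> (\<exists>g\<in>heis_lattice. q = heis_mult g p)"
  using heis_mfd.abs_eq_iff[of p q] unfolding heis_rel_def .

lemma proj_mfd_mult: "g \<in> heis_lattice \<Longrightarrow> proj_mfd (heis_mult g p) = proj_mfd p"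
  by (metis proj_mfd_eq_iff)

lemma proj_rep_mfd [simp]: "proj_mfd (rep_mfd q) = q"
  using Quotient_heis_mfd by (metis Quotient_abs_rep)

text \<open>The quotient topology.\<close>

instantiation heis_mfd :: topological_space
begin

definition open_heis_mfd :: "heis_mfd set \<Rightarrow> bool" where
  "open_heis_mfd U \<longleftrightarrow> open (proj_mfd -` U)"

instance
proof
  show "open (UNIV :: heis_mfd set)" by (simp add: open_heis_mfd_def)
  show "open (S \<inter> T)" if "open S" "open T" for S T :: "heis_mfd set"
    using that by (simp add: open_heis_mfd_def open_Int)
  show "open (\<Union>K)" if "\<forall>S\<in>K. open S" for K :: "heis_mfd set set"
    using that by (auto simp: open_heis_mfd_def vimage_Union)
qed

end

text \<open>The half-open box is a fundamental domain for the lattice acting by left translations, and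
  left translations preserve Lebesgue measure; so the following is the measure on the quotient
  induced by the Lebesgue measure.\<close>

definition heis_fund_dom :: "heis set" where
  "heis_fund_dom = {0..<sqrt (2 * pi)} \<times> {0..<sqrt (2 * pi)} \<times> {0..<2 * pi}"

definition mfd_measure :: "heis_mfd measure" where
  "mfd_measure = distr (restrict_space lborel heis_fund_dom) borel proj_mfd"


section \<open>Horizontal vector fields and smooth functions\<close>

fun X1 :: "heis \<Rightarrow> heis" where
  "X1 (x, y, z) = (1, 0, 0)"

fun Y1 :: "heis \<Rightarrow> heis" where
  "Y1 (x, y, z) = (0, 1, - x)"

text \<open>A function on the quotient is differentiated along a left-invariant vector field by
  differentiating its lift; \<open>mfd_deriv_proj\<close> below shows that the choice of the
  representative is irrelevant.\<close>

definition mfd_deriv :: "(heis \<Rightarrow> heis) \<Rightarrow> (heis_mfd \<Rightarrow> real) \<Rightarrow> heis_mfd \<Rightarrow> real" where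
  "mfd_deriv V v q =
     frechet_derivative (\<lambda>p. v (proj_mfd p)) (at (rep_mfd q)) (V (rep_mfd q))"

fun Ck :: "nat \<Rightarrow> ('a::real_normed_vector \<Rightarrow> real) \<Rightarrow> bool" where
  "Ck 0 f \<longleftrightarrow> continuous_on UNIV f"
| "Ck (Suc k) f \<longleftrightarrow>
     (\<forall>x. f differentiable (at x)) \<and> (\<forall>h. Ck k (\<lambda>x. frechet_derivative f (at x) h))"

definition mfd_smooth :: "(heis_mfd \<Rightarrow> real) \<Rightarrow> bool" where
  "mfd_smooth v \<longleftrightarrow> (\<forall>k. Ck k (\<lambda>p. v (proj_mfd p)))"

lemma mfd_deriv_proj:
  assumes "mfd_smooth v" and "V = X1 \<or> V = Y1"
  shows "mfd_deriv V v (proj_mfd p) = frechet_derivative (\<lambda>p. v (proj_mfd p)) (at p) (V p)"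
proof -
  let ?u = "\<lambda>p. v (proj_mfd p)"
  have diff: "?u differentiable (at x)" for x
    using assms(1) Ck.simps(2)[of 0 ?u] unfolding mfd_smooth_def by blast
  obtain g where g: "g \<in> heis_lattice" and r: "rep_mfd (proj_mfd p) = heis_mult g p"
    using proj_mfd_eq_iff[of p "rep_mfd (proj_mfd p)"] by auto
  obtain a b c where abc: "g = (a, b, c)" by (cases g)
  define L :: "heis \<Rightarrow> heis" where "L = (\<lambda>h. (fst h, fst (snd h), snd (snd h) - a * fst (snd h)))"
  have gm: "heis_mult g = (\<lambda>p. (a, b, c) + L p)"
    by (auto simp: abc L_def fun_eq_iff algebra_simps)
  have "(heis_mult g has_derivative L) (at p)"
    unfolding gm L_def by (auto intro!: derivative_eq_intros)
  then have "(?u \<circ> heis_mult g has_derivative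
      frechet_derivative ?u (at (heis_mult g p)) \<circ> L) (at p)"
    by (rule diff_chain_at) (use diff frechet_derivative_works in blast)
  moreover have "?u \<circ> heis_mult g = ?u"
    using g by (simp add: fun_eq_iff proj_mfd_mult)
  ultimately have "frechet_derivative ?u (at p) = frechet_derivative ?u (at (heis_mult g p)) \<circ> L"
    by (metis frechet_derivative_at)
  moreover have "L (V p) = V (heis_mult g p)"
    using assms(2) by (cases p) (auto simp: abc L_def algebra_simps)
  ultimately show ?thesis
    unfolding mfd_deriv_def r by simp
qed

definition test_fun :: "heis_mfd set \<Rightarrow> (heis_mfd \<Rightarrow> real) \<Rightarrow> bool" where
  "test_fun \<Omega> v \<longleftrightarrow>
     mfd_smooth v \<and> compact (closure {q. v q \<noteq> 0}) \<and> closure {q. v q \<noteq> 0} \<subseteq> \<Omega>"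


section \<open>The Dirichlet sub-Laplacian\<close>

definition L2 :: "heis_mfd set \<Rightarrow> (heis_mfd \<Rightarrow> real) \<Rightarrow> bool" where
  "L2 \<Omega> v \<longleftrightarrow> v \<in> borel_measurable (restrict_space mfd_measure \<Omega>) \<and>
     integrable (restrict_space mfd_measure \<Omega>) (\<lambda>q. (v q)\<^sup>2)"

definition L2_inner :: "heis_mfd set \<Rightarrow> (heis_mfd \<Rightarrow> real) \<Rightarrow> (heis_mfd \<Rightarrow> real) \<Rightarrow> real" where
  "L2_inner \<Omega> v w = integral\<^sup>L (restrict_space mfd_measure \<Omega>) (\<lambda>q. v q * w q)"

definition L2_normsq :: "heis_mfd set \<Rightarrow> (heis_mfd \<Rightarrow> real) \<Rightarrow> real" where
  "L2_normsq \<Omega> v = L2_inner \<Omega> v v"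

definition L2_lim :: "heis_mfd set \<Rightarrow> (nat \<Rightarrow> heis_mfd \<Rightarrow> real) \<Rightarrow> (heis_mfd \<Rightarrow> real) \<Rightarrow> bool" where
  "L2_lim \<Omega> v_seq v \<longleftrightarrow> (\<lambda>n. L2_normsq \<Omega> (\<lambda>q. v_seq n q - v q)) \<longlonglongrightarrow> 0"

definition form_dom :: "heis_mfd set \<Rightarrow> (heis_mfd \<Rightarrow> real) \<Rightarrow> bool" where
  "form_dom \<Omega> v \<longleftrightarrow> L2 \<Omega> v \<and>
     (\<exists>v_seq. (\<forall>n. test_fun \<Omega> (v_seq n)) \<and> L2_lim \<Omega> v_seq v \<and>
        ((\<lambda>(n, l). L2_normsq \<Omega> (mfd_deriv X1 (\<lambda>q. v_seq n q - v_seq l q))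
                 + L2_normsq \<Omega> (mfd_deriv Y1 (\<lambda>q. v_seq n q - v_seq l q)))
          \<longlongrightarrow> 0) (sequentially \<times>\<^sub>F sequentially))"

text \<open>On the form domain, the derivatives along \<open>X1\<close> and \<open>Y1\<close> are those of the closed form: the
  limits in \<open>L2\<close> of the derivatives of the approximating test functions. These limits exist
  by completeness, and they do not depend (almost everywhere) on the approximating sequence,
  because the form is closable; they are also the distributional derivatives.\<close>

definition has_horiz_grad ::
    "heis_mfd set \<Rightarrow> (heis_mfd \<Rightarrow> real) \<Rightarrow> (heis_mfd \<Rightarrow> real) \<times> (heis_mfd \<Rightarrow> real) \<Rightarrow> bool" where
  "has_horiz_grad \<Omega> v = (\<lambda>(a, b). L2 \<Omega> a \<and> L2 \<Omega> b \<and>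
     (\<exists>v_seq. (\<forall>n. test_fun \<Omega> (v_seq n)) \<and> L2_lim \<Omega> v_seq v \<and>
        L2_lim \<Omega> (\<lambda>n. mfd_deriv X1 (v_seq n)) a \<and> L2_lim \<Omega> (\<lambda>n. mfd_deriv Y1 (v_seq n)) b))"

definition horiz_grad ::
    "heis_mfd set \<Rightarrow> (heis_mfd \<Rightarrow> real) \<Rightarrow> (heis_mfd \<Rightarrow> real) \<times> (heis_mfd \<Rightarrow> real)" where
  "horiz_grad \<Omega> v = (SOME ab. has_horiz_grad \<Omega> v ab)"

definition X1_ext :: "heis_mfd set \<Rightarrow> (heis_mfd \<Rightarrow> real) \<Rightarrow> heis_mfd \<Rightarrow> real" where
  "X1_ext \<Omega> v = fst (horiz_grad \<Omega> v)"

definition Y1_ext :: "heis_mfd set \<Rightarrow> (heis_mfd \<Rightarrow> real) \<Rightarrow> heis_mfd \<Rightarrow> real" where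
  "Y1_ext \<Omega> v = snd (horiz_grad \<Omega> v)"

text \<open>The graph of the Friedrichs extension: \<open>v\<close> is in its domain and is mapped to \<open>f\<close>.\<close>

definition sub_laplacian :: "heis_mfd set \<Rightarrow> (heis_mfd \<Rightarrow> real) \<Rightarrow> (heis_mfd \<Rightarrow> real) \<Rightarrow> bool" where
  "sub_laplacian \<Omega> v f \<longleftrightarrow> form_dom \<Omega> v \<and> L2 \<Omega> f \<and>
     (\<forall>w. form_dom \<Omega> w \<longrightarrow>
        - L2_inner \<Omega> (X1_ext \<Omega> v) (X1_ext \<Omega> w) - L2_inner \<Omega> (Y1_ext \<Omega> v) (Y1_ext \<Omega> w)
        = L2_inner \<Omega> f w)"

text \<open>Eigenfunctions of \<open>- \<Delta>\<^sub>\<Omega>\<close>.\<close>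

definition eigenfunction :: "heis_mfd set \<Rightarrow> real \<Rightarrow> (heis_mfd \<Rightarrow> real) \<Rightarrow> bool" where
  "eigenfunction \<Omega> ev \<phi> \<longleftrightarrow>
     sub_laplacian \<Omega> \<phi> (\<lambda>q. - ev * \<phi> q) \<and>
     \<not> (AE q in restrict_space mfd_measure \<Omega>. \<phi> q = 0)"

definition nodal_set :: "heis_mfd set \<Rightarrow> (heis_mfd \<Rightarrow> real) \<Rightarrow> heis_mfd set" where
  "nodal_set \<Omega> f = {q \<in> closure \<Omega>. f q = 0}"


section \<open>Sub-Riemannian distance and Hausdorff measure\<close>

text \<open>The projection is a local diffeomorphism mapping the left-invariant fields on the group to
  the fields on the quotient, so the tangent space at \<open>proj_mfd p\<close> is identified with the one at
  \<open>p\<close>, i.e. with \<open>heis\<close>.\<close>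

definition sr_metric :: "heis \<Rightarrow> heis \<Rightarrow> ennreal" where
  "sr_metric p v =
     Inf {ennreal (u\<^sub>1\<^sup>2 + u\<^sub>2\<^sup>2) | u\<^sub>1 u\<^sub>2. v = u\<^sub>1 *\<^sub>R X1 p + u\<^sub>2 *\<^sub>R Y1 p}"

definition ennreal_sqrt :: "ennreal \<Rightarrow> ennreal" where
  "ennreal_sqrt r = (if r = top then top else ennreal (sqrt (enn2real r)))"

definition abs_continuous_on_interval :: "real \<Rightarrow> real \<Rightarrow> (real \<Rightarrow> 'a::metric_space) \<Rightarrow> bool" where
  "abs_continuous_on_interval a b f \<longleftrightarrow>
     (\<forall>\<epsilon>>0. \<exists>\<delta>>0. \<forall>D. finite D \<and> (\<forall>(s, t)\<in>D. a \<le> s \<and> s \<le> t \<and> t \<le> b) \<and>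
        pairwise (\<lambda>(s, t) (s', t'). {s<..<t} \<inter> {s'<..<t'} = {}) D \<and>
        (\<Sum>(s, t)\<in>D. t - s) < \<delta> \<longrightarrow> (\<Sum>(s, t)\<in>D. dist (f s) (f t)) < \<epsilon>)"

definition sr_length :: "(real \<Rightarrow> heis) \<Rightarrow> ennreal" where
  "sr_length \<gamma> =
     (\<integral>\<^sup>+ t\<in>{0..1}. ennreal_sqrt (sr_metric (\<gamma> t) (vector_derivative \<gamma> (at t))) \<partial>lborel)"

text \<open>Since the projection is a smooth covering, the absolutely continuous curves in the quotient
  are exactly the projections of the absolutely continuous curves in the group, and their length
  is the length of the lift.\<close>

definition sr_dist :: "heis_mfd \<Rightarrow> heis_mfd \<Rightarrow> ennreal" where
  "sr_dist q q' = Inf {sr_length \<gamma> | \<gamma>. abs_continuous_on_interval 0 1 \<gamma> \<and>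
     proj_mfd (\<gamma> 0) = q \<and> proj_mfd (\<gamma> 1) = q'}"

definition ediam :: "('a \<Rightarrow> 'a \<Rightarrow> ennreal) \<Rightarrow> 'a set \<Rightarrow> ennreal" where
  "ediam d A = (SUP x\<in>A. SUP y\<in>A. d x y)"

text \<open>Hausdorff measure of integer dimension \<open>k > 0\<close>, without normalizing constant.\<close>

definition hausdorff_measure :: "('a \<Rightarrow> 'a \<Rightarrow> ennreal) \<Rightarrow> nat \<Rightarrow> 'a set \<Rightarrow> ennreal" where
  "hausdorff_measure d k A =
     (SUP \<delta>\<in>{0<..}. Inf {(\<Sum>i. ediam d (U i) ^ k) | U :: nat \<Rightarrow> 'a set.
        A \<subseteq> (\<Union>i. U i) \<and> (\<forall>i. ediam d (U i) \<le> \<delta>)})"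

end

theory Submission
  imports Defs
begin

text \<open>
  The open set is \<open>M\<close> itself, and both families of eigenfunctions are explicit.

  The functions \<open>sin (sqrt (2 * pi) * k * x)\<close> depend on \<open>x\<close> only. Their eigenvalue is
  \<open>2 * pi * k\<^sup>2\<close>, and their nodal set consists of \<open>2 * k\<close> vertical planes \<open>x = const\<close>. Such a
  plane has finite three-dimensional measure: inside it the distance is bounded by a
  multiple of \<open>\<bar>y' - y\<bar> + sqrt \<bar>w' - w\<bar>\<close> with \<open>w = z + x * y\<close>, so \<open>N ^ 3\<close> boxes of diameter at most a
  constant times \<open>1 / N\<close> cover it. Hence the nodal set has measure at most a constant times \<open>k\<close>
  (\<open>hausdorff_measure_vertical_planes_le\<close>, \<open>nodal_set_sine\<close>).

  The second family oscillates in \<open>z\<close>. The function \<open>exp (- n * x\<^sup>2 / 2) * cos (n * z)\<close> satisfies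
  \<open>X1\<^sup>2 u + Y1\<^sup>2 u = - n * u\<close>, because the Gaussian is the ground state of the harmonic oscillator
  \<open>- f'' + n\<^sup>2 * x\<^sup>2 * f\<close>. Summing its translates over the lattice gives a theta series on \<open>M\<close> with
  eigenvalue \<open>n\<close>. The series stays concentrated near the walls \<open>x = sqrt (2 * pi) * j\<close>: for
  \<open>0 \<le> x \<le> sqrt (2 * pi) / 4\<close> the original term dominates all others
  (\<open>theta_dominant_term\<close>), and the nodal set there is a stack of sheets close to planes \<open>z = const\<close>, at
  mutual distance about \<open>pi / n\<close> in \<open>z\<close>. Away from \<open>x = 0\<close> these sheets are transversal to the field \<open>Y1\<close>. The map
  \<open>(x, y, z) \<mapsto> (x, z + x * y)\<close> is constant along \<open>Y1\<close> and sends a small piece of diameter \<open>r\<close> into a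
  parallelogram of area at most \<open>8 * r ^ 3\<close>, so a set that meets every fibre over a rectangle in \<open>K\<close>
  separated points has measure at least a constant times \<open>K\<close> (\<open>hausdorff_measure_sheets_ge\<close>). With
  \<open>K\<close> proportional to \<open>n\<close> this is the bound by the eigenvalue.

  Two general facts carry these computations. Lower bounds for the distance need that a curve cannot
  move without paying for it in the integral of its speed, and the speed is only given through the
  pointwise derivative of an absolutely continuous curve. This is Lebesgue's theorem: such a function
  is differentiable almost everywhere and is the integral of its derivative
  (\<open>abs_continuous_differentiable_ae\<close>, \<open>abs_continuous_has_integral\<close>), proved with Vitali coverings
  and gauge integrals. And a smooth function that solves the eigenvalue equation pointwise is an
  eigenfunction of the Friedrichs extension (\<open>smooth_sub_laplacian\<close>): since \<open>M\<close> is compact, smooth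
  functions are test functions, and integration by parts against them passes to the limit.
\<close>

section \<open>Absolutely continuous functions of one variable\<close>

text \<open>The families of intervals over which the definition of absolute continuity quantifies.\<close>

definition small_family :: "real \<Rightarrow> real \<Rightarrow> real \<Rightarrow> (real \<times> real) set \<Rightarrow> bool" where
  "small_family a b d D \<longleftrightarrow> finite D \<and> (\<forall>(s, t)\<in>D. a \<le> s \<and> s \<le> t \<and> t \<le> b) \<and>
     pairwise (\<lambda>(s, t) (s', t'). {s<..<t} \<inter> {s'<..<t'} = {}) D \<and> (\<Sum>(s, t)\<in>D. t - s) < d"

lemma abs_continuous_iff:
  "abs_continuous_on_interval a b f \<longleftrightarrow>
    (\<forall>e>0. \<exists>d>0. \<forall>D. small_family a b d D \<longrightarrow> (\<Sum>(s, t)\<in>D. dist (f s) (f t)) < e)"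
  unfolding abs_continuous_on_interval_def small_family_def conj_assoc by (rule refl)

abbreviation incr :: "(real \<Rightarrow> real) \<Rightarrow> real set \<Rightarrow> real" where
  "incr f k \<equiv> f (Sup k) - f (Inf k)"

text \<open>Divisions in the sense of gauge integration are the convenient families of non-overlapping
  intervals: they can be extended and refined, and increments telescope over them.\<close>

lemma abs_continuous_divisionD:
  fixes f :: "real \<Rightarrow> real"
  assumes "abs_continuous_on_interval a b f" and "0 < e"
  obtains d where "0 < d"
    "\<And>p. p division_of \<Union>p \<Longrightarrow> \<Union>p \<subseteq> {a..b} \<Longrightarrow> (\<Sum>k\<in>p. Sup k - Inf k) < d \<Longrightarrow> (\<Sum>k\<in>p. \<bar>incr f k\<bar>) < e"
proof -
  obtain d where d: "d > 0" "\<And>D. small_family a b d D \<Longrightarrow> (\<Sum>(s, t)\<in>D. dist (f s) (f t)) < e"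
    using assms unfolding abs_continuous_iff by blast
  have "(\<Sum>k\<in>p. \<bar>incr f k\<bar>) < e"
    if p: "p division_of \<Union>p" and sub: "\<Union>p \<subseteq> {a..b}" and len: "(\<Sum>k\<in>p. Sup k - Inf k) < d" for p
  proof -
    have k: "\<exists>s t. k = {s..t} \<and> s \<le> t \<and> Inf k = s \<and> Sup k = t" if kp: "k \<in> p" for k
    proof -
      obtain s t where st: "k = cbox s t" using division_ofD(4)[OF p kp] by blast
      have "k \<noteq> {}" using division_ofD(3)[OF p kp] .
      then show ?thesis using st by (auto simp: cbox_interval)
    qed
    define g where "g = (\<lambda>k::real set. (Inf k, Sup k))"
    have inj: "inj_on g p"
    proof (rule inj_onI)
      fix k l assume "k \<in> p" "l \<in> p" "g k = g l"
      then show "k = l" using k[of k] k[of l] unfolding g_def by auto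
    qed
    have "(\<Sum>(s, t)\<in>g ` p. dist (f s) (f t)) < e"
    proof (rule d(2), unfold small_family_def, intro conjI)
      show "finite (g ` p)" using division_ofD(1)[OF p] by simp
      show "\<forall>(s, t)\<in>g ` p. a \<le> s \<and> s \<le> t \<and> t \<le> b"
      proof (rule ballI)
        fix z assume "z \<in> g ` p"
        then obtain l where l: "l \<in> p" "z = (Inf l, Sup l)" unfolding g_def by blast
        have "l \<subseteq> {a..b}" using l(1) sub by blast
        moreover obtain s t where "l = {s..t}" "s \<le> t" using k[OF l(1)] by blast
        ultimately show "case z of (s, t) \<Rightarrow> a \<le> s \<and> s \<le> t \<and> t \<le> b" using l(2) by auto
      qed
      show "pairwise (\<lambda>(s, t) (s', t'). {s<..<t} \<inter> {s'<..<t'} = {}) (g ` p)"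
      proof (rule pairwiseI)
        fix z w assume "z \<in> g ` p" "w \<in> g ` p" "z \<noteq> w"
        then obtain k' l where kl: "k' \<in> p" "l \<in> p" "k' \<noteq> l" and zw: "z = (Inf k', Sup k')" "w = (Inf l, Sup l)"
          unfolding g_def by blast
        obtain s t s' t' where "k' = {s..t}" "s \<le> t" "l = {s'..t'}" "s' \<le> t'" using k[OF kl(1)] k[OF kl(2)] by blast
        then show "(case z of (s, t) \<Rightarrow> \<lambda>(s', t'). {s<..<t} \<inter> {s'<..<t'} = {}) w"
          using division_ofD(5)[OF p kl] zw by simp
      qed
      have "(\<Sum>(s, t)\<in>g ` p. t - s) = (\<Sum>k\<in>p. Sup k - Inf k)"
        by (subst sum.reindex[OF inj]) (simp add: g_def)
      then show "(\<Sum>(s, t)\<in>g ` p. t - s) < d" using len by simp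
    qed
    moreover have "(\<Sum>(s, t)\<in>g ` p. dist (f s) (f t)) = (\<Sum>k\<in>p. \<bar>incr f k\<bar>)"
      by (subst sum.reindex[OF inj]) (simp add: g_def dist_real_def abs_minus_commute)
    ultimately show ?thesis by simp
  qed
  then show ?thesis using that[OF d(1)] by blast
qed

lemma sum_incr_division:
  fixes f :: "real \<Rightarrow> real"
  assumes p: "p division_of {a..b}" and "a \<le> b"
  shows "(\<Sum>k\<in>p. incr f k) = f b - f a"
proof -
  have k: "\<exists>s t. k = {s..t} \<and> s \<le> t \<and> Inf k = s" if kp: "k \<in> p" for k
  proof -
    obtain s t where st: "k = cbox s t" using division_ofD(4)[OF p kp] by blast
    have "k \<noteq> {}" using division_ofD(3)[OF p kp] .
    then show ?thesis using st by (auto simp: cbox_interval)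
  qed
  have "(\<lambda>k. (Inf k, k)) ` p tagged_division_of {a..b}"
  proof (rule tagged_division_ofI)
    show "finite ((\<lambda>k. (Inf k, k)) ` p)" using division_ofD(1)[OF p] by simp
    show "\<Union> {K. \<exists>x. (x, K) \<in> (\<lambda>k. (Inf k, k)) ` p} = {a..b}"
      using division_ofD(6)[OF p] by (auto simp: image_iff)
  next
    fix x K assume xK: "(x, K) \<in> (\<lambda>k. (Inf k, k)) ` p"
    then have K: "K \<in> p" "x = Inf K" by auto
    obtain s t where "K = {s..t}" "s \<le> t" using k[OF K(1)] by blast
    then show "x \<in> K" using K(2) by simp
    show "K \<subseteq> {a..b}" using division_ofD(2)[OF p K(1)] .
    show "\<exists>a b. K = cbox a b" using division_ofD(4)[OF p K(1)] .
    fix y L assume "(y, L) \<in> (\<lambda>k. (Inf k, k)) ` p" "(x, K) \<noteq> (y, L)"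
    then have "L \<in> p" "K \<noteq> L" using K by auto
    then show "interior K \<inter> interior L = {}" using division_ofD(5)[OF p K(1)] by blast
  qed
  from additive_tagged_division_1[OF assms(2) this, of f]
  show ?thesis by (subst (asm) sum.reindex) (auto simp: inj_on_def)
qed

text \<open>Extend \<open>D1\<close> to a division of the whole interval, replace its members by \<open>D2\<close>, and extend again: the
  increments over both divisions telescope to the same value, and \<open>G\<close> consists of the newly added intervals.\<close>

lemma division_gaps:
  fixes D1 D2 :: "real set set"
  assumes D1: "D1 division_of \<Union>D1" "\<Union>D1 \<subseteq> {a..b}" and "a \<le> b"
    and D2: "D2 division_of \<Union>D2" "\<And>J. J \<in> D2 \<Longrightarrow> \<exists>I\<in>D1. J \<subseteq> I" "\<And>J. J \<in> D2 \<Longrightarrow> interior J \<noteq> {}"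
  obtains G where "G division_of \<Union>G" "\<Union>G \<subseteq> {a..b}"
    "\<And>f :: real \<Rightarrow> real. (\<Sum>k\<in>D1. incr f k) = (\<Sum>k\<in>D2. incr f k) + (\<Sum>k\<in>G. incr f k)"
proof -
  have "{{a..b}} division_of {a..b}" using division_of_self[of a b] \<open>a \<le> b\<close> by (simp add: cbox_interval)
  then obtain q where q: "D1 \<subseteq> q" "q division_of {a..b}"
    using partial_division_extend[OF D1(1) _ D1(2)] by blast
  have disj: "interior J \<inter> interior K = {}" if "J \<in> D2" "K \<in> q - D1" for J K
  proof -
    obtain I where I: "I \<in> D1" "J \<subseteq> I" using D2(2) \<open>J \<in> D2\<close> by blast
    then have "interior I \<inter> interior K = {}" using division_ofD(5)[OF q(2), of I K] q(1) that by auto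
    then show ?thesis using interior_mono[OF I(2)] by blast
  qed
  have D2D: "finite D2" "\<And>K. K \<in> D2 \<Longrightarrow> K \<noteq> {} \<and> (\<exists>a b. K = cbox a b)"
    "\<And>K L. K \<in> D2 \<Longrightarrow> L \<in> D2 \<Longrightarrow> K \<noteq> L \<Longrightarrow> interior K \<inter> interior L = {}"
    using division_ofD[OF D2(1)] by auto
  have qD: "finite q" "\<And>K. K \<in> q \<Longrightarrow> K \<noteq> {} \<and> (\<exists>a b. K = cbox a b)" "\<Union>q = {a..b}"
    "\<And>K L. K \<in> q \<Longrightarrow> L \<in> q \<Longrightarrow> K \<noteq> L \<Longrightarrow> interior K \<inter> interior L = {}"
    using division_ofD[OF q(2)] by auto
  let ?p = "D2 \<union> (q - D1)"
  have p: "?p division_of \<Union>?p"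
    
  proof (rule division_ofI)
    show "interior K \<inter> interior L = {}" if "K \<in> ?p" "L \<in> ?p" "K \<noteq> L" for K L
      using that D2D(3)[of K L] qD(4)[of K L] disj[of K L] disj[of L K] by (auto simp: Int_commute)
    show "finite ?p" using D2D(1) qD(1) by simp
    show "K \<noteq> {}" "\<exists>a b. K = cbox a b" if "K \<in> ?p" for K
      using that D2D(2)[of K] qD(2)[of K] by auto
  qed auto
  have sub: "\<Union>?p \<subseteq> {a..b}" using D2(2) D1(2) qD(3) by blast
  obtain r where r: "?p \<subseteq> r" "r division_of {a..b}"
    using partial_division_extend[OF p \<open>{{a..b}} division_of {a..b}\<close> sub] by blast
  have fin: "finite r" using division_ofD(1)[OF r(2)] .
  show ?thesis
  proof (rule that[of "r - ?p"])
    show "r - ?p division_of \<Union>(r - ?p)" using r(2) by (meson Diff_subset division_of_subset division_of_union_self)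
    show "\<Union>(r - ?p) \<subseteq> {a..b}" using division_ofD(6)[OF r(2)] by auto
    fix f :: "real \<Rightarrow> real"
    have "D2 \<inter> (q - D1) = {}" using disj D2(3) by blast
    then have "(\<Sum>k\<in>r. incr f k) = (\<Sum>k\<in>D2. incr f k) + (\<Sum>k\<in>q - D1. incr f k) + (\<Sum>k\<in>r - ?p. incr f k)"
      using r(1) fin D2D(1) qD(1) by (simp add: sum.subset_diff[of ?p r] sum.union_disjoint)
    moreover have "(\<Sum>k\<in>q. incr f k) = (\<Sum>k\<in>D1. incr f k) + (\<Sum>k\<in>q - D1. incr f k)"
      using q(1) qD(1) by (simp add: sum.subset_diff[of D1 q])
    ultimately show "(\<Sum>k\<in>D1. incr f k) = (\<Sum>k\<in>D2. incr f k) + (\<Sum>k\<in>r - ?p. incr f k)"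
      using sum_incr_division[OF q(2) \<open>a \<le> b\<close>, of f] sum_incr_division[OF r(2) \<open>a \<le> b\<close>, of f] by simp
  qed
qed

text \<open>Vitali's covering theorem, cut down to finitely many intervals at the price of an arbitrarily small
  part of \<open>S\<close>. The predicate \<open>R\<close> records the property for which the intervals were selected.\<close>

lemma vitali_finite:
  fixes S :: "real set"
  assumes S: "S \<in> lmeasurable" and "0 < e"
    and R: "\<And>x d. x \<in> S \<Longrightarrow> 0 < d \<Longrightarrow> \<exists>s t. s \<le> x \<and> x \<le> t \<and> s < t \<and> t - s < d \<and> R s t"
  obtains D where "D division_of \<Union>D" "\<And>k. k \<in> D \<Longrightarrow> \<exists>s t. k = {s..t} \<and> s < t \<and> R s t"
    "measure lebesgue S - e < measure lebesgue (S \<inter> \<Union>D)"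
    "(\<Sum>k\<in>D. Sup k - Inf k) = measure lebesgue (\<Union>D)"
proof -
  define mid where "mid = (\<lambda>(s::real, t). (s + t) / 2)"
  define rad where "rad = (\<lambda>(s::real, t). (t - s) / 2)"
  define K where "K = {(s, t). s < t \<and> R s t}"
  have cb: "cball (mid i) (rad i) = {fst i..snd i}" if "i \<in> K" for i
    using that by (auto simp: K_def mid_def rad_def cball_eq_atLeastAtMost field_simps)
  obtain C where C: "countable C" "C \<subseteq> K" 
    "pairwise (\<lambda>i j. disjnt (cball (mid i) (rad i)) (cball (mid j) (rad j))) C"
    "negligible (S - (\<Union>i\<in>C. cball (mid i) (rad i)))"
  proof (rule Vitali_covering_theorem_cballs[of K rad S mid])
    show "0 < rad i" if "i \<in> K" for i using that by (auto simp: K_def rad_def)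
    show "\<exists>i. i \<in> K \<and> x \<in> cball (mid i) (rad i) \<and> rad i < d" if "x \<in> S" "0 < d" for x d
    proof -
      obtain s t where st: "s \<le> x" "x \<le> t" "s < t" "t - s < d" "R s t" using R \<open>x \<in> S\<close> \<open>0 < d\<close> by blast
      then have "(s, t) \<in> K" by (simp add: K_def)
      moreover have "rad (s, t) < d" using st by (simp add: rad_def)
      ultimately show ?thesis using st cb[of "(s,t)"] by fastforce
    qed
  qed
  define I where "I = (\<lambda>i::real\<times>real. {fst i..snd i})"
  have CI: "cball (mid i) (rad i) = I i" if "i \<in> C" for i using cb[of i] C(2) that unfolding I_def by blast
  have neg: "negligible (S - (\<Union>i\<in>C. I i))" using C(4) CI by simp
  have dj: "I i \<inter> I j = {}" if "i \<in> C" "j \<in> C" "i \<noteq> j" for i j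
    using C(3) that CI by (auto simp: pairwise_def disjnt_def)
  obtain F where F: "F \<subseteq> (\<lambda>i. S \<inter> I i) ` C" "finite F"
    "measure lebesgue (\<Union>((\<lambda>i. S \<inter> I i) ` C)) - e < measure lebesgue (\<Union>F)"
  proof (rule measure_countable_Union_approachable[of "(\<lambda>i. S \<inter> I i) ` C" e "measure lebesgue S"])
    show "d \<in> lmeasurable" if "d \<in> (\<lambda>i. S \<inter> I i) ` C" for d
      using that S by (auto simp: I_def intro!: fmeasurable.Int)
    show "measure lebesgue (\<Union>D') \<le> measure lebesgue S"
      if "D' \<subseteq> (\<lambda>i. S \<inter> I i) ` C" "finite D'" for D'
      using that S by (intro measure_mono_fmeasurable) (auto simp: I_def intro!: fmeasurableD fmeasurable.Int sets.finite_Union)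
  qed (use C(1) \<open>0 < e\<close> in auto)
  have meq: "measure lebesgue (\<Union>((\<lambda>i. S \<inter> I i) ` C)) = measure lebesgue S"
    by (rule measure_negligible_symdiff[OF S], rule negligible_subset[OF neg]) blast
  obtain C' where C': "C' \<subseteq> C" "finite C'" "F = (\<lambda>i. S \<inter> I i) ` C'"
    using F(1,2) by (meson finite_subset_image)
  have C'K: "fst i < snd i \<and> R (fst i) (snd i)" if "i \<in> C'" for i
    using that C'(1) C(2) by (auto simp: K_def)
  let ?D = "I ` C'"
  have div: "?D division_of \<Union>?D"
  proof (rule division_ofI)
    fix k assume "k \<in> ?D"
    then obtain i where i: "i \<in> C'" "k = I i" by blast
    show "k \<noteq> {}" using i C'K[of i] by (auto simp: I_def)
    show "\<exists>a b. k = cbox a b" using i by (auto simp: I_def cbox_interval)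
    show "k \<subseteq> \<Union>?D" using i by blast
    fix l assume "l \<in> ?D" "k \<noteq> l"
    then obtain j where "j \<in> C'" "l = I j" "i \<noteq> j" using i by blast
    then have "k \<inter> l = {}" using i dj[of i j] C'(1) by blast
    then show "interior k \<inter> interior l = {}" using interior_subset[of k] interior_subset[of l] by blast
  qed (use C'(2) in auto)
  show ?thesis
  proof (rule that[OF div])
    show "\<exists>s t. k = {s..t} \<and> s < t \<and> R s t" if "k \<in> ?D" for k
      using that C'K by (auto simp: I_def)
    show "measure lebesgue S - e < measure lebesgue (S \<inter> \<Union>?D)"
    proof -
      have "S \<inter> \<Union>?D = \<Union>F" unfolding C'(3) by blast
      then show ?thesis using F(3) unfolding meq by simp
    qed
    have "(\<Sum>k\<in>?D. Sup k - Inf k) = (\<Sum>k\<in>?D. measure lebesgue k)"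
      using C'K by (intro sum.cong) (auto simp: I_def less_imp_le)
    also have "\<dots> = measure lebesgue (\<Union>?D)"
      using content_division[OF div] .
    finally show "(\<Sum>k\<in>?D. Sup k - Inf k) = measure lebesgue (\<Union>?D)" .
  qed
qed

text \<open>The points that lie in arbitrarily short intervals with a given property. Taking them interior to the
  intervals makes this set a countable intersection of open sets.\<close>

definition often :: "(real \<Rightarrow> real \<Rightarrow> bool) \<Rightarrow> real set" where
  "often R = {x. \<forall>d>0. \<exists>s t. s < x \<and> x < t \<and> t - s < d \<and> R s t}"

lemma often_borel: "often R \<in> sets borel"
proof -
  have "often R = (\<Inter>n. \<Union>{{s<..<t} | s t. t - s < inverse (real (Suc n)) \<and> R s t})" (is "_ = ?B")
  proof (intro set_eqI iffI)
    fix x assume "x \<in> often R"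
    show "x \<in> ?B"
    proof (rule INT_I)
      fix n
      have "0 < inverse (real (Suc n))" by simp
      then obtain s t where "s < x" "x < t" "t - s < inverse (real (Suc n)) \<and> R s t"
        using \<open>x \<in> often R\<close> unfolding often_def by blast
      then show "x \<in> \<Union>{{s<..<t} | s t. t - s < inverse (real (Suc n)) \<and> R s t}"
        by (intro UnionI[of "{s<..<t}"]) (blast, simp)
    qed
  next
    fix x assume x: "x \<in> ?B"
    show "x \<in> often R" unfolding often_def
    proof clarify
      fix d :: real assume "0 < d"
      then obtain n where n: "inverse (real (Suc n)) < d" using reals_Archimedean by blast
      have "x \<in> \<Union>{{s<..<t} | s t. t - s < inverse (real (Suc n)) \<and> R s t}" using x by blast
      then obtain s t where "x \<in> {s<..<t}" "t - s < inverse (real (Suc n))" "R s t" by blast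
      then have "s < x \<and> x < t \<and> t - s < d \<and> R s t" using n by (simp del: of_nat_Suc add: less_trans)
      then show "\<exists>s t. s < x \<and> x < t \<and> t - s < d \<and> R s t" by blast
    qed
  qed
  moreover have "\<Union>{{s<..<t} | s t. t - s < inverse (real (Suc n)) \<and> R s t} \<in> sets borel" for n
    by (rule borel_open, rule open_Union) auto
  ultimately show ?thesis by simp
qed

text \<open>A positive measure \<open>e\<close> of this set is impossible. Cover it, up to a small part and with little
  excess, by disjoint intervals \<open>D1\<close> on which the slope is below \<open>p\<close>; inside these, cover it again by
  intervals \<open>D2\<close> on which the slope is above \<open>q\<close>. Both families have total length about \<open>e\<close>, so the
  gaps between them are short and contribute little to the increments, by absolute continuity. Thus
  the increment over \<open>D1\<close> is both at most about \<open>p * e\<close> and at least about \<open>q * e\<close>.\<close>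

lemma negligible_oscillation:
  fixes f :: "real \<Rightarrow> real"
  assumes ac: "abs_continuous_on_interval a b f" and "a \<le> b" and pq: "p < q"
  shows "negligible ({a<..<b} \<inter> often (\<lambda>s t. f t - f s < p * (t - s)) \<inter> often (\<lambda>s t. q * (t - s) < f t - f s))"
    (is "negligible ?E")
proof (rule ccontr)
  assume neg: "\<not> negligible ?E"
  have Eb: "?E \<in> sets borel" by (intro sets.Int often_borel) auto
  have Esub: "?E \<subseteq> {a<..<b}" by blast
  have El: "?E \<in> lmeasurable"
    by (rule bounded_set_imp_lmeasurable) (use Eb Esub bounded_subset[of "{a<..<b}"] in auto)
  let ?\<mu> = "measure lebesgue"
  define e where "e = ?\<mu> ?E"
  have e: "e > 0" using neg El by (simp add: e_def negligible_iff_measure zero_less_measure_iff)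
  define \<eta> where "\<eta> = (q - p) * e / 4"
  have "\<eta> > 0" using pq e by (simp add: \<eta>_def)
  then obtain d where d: "d > 0" "\<And>P. P division_of \<Union>P \<Longrightarrow> \<Union>P \<subseteq> {a..b} \<Longrightarrow> (\<Sum>k\<in>P. Sup k - Inf k) < d
      \<Longrightarrow> (\<Sum>k\<in>P. \<bar>incr f k\<bar>) < \<eta>"
    by (rule abs_continuous_divisionD[OF ac]) blast
  \<comment> \<open>The gaps will have total length below \<open>3 * \<delta>\<close>, and \<open>2 * \<delta>\<close> bounds the error in both total lengths.\<close>
  define \<delta> where "\<delta> = min (d / 3) (\<eta> / (2 * (\<bar>p\<bar> + \<bar>q\<bar> + 1)))"
  have \<delta>: "\<delta> > 0" using d \<open>\<eta> > 0\<close> by (simp add: \<delta>_def divide_simps add_nonneg_pos)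
  have d3: "3 * \<delta> \<le> d" by (simp add: \<delta>_def)
  have pq\<delta>: "2 * (\<bar>p\<bar> + \<bar>q\<bar>) * \<delta> \<le> \<eta>"
  proof -
    have "\<delta> \<le> \<eta> / (2 * (\<bar>p\<bar> + \<bar>q\<bar> + 1))" by (simp add: \<delta>_def)
    then have "\<delta> * (2 * (\<bar>p\<bar> + \<bar>q\<bar> + 1)) \<le> \<eta>" by (simp add: pos_le_divide_eq add_nonneg_pos)
    then show ?thesis using \<delta> by (simp add: algebra_simps)
  qed
  obtain T where T: "open T" "?E \<subseteq> T" "T - ?E \<in> lmeasurable" "emeasure lebesgue (T - ?E) < ennreal \<delta>"
    using sets_lebesgue_outer_open[of ?E \<delta>] El \<delta> by blast
  define U where "U = T \<inter> {a<..<b}"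
  have U: "open U" "?E \<subseteq> U" "U \<subseteq> {a<..<b}" using T by (auto simp: U_def)
  have Ul: "U \<in> lmeasurable"
    by (rule bounded_set_imp_lmeasurable) (use U bounded_subset[of "{a<..<b}"] in auto)
  have Um: "?\<mu> U < e + \<delta>"
  proof -
    have "?\<mu> (T - ?E) < \<delta>"
      using T(3,4) \<delta> by (simp add: emeasure_eq_measure2 ennreal_less_iff)
    moreover have "?\<mu> (U - ?E) \<le> ?\<mu> (T - ?E)"
      by (rule measure_mono_fmeasurable[OF _ _ T(3)]) (use fmeasurableD[OF Ul] fmeasurableD[OF El] in \<open>auto simp: U_def\<close>)
    moreover have "?\<mu> (U - ?E) = ?\<mu> U - e"
      unfolding e_def by (rule measurable_measure_Diff) (use Ul El U in auto)
    ultimately show ?thesis by linarith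
  qed
  obtain D1 where D1: "D1 division_of \<Union>D1"
    "\<And>k. k \<in> D1 \<Longrightarrow> \<exists>s t. k = {s..t} \<and> s < t \<and> ({s..t} \<subseteq> U \<and> f t - f s < p * (t - s))"
    "?\<mu> ?E - \<delta> < ?\<mu> (?E \<inter> \<Union>D1)" "(\<Sum>k\<in>D1. Sup k - Inf k) = ?\<mu> (\<Union>D1)"
  proof (rule vitali_finite[OF El \<delta>])
    fix x d :: real assume x: "x \<in> ?E" and "0 < d"
    obtain r where r: "r > 0" "ball x r \<subseteq> U" using U x open_contains_ball by blast
    have "0 < min d r" using r \<open>0 < d\<close> by simp
    then obtain s t where st: "s < x" "x < t" "t - s < min d r" "f t - f s < p * (t - s)"
      using x unfolding often_def by blast
    have "{s..t} \<subseteq> ball x r" using st by (auto simp: dist_real_def)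
    then show "\<exists>s t. s \<le> x \<and> x \<le> t \<and> s < t \<and> t - s < d \<and> ({s..t} \<subseteq> U \<and> f t - f s < p * (t - s))"
      using st r(2) by (intro exI[of _ s] exI[of _ t]) auto
  qed blast
  have fD1: "finite D1" using division_ofD(1)[OF D1(1)] .
  have D1U: "\<Union>D1 \<subseteq> U" using D1(2) by blast
  have D1m: "?\<mu> (\<Union>D1) \<le> ?\<mu> U"
    by (rule measure_mono_fmeasurable[OF D1U fmeasurableD[OF lmeasurable_division[OF D1(1)]] Ul])
  have D1l: "\<Union>D1 \<in> lmeasurable" by (rule lmeasurable_division[OF D1(1)])
  \<comment> \<open>Only interior points of members of \<open>D1\<close> have small intervals around them inside that member.\<close>
  define V where "V = (\<Union>k\<in>D1. {Inf k<..<Sup k})"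
  have Vo: "open V" by (auto simp: V_def)
  define E2 where "E2 = ?E \<inter> V"
  have E2l: "E2 \<in> lmeasurable" unfolding E2_def by (rule fmeasurable_Int_fmeasurable[OF El]) (use Vo in simp)
  have E2m: "?\<mu> E2 = ?\<mu> (?E \<inter> \<Union>D1)"
  proof (rule measure_negligible_symdiff)
    show "?E \<inter> \<Union>D1 \<in> lmeasurable" by (rule fmeasurable_Int_fmeasurable[OF El fmeasurableD[OF D1l]])
    have "?E \<inter> \<Union>D1 - E2 \<union> (E2 - ?E \<inter> \<Union>D1) \<subseteq> (\<Union>k\<in>D1. {Inf k, Sup k})"
    proof
      fix x assume x: "x \<in> ?E \<inter> \<Union>D1 - E2 \<union> (E2 - ?E \<inter> \<Union>D1)"
      show "x \<in> (\<Union>k\<in>D1. {Inf k, Sup k})"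
      proof (cases "x \<in> E2")
        case True
        then obtain k where k: "k \<in> D1" "x \<in> {Inf k<..<Sup k}" by (auto simp: E2_def V_def)
        obtain s t where "k = {s..t}" "s < t" using D1(2)[OF k(1)] by blast
        then have "x \<in> k" using k(2) by auto
        then show ?thesis using x True k(1) by (auto simp: E2_def)
      next
        case False
        then obtain k where k: "k \<in> D1" "x \<in> k" "x \<in> ?E" using x by blast
        obtain s t where "k = {s..t}" "s < t" using D1(2)[OF k(1)] by blast
        moreover have "x \<notin> {Inf k<..<Sup k}" using False k by (auto simp: E2_def V_def)
        ultimately have "x = Inf k \<or> x = Sup k" using k(2) by auto
        then show ?thesis using k(1) by blast
      qed
    qed
    moreover have "finite (\<Union>k\<in>D1. {Inf k, Sup k})" using fD1 by blast
    ultimately show "negligible (?E \<inter> \<Union>D1 - E2 \<union> (E2 - ?E \<inter> \<Union>D1))"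
      using negligible_finite negligible_subset by blast
  qed
  obtain D2 where D2: "D2 division_of \<Union>D2"
    "\<And>k. k \<in> D2 \<Longrightarrow> \<exists>s t. k = {s..t} \<and> s < t \<and> ((\<exists>I\<in>D1. {s..t} \<subseteq> I) \<and> q * (t - s) < f t - f s)"
    "?\<mu> E2 - \<delta> < ?\<mu> (E2 \<inter> \<Union>D2)" "(\<Sum>k\<in>D2. Sup k - Inf k) = ?\<mu> (\<Union>D2)"
  proof (rule vitali_finite[OF E2l \<delta>])
    fix x d :: real assume x: "x \<in> E2" and "0 < d"
    obtain k where k: "k \<in> D1" "x \<in> {Inf k<..<Sup k}" using x by (auto simp: E2_def V_def)
    obtain s' t' where st': "k = {s'..t'}" "s' < t'" using D1(2)[OF k(1)] by blast
    define r where "r = min (x - s') (t' - x)"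
    have r: "r > 0" "{x - r..x + r} \<subseteq> k" using k st' by (auto simp: r_def)
    have "0 < min d r" using r \<open>0 < d\<close> by simp
    moreover have "x \<in> often (\<lambda>s t. q * (t - s) < f t - f s)" using x by (simp add: E2_def)
    ultimately obtain s t where st: "s < x" "x < t" "t - s < min d r" "q * (t - s) < f t - f s"
      unfolding often_def by blast
    have "{s..t} \<subseteq> k" using st r(2) by auto
    then show "\<exists>s t. s \<le> x \<and> x \<le> t \<and> s < t \<and> t - s < d \<and> ((\<exists>I\<in>D1. {s..t} \<subseteq> I) \<and> q * (t - s) < f t - f s)"
      using st k(1) by (intro exI[of _ s] exI[of _ t]) auto
  qed blast
  have D2l: "\<Union>D2 \<in> lmeasurable" by (rule lmeasurable_division[OF D2(1)])
  have "?\<mu> (E2 \<inter> \<Union>D2) \<le> ?\<mu> (\<Union>D2)"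
    by (rule measure_mono_fmeasurable[OF Int_lower2 _ D2l], rule fmeasurableD, rule fmeasurable_Int_fmeasurable[OF E2l fmeasurableD[OF D2l]])
  then have m2: "e - 2 * \<delta> < ?\<mu> (\<Union>D2)" using D2(3) E2m D1(3) by (simp add: e_def)
  have "?\<mu> (?E \<inter> \<Union>D1) \<le> ?\<mu> (\<Union>D1)"
    by (rule measure_mono_fmeasurable[OF Int_lower2 _ D1l], rule fmeasurableD, rule fmeasurable_Int_fmeasurable[OF El fmeasurableD[OF D1l]])
  then have m1: "e - \<delta> < ?\<mu> (\<Union>D1)" "?\<mu> (\<Union>D1) < e + \<delta>" using D1(3) D1m Um by (auto simp: e_def)
  have "?\<mu> (\<Union>D2) \<le> ?\<mu> (\<Union>D1)"
    by (rule measure_mono_fmeasurable[OF _ fmeasurableD[OF D2l] D1l]) (use D2(2) in blast)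
  have sub: "\<Union>D1 \<subseteq> {a..b}" using D1U U(3) by (auto simp: subset_iff less_imp_le)
  have int: "interior J \<noteq> {}" if "J \<in> D2" for J
    using D2(2)[OF that] by auto
  have J: "\<exists>I\<in>D1. J \<subseteq> I" if "J \<in> D2" for J using D2(2)[OF that] by blast
  obtain G where G: "G division_of \<Union>G" "\<Union>G \<subseteq> {a..b}"
    "\<And>f :: real \<Rightarrow> real. (\<Sum>k\<in>D1. incr f k) = (\<Sum>k\<in>D2. incr f k) + (\<Sum>k\<in>G. incr f k)"
    using division_gaps[OF D1(1) sub \<open>a \<le> b\<close> D2(1) J int] by blast
  have "(\<Sum>k\<in>G. Sup k - Inf k) = ?\<mu> (\<Union>D1) - ?\<mu> (\<Union>D2)"
    using G(3)[of "\<lambda>x. x"] D1(4) D2(4) by simp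
  then have "(\<Sum>k\<in>G. \<bar>incr f k\<bar>) < \<eta>" using d(2)[OF G(1,2)] m1 m2 d3 by simp
  then have G\<eta>: "- \<eta> < (\<Sum>k\<in>G. incr f k)" using sum_abs[of "incr f" G] by linarith
  have s1: "(\<Sum>k\<in>D1. incr f k) \<le> p * ?\<mu> (\<Union>D1)"
    unfolding D1(4)[symmetric] sum_distrib_left
  proof (rule sum_mono)
    fix k assume "k \<in> D1"
    then show "incr f k \<le> p * (Sup k - Inf k)" using D1(2)[of k] by fastforce
  qed
  have s2: "q * ?\<mu> (\<Union>D2) \<le> (\<Sum>k\<in>D2. incr f k)"
    unfolding D2(4)[symmetric] sum_distrib_left
  proof (rule sum_mono)
    fix k assume "k \<in> D2"
    then show "q * (Sup k - Inf k) \<le> incr f k" using D2(2)[of k] by fastforce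
  qed
  have "q * ?\<mu> (\<Union>D2) - \<eta> < p * ?\<mu> (\<Union>D1)" using s1 s2 G(3)[of f] G\<eta> by linarith
  moreover have "q * e - 2 * \<bar>q\<bar> * \<delta> \<le> q * ?\<mu> (\<Union>D2)"
  proof -
    have "\<bar>q * (?\<mu> (\<Union>D2) - e)\<bar> \<le> \<bar>q\<bar> * (2 * \<delta>)"
      unfolding abs_mult using m1 m2 \<open>?\<mu> (\<Union>D2) \<le> ?\<mu> (\<Union>D1)\<close> \<delta> by (intro mult_left_mono) auto
    then show ?thesis by (simp add: algebra_simps abs_le_iff)
  qed
  moreover have "p * ?\<mu> (\<Union>D1) \<le> p * e + 2 * \<bar>p\<bar> * \<delta>"
  proof -
    have "\<bar>p * (?\<mu> (\<Union>D1) - e)\<bar> \<le> \<bar>p\<bar> * (2 * \<delta>)"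
      unfolding abs_mult using m1 \<delta> by (intro mult_left_mono) auto
    then show ?thesis by (simp add: algebra_simps abs_le_iff)
  qed
  ultimately have "(q - p) * e < 2 * \<eta>" using pq\<delta> by (simp add: algebra_simps)
  then show False using \<open>\<eta> > 0\<close> unfolding \<eta>_def by linarith
qed

text \<open>On an interval shorter than the \<open>d\<close> that belongs to \<open>1\<close> in the definition of absolute continuity, the
  increments over disjoint intervals add up to less than \<open>1\<close>. Disjoint intervals on which the slope
  exceeds \<open>K\<close> therefore have total length below \<open>1 / K\<close>, for every \<open>K\<close>.\<close>

lemma negligible_infinite_slope:
  fixes f :: "real \<Rightarrow> real"
  assumes ac: "abs_continuous_on_interval a b f"
  shows "negligible ({a<..<b} \<inter> (\<Inter>K::nat. often (\<lambda>s t. real K * (t - s) < f t - f s)))"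
    (is "negligible ?E")
proof -
  obtain d where d: "d > 0" "\<And>P. P division_of \<Union>P \<Longrightarrow> \<Union>P \<subseteq> {a..b} \<Longrightarrow> (\<Sum>k\<in>P. Sup k - Inf k) < d
      \<Longrightarrow> (\<Sum>k\<in>P. \<bar>incr f k\<bar>) < 1"
    by (rule abs_continuous_divisionD[OF ac zero_less_one]) blast
  have Eb: "?E \<in> sets borel" by (intro sets.Int sets.countable_INT often_borel) (auto simp: often_borel)
  show ?thesis
    unfolding locally_negligible_alt[of ?E]
  proof (rule ballI)
    fix x assume x: "x \<in> ?E"
    define B where "B = ball x (d / 3)"
    define S where "S = ?E \<inter> B"
    have Sl: "S \<in> lmeasurable"
      by (rule bounded_set_imp_lmeasurable) (use Eb bounded_subset[of B S] in \<open>auto simp: S_def B_def\<close>)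
    have bound: "real K * (measure lebesgue S - e) \<le> 1" if "e > 0" for K e
    proof -
      obtain D where D: "D division_of \<Union>D"
        "\<And>k. k \<in> D \<Longrightarrow> \<exists>s t. k = {s..t} \<and> s < t \<and> ({s..t} \<subseteq> B \<inter> {a<..<b} \<and> real K * (t - s) < f t - f s)"
        "measure lebesgue S - e < measure lebesgue (S \<inter> \<Union>D)" "(\<Sum>k\<in>D. Sup k - Inf k) = measure lebesgue (\<Union>D)"
      proof (rule vitali_finite[OF Sl \<open>e > 0\<close>])
        fix y d' :: real assume y: "y \<in> S" and "0 < d'"
        have "open (B \<inter> {a<..<b})" "y \<in> B \<inter> {a<..<b}" using y by (auto simp: B_def S_def)
        then obtain r where r: "r > 0" "ball y r \<subseteq> B \<inter> {a<..<b}" by (meson open_contains_ball)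
        have "0 < min d' r" "y \<in> often (\<lambda>s t. real K * (t - s) < f t - f s)"
          using r \<open>0 < d'\<close> y by (auto simp: S_def)
        then obtain s t where st: "s < y" "y < t" "t - s < min d' r" "real K * (t - s) < f t - f s"
          unfolding often_def by blast
        have "{s..t} \<subseteq> ball y r" using st by (auto simp: dist_real_def)
        then show "\<exists>s t. s \<le> y \<and> y \<le> t \<and> s < t \<and> t - s < d' \<and> ({s..t} \<subseteq> B \<inter> {a<..<b} \<and> real K * (t - s) < f t - f s)"
          using st r(2) by (intro exI[of _ s] exI[of _ t]) auto
      qed blast
      have Dl: "\<Union>D \<in> lmeasurable" by (rule lmeasurable_division[OF D(1)])
      have DB: "\<Union>D \<subseteq> B" "\<Union>D \<subseteq> {a..b}" using D(2) by fastforce+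
      have "measure lebesgue (\<Union>D) \<le> measure lebesgue B"
        by (rule measure_mono_fmeasurable[OF DB(1) fmeasurableD[OF Dl]]) (simp add: B_def)
      also have "\<dots> < d" using d(1) by (simp add: B_def ball_eq_greaterThanLessThan)
      finally have "(\<Sum>k\<in>D. \<bar>incr f k\<bar>) < 1" using d(2)[OF D(1) DB(2)] D(4) by simp
      moreover have "real K * measure lebesgue (\<Union>D) \<le> (\<Sum>k\<in>D. \<bar>incr f k\<bar>)"
        unfolding D(4)[symmetric] sum_distrib_left
      proof (rule sum_mono)
        fix k assume "k \<in> D"
        then show "real K * (Sup k - Inf k) \<le> \<bar>incr f k\<bar>" using D(2)[of k] by fastforce
      qed
      moreover have "measure lebesgue (S \<inter> \<Union>D) \<le> measure lebesgue (\<Union>D)"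
        by (rule measure_mono_fmeasurable[OF Int_lower2 _ Dl], rule fmeasurableD, rule fmeasurable_Int_fmeasurable[OF Sl fmeasurableD[OF Dl]])
      then have "real K * (measure lebesgue S - e) \<le> real K * measure lebesgue (\<Union>D)"
        using D(3) by (intro mult_left_mono) auto
      ultimately show ?thesis by linarith
    qed
    have "measure lebesgue S = 0"
    proof (rule ccontr)
      assume "measure lebesgue S \<noteq> 0"
      then have pos: "measure lebesgue S > 0" by (simp add: zero_less_measure_iff)
      obtain K where "1 < real K * (measure lebesgue S / 2)" using pos ex_less_of_nat_mult[of "measure lebesgue S / 2" 1] by auto
      then show False using bound[of "measure lebesgue S / 2" K] pos by simp
    qed
    then have "negligible S" using Sl by (simp add: negligible_iff_measure)
    moreover have "openin (top_of_set ?E) S" unfolding S_def B_def by (intro openin_open_Int) auto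
    moreover have "x \<in> S" using x d(1) by (simp add: S_def B_def)
    ultimately show "\<exists>U. openin (top_of_set ?E) U \<and> x \<in> U \<and> negligible U" by blast
  qed
qed

lemma abs_continuous_continuous_on:
  fixes f :: "real \<Rightarrow> real"
  assumes ac: "abs_continuous_on_interval a b f"
  shows "continuous_on {a..b} f"
  unfolding continuous_on_iff
proof clarify
  fix x e :: real assume x: "x \<in> {a..b}" and "0 < e"
  obtain d where d: "d > 0" "\<And>P. P division_of \<Union>P \<Longrightarrow> \<Union>P \<subseteq> {a..b} \<Longrightarrow> (\<Sum>k\<in>P. Sup k - Inf k) < d
      \<Longrightarrow> (\<Sum>k\<in>P. \<bar>incr f k\<bar>) < e"
    by (rule abs_continuous_divisionD[OF ac \<open>0 < e\<close>]) blast
  have "dist (f y) (f x) < e" if y: "y \<in> {a..b}" "dist y x < d" for y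
  proof -
    let ?P = "{cbox (min x y) (max x y)}"
    have "?P division_of \<Union>?P" using division_of_self[of "min x y" "max x y"] by (simp add: min_le_iff_disj)
    moreover have "\<Union>?P \<subseteq> {a..b}" using x y by auto
    moreover have "(\<Sum>k\<in>?P. Sup k - Inf k) < d" using y by (auto simp: dist_real_def min_def max_def)
    ultimately have "(\<Sum>k\<in>?P. \<bar>incr f k\<bar>) < e" by (rule d(2))
    then show ?thesis by (auto simp: dist_real_def min_def max_def split: if_splits)
  qed
  then show "\<exists>d>0. \<forall>x'\<in>{a..b}. dist x' x < d \<longrightarrow> dist (f x') (f x) < e" using d(1) by blast
qed

lemma abs_continuous_lipschitz:
  assumes ac: "abs_continuous_on_interval a b f" and "0 < L"
    and lip: "\<And>s t. dist (g s) (g t) \<le> L * dist (f s) (f t)"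
  shows "abs_continuous_on_interval a b g"
  unfolding abs_continuous_iff
proof (intro allI impI)
  fix e :: real assume "0 < e"
  then have "0 < e / L" using \<open>0 < L\<close> by simp
  then obtain d where d: "0 < d" "\<And>D. small_family a b d D \<Longrightarrow> (\<Sum>(s, t)\<in>D. dist (f s) (f t)) < e / L"
    using ac unfolding abs_continuous_iff by blast
  have "(\<Sum>(s, t)\<in>D. dist (g s) (g t)) < e" if "small_family a b d D" for D
  proof -
    have "L * (\<Sum>(s, t)\<in>D. dist (f s) (f t)) < e" using d(2)[OF that] \<open>0 < L\<close> by (simp add: field_simps)
    moreover have "(\<Sum>(s, t)\<in>D. dist (g s) (g t)) \<le> L * (\<Sum>(s, t)\<in>D. dist (f s) (f t))"
      unfolding sum_distrib_left by (rule sum_mono) (auto intro: lip)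
    ultimately show ?thesis by linarith
  qed
  then show "\<exists>d>0. \<forall>D. small_family a b d D \<longrightarrow> (\<Sum>(s, t)\<in>D. dist (g s) (g t)) < e" using d(1) by blast
qed

lemma abs_continuous_uminus:
  fixes f :: "real \<Rightarrow> real"
  shows "abs_continuous_on_interval a b f \<Longrightarrow> abs_continuous_on_interval a b (\<lambda>x. - f x)"
  by (rule abs_continuous_lipschitz[of a b f 1]) (auto simp: dist_minus)

text \<open>Slopes of intervals ending at \<open>x\<close> are transferred to slightly larger intervals around \<open>x\<close>: the
  inequality is strict and \<open>f\<close> is continuous.\<close>

lemma frequently_slope_imp_often:
  fixes f :: "real \<Rightarrow> real"
  assumes cont: "continuous_on {a..b} f" and x: "x \<in> {a<..<b}"
    and fr: "\<exists>\<^sub>F h in at 0. c < (f (x + h) - f x) / h"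
  shows "x \<in> often (\<lambda>s t. c * (t - s) < f t - f s)"
  unfolding often_def
proof (clarify)
  fix d :: real assume d: "0 < d"
  define r where "r = min (d / 2) (min (x - a) (b - x))"
  have r: "r > 0" using x d by (simp add: r_def)
  have "\<forall>\<^sub>F h in at (0::real). dist h 0 < r \<and> h \<noteq> 0" using r unfolding eventually_at by (intro exI[of _ r]) auto
  from eventually_frequently_simps(1)
  have "\<exists>\<^sub>F h in at 0. c < (f (x + h) - f x) / h \<and> (dist h 0 < r \<and> h \<noteq> 0)"
    using frequently_eventually_frequently[OF fr \<open>\<forall>\<^sub>F h in at (0::real). dist h 0 < r \<and> h \<noteq> 0\<close>] by simp
  then obtain h where h: "c < (f (x + h) - f x) / h" "\<bar>h\<bar> < r" "h \<noteq> 0" using frequently_ex by force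
  define s where "s = min x (x + h)"
  define t where "t = max x (x + h)"
  have st: "s < t" "s \<le> x" "x \<le> t" "a < s" "t < b" "t - s < d / 2"
  proof -
    have "\<bar>h\<bar> < d / 2" "\<bar>h\<bar> < x - a" "\<bar>h\<bar> < b - x" using h by (auto simp: r_def)
    then show "s < t" "s \<le> x" "x \<le> t" "a < s" "t < b" "t - s < d / 2"
      using h x by (auto simp: s_def t_def min_def max_def)
  qed
  have pos: "c * (t - s) < f t - f s"
  proof (cases "h > 0")
    case True
    then show ?thesis using h by (simp add: s_def t_def field_simps)
  next
    case False
    then have "h < 0" using h by simp
    then show ?thesis using h by (simp add: s_def t_def field_simps)
  qed
  have it: "isCont f t" and is': "isCont f s"
    using cont st continuous_on_interior[of "{a..b}" f] by auto
  have "((\<lambda>e. f (t + e) - f (s - e) - c * (t + e - (s - e))) \<longlongrightarrow> f (t + 0) - f (s - 0) - c * (t + 0 - (s - 0))) (at_right 0)"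
    by (intro tendsto_intros isCont_tendsto_compose[of _ f]) (use it is' in auto)
  then have "\<forall>\<^sub>F e in at_right 0. 0 < f (t + e) - f (s - e) - c * (t + e - (s - e))"
    using pos by (intro order_tendstoD(1)) auto
  moreover have "\<forall>\<^sub>F e in at_right 0. e < d / 4 \<and> 0 < e"
    using d by (auto simp: eventually_at_right_field intro!: exI[of _ "d/4"])
  ultimately have "\<forall>\<^sub>F e in at_right 0. 0 < f (t + e) - f (s - e) - c * (t + e - (s - e)) \<and> (e < d / 4 \<and> 0 < e)"
    by (rule eventually_conj)
  then obtain e where e: "0 < f (t + e) - f (s - e) - c * (t + e - (s - e))" "e < d / 4" "0 < e"
    using eventually_happens'[OF trivial_limit_at_right_real] by blast
  show "\<exists>s t. s < x \<and> x < t \<and> t - s < d \<and> c * (t - s) < f t - f s"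
    using e st by (intro exI[of _ "s - e"] exI[of _ "t + e"]) auto
qed

text \<open>If the lower limit were smaller than the upper one, two rational numbers between them would be crossed
  infinitely often.\<close>

lemma nonoscillating_tendsto:
  fixes g :: "'a \<Rightarrow> real"
  assumes F: "F \<noteq> bot"
    and osc: "\<And>p q. p \<in> \<rat> \<Longrightarrow> q \<in> \<rat> \<Longrightarrow> p < q \<Longrightarrow> \<not> (\<exists>\<^sub>F x in F. g x < p) \<or> \<not> (\<exists>\<^sub>F x in F. q < g x)"
    and up: "\<not> (\<exists>\<^sub>F x in F. K < g x)" and lo: "\<not> (\<exists>\<^sub>F x in F. g x < L)"
  shows "\<exists>l. (g \<longlongrightarrow> l) F"
proof -
  let ?g = "\<lambda>x. ereal (g x)"
  have "Liminf F ?g = Limsup F ?g"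
  proof (rule ccontr)
    assume "Liminf F ?g \<noteq> Limsup F ?g"
    then have "Liminf F ?g < Limsup F ?g" using Liminf_le_Limsup[OF F, of ?g] by simp
    then obtain p where p: "Liminf F ?g < ereal (real_of_rat p)" "ereal (real_of_rat p) < Limsup F ?g"
      using ereal_dense3 by blast
    obtain q where q: "ereal (real_of_rat p) < ereal (real_of_rat q)" "ereal (real_of_rat q) < Limsup F ?g"
      using ereal_dense3[OF p(2)] by blast
    have "\<exists>\<^sub>F x in F. g x < real_of_rat p"
    proof (rule ccontr)
      assume "\<not> ?thesis"
      then have "\<forall>\<^sub>F x in F. ereal (real_of_rat p) \<le> ?g x" by (simp add: frequently_def not_less)
      from Liminf_bounded[OF this] show False using p(1) by simp
    qed
    moreover have "\<exists>\<^sub>F x in F. real_of_rat q < g x"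
    proof (rule ccontr)
      assume "\<not> ?thesis"
      then have "\<forall>\<^sub>F x in F. ?g x \<le> ereal (real_of_rat q)" by (simp add: frequently_def not_less)
      from Limsup_bounded[OF this] show False using q(2) by simp
    qed
    ultimately show False using osc[of "real_of_rat p" "real_of_rat q"] q(1) by simp
  qed
  then have lim: "(?g \<longlongrightarrow> Liminf F ?g) F" by (intro tendsto_Liminf[OF F]) simp
  have "ereal L \<le> Liminf F ?g" using lo by (intro Liminf_bounded) (simp add: frequently_def not_less)
  moreover have "Limsup F ?g \<le> ereal K" using up by (intro Limsup_bounded) (simp add: frequently_def not_less)
  moreover define M where "M = Liminf F ?g"
  ultimately have "ereal L \<le> M" "M \<le> ereal K"
    using \<open>Liminf F ?g = Limsup F ?g\<close> by simp_all
  then obtain l where "M = ereal l" by (cases M) auto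
  then show ?thesis using lim by (auto simp: M_def)
qed

text \<open>Off countably many null sets the difference quotients neither oscillate between two rational numbers
  nor are unbounded in either direction.\<close>

theorem abs_continuous_differentiable_ae:
  fixes f :: "real \<Rightarrow> real"
  assumes ac: "abs_continuous_on_interval a b f" and "a \<le> b"
  shows "negligible {x \<in> {a<..<b}. \<not> f differentiable (at x)}"
proof -
  let ?O = "\<lambda>pq. {a<..<b} \<inter> often (\<lambda>s t. f t - f s < fst pq * (t - s)) \<inter> often (\<lambda>s t. snd pq * (t - s) < f t - f s)"
  let ?I = "\<lambda>f. {a<..<b} \<inter> (\<Inter>K::nat. often (\<lambda>s t. real K * (t - s) < f t - f s))"
  let ?Q = "{pq \<in> \<rat> \<times> \<rat>. fst pq < (snd pq :: real)}"
  note ac' = abs_continuous_uminus[OF ac]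
  have cont: "continuous_on {a..b} f" "continuous_on {a..b} (\<lambda>x. - f x)"
    using ac ac' by (auto intro: abs_continuous_continuous_on)
  have "countable ?Q" by (rule countable_subset[of _ "\<rat> \<times> \<rat>"]) (auto intro: countable_rat)
  then have "negligible (\<Union>(?O ` ?Q))"
    by (intro negligible_countable_Union) (auto intro!: negligible_oscillation[OF ac \<open>a \<le> b\<close>])
  then have "negligible (\<Union>(?O ` ?Q) \<union> ?I f \<union> ?I (\<lambda>x. - f x))"
    using negligible_infinite_slope[OF ac] negligible_infinite_slope[OF ac'] by (intro negligible_Un)
  then show ?thesis
  proof (rule negligible_subset)
    show "{x \<in> {a<..<b}. \<not> f differentiable (at x)} \<subseteq> \<Union>(?O ` ?Q) \<union> ?I f \<union> ?I (\<lambda>x. - f x)"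
    proof (rule subsetI, rule ccontr)
    fix x assume x: "x \<in> {x \<in> {a<..<b}. \<not> f differentiable (at x)}" and nx: "x \<notin> \<Union>(?O ` ?Q) \<union> ?I f \<union> ?I (\<lambda>x. - f x)"
    let ?g = "\<lambda>h. (f (x + h) - f x) / h"
    have xab: "x \<in> {a<..<b}" using x by blast
    have neg: "(- f (x + h) - - f x) / h = - ?g h" for h
      by (metis minus_diff_commute minus_diff_eq minus_divide_left uminus_add_conv_diff add.commute diff_minus_eq_add)
    have up: "x \<in> often (\<lambda>s t. c * (t - s) < f t - f s)" if "\<exists>\<^sub>F h in at 0. c < ?g h" for c
      by (rule frequently_slope_imp_often[OF cont(1) xab that])
    have lo: "x \<in> often (\<lambda>s t. (- c) * (t - s) < - f t - - f s)" if "\<exists>\<^sub>F h in at 0. ?g h < c" for c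
      by (rule frequently_slope_imp_often[OF cont(2) xab]) (use that in \<open>simp only: neg, simp\<close>)
    have lo': "x \<in> often (\<lambda>s t. f t - f s < c * (t - s))" if "\<exists>\<^sub>F h in at 0. ?g h < c" for c
    proof -
      have "(\<lambda>s t. (- c) * (t - s) < - f t - - f s) = (\<lambda>s t. f t - f s < c * (t - s))" by (auto simp: fun_eq_iff)
      then show ?thesis using lo[OF that] by simp
    qed
    obtain K where K: "x \<notin> often (\<lambda>s t. real K * (t - s) < f t - f s)" using nx xab by blast
    obtain L where L: "x \<notin> often (\<lambda>s t. real L * (t - s) < - f t - - f s)" using nx xab by blast
    have "\<exists>l. (?g \<longlongrightarrow> l) (at 0)"
    proof (rule nonoscillating_tendsto[where K = "real K" and L = "- real L"])
      show "\<not> (\<exists>\<^sub>F h in at 0. ?g h < p) \<or> \<not> (\<exists>\<^sub>F h in at 0. q < ?g h)" if "p \<in> \<rat>" "q \<in> \<rat>" "p < q" for p q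
      proof (rule ccontr)
        assume "\<not> ?thesis"
        then have "x \<in> ?O (p, q)" using lo'[of p] up[of q] xab by simp
        moreover have "(p, q) \<in> ?Q" using that by simp
        ultimately show False using nx by blast
      qed
      show "\<not> (\<exists>\<^sub>F h in at 0. real K < ?g h)" using K up by blast
      show "\<not> (\<exists>\<^sub>F h in at 0. ?g h < - real L)" using L lo[of "- real L"] by auto
    qed simp
    then have "f differentiable (at x)" unfolding real_differentiable_def DERIV_def by simp
    then show False using x by blast
    qed
  qed
qed

text \<open>The gauge treats the null set \<open>N\<close> of bad points separately. Intervals tagged in \<open>N\<close> lie in an open
  set of small measure, so their increments are small by absolute continuity, and the integrand vanishes
  at their tags; at all other tags the derivative approximates the increment.\<close>

theorem abs_continuous_has_integral:
  fixes f :: "real \<Rightarrow> real"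
  assumes ac: "abs_continuous_on_interval a b f" and "a \<le> b"
  shows "((\<lambda>t. if t \<in> {a<..<b} \<and> f differentiable (at t) then deriv f t else 0) has_integral (f b - f a)) {a..b}"
    (is "(?g has_integral _) _")
  unfolding has_integral_real
proof clarify
  fix e :: real assume e: "0 < e"
  define N where "N = {a, b} \<union> {x \<in> {a<..<b}. \<not> f differentiable (at x)}"
  have N: "negligible N"
    unfolding N_def using abs_continuous_differentiable_ae[OF ac \<open>a \<le> b\<close>] by (intro negligible_Un) auto
  obtain d where d: "d > 0" "\<And>P. P division_of \<Union>P \<Longrightarrow> \<Union>P \<subseteq> {a..b} \<Longrightarrow> (\<Sum>k\<in>P. Sup k - Inf k) < d
      \<Longrightarrow> (\<Sum>k\<in>P. \<bar>incr f k\<bar>) < e / 2"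
    by (rule abs_continuous_divisionD[OF ac half_gt_zero[OF e]]) blast
  obtain U where U: "open U" "N \<subseteq> U" "U - N \<in> lmeasurable" "emeasure lebesgue (U - N) < ennreal d"
    using sets_lebesgue_outer_open[OF negligible_imp_sets[OF N] d(1)] by blast
  have Ul: "U \<in> lmeasurable"
    using fmeasurable.Un[OF U(3) negligible_imp_measurable[OF N]] U(2) by (simp add: Un_absorb2)
  have Ud: "measure lebesgue U < d"
  proof -
    have "measure lebesgue U = measure lebesgue (U - N)"
      by (rule measure_negligible_symdiff[OF U(3)], rule negligible_subset[OF N]) blast
    then show ?thesis using U(3,4) d(1) by (simp add: emeasure_eq_measure2 ennreal_less_iff)
  qed
  define \<epsilon> where "\<epsilon> = e / (2 * (b - a + 1))"
  have \<epsilon>: "\<epsilon> > 0" using e \<open>a \<le> b\<close> by (simp add: \<epsilon>_def)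
  have "\<exists>r>0. \<forall>y. \<bar>y - x\<bar> < r \<longrightarrow> \<bar>f y - f x - ?g x * (y - x)\<bar> \<le> \<epsilon> * \<bar>y - x\<bar>"
    if x: "x \<in> {a..b}" "x \<notin> N" for x
  proof -
    have x': "x \<in> {a<..<b}" "f differentiable (at x)" using x by (auto simp: N_def)
    then have "(f has_derivative (\<lambda>h. h * deriv f x)) (at x)"
      using DERIV_deriv_iff_real_differentiable has_field_derivative_def by (metis (no_types, lifting) ext mult.commute)
    then obtain r where "r > 0" "\<And>y. norm (y - x) < r \<Longrightarrow> norm (f y - f x - (y - x) * deriv f x) \<le> \<epsilon> * norm (y - x)"
      unfolding has_derivative_at_alt using \<epsilon> by blast
    then show ?thesis using x' by (intro exI[of _ r]) (auto simp: mult.commute)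
  qed
  then obtain r where r: "\<And>x. x \<in> {a..b} \<Longrightarrow> x \<notin> N \<Longrightarrow> r x > 0"
    "\<And>x y. x \<in> {a..b} \<Longrightarrow> x \<notin> N \<Longrightarrow> \<bar>y - x\<bar> < r x \<Longrightarrow> \<bar>f y - f x - ?g x * (y - x)\<bar> \<le> \<epsilon> * \<bar>y - x\<bar>"
    by metis
  define \<gamma> where "\<gamma> = (\<lambda>x. if x \<in> N then U else if x \<in> {a..b} then ball x (r x) else UNIV)"
  show "\<exists>\<gamma>. gauge \<gamma> \<and> (\<forall>\<D>. \<D> tagged_division_of {a..b} \<and> \<gamma> fine \<D> \<longrightarrow>
      norm ((\<Sum>(x, k)\<in>\<D>. measure lborel k *\<^sub>R ?g x) - (f b - f a)) < e)"
  proof (intro exI[of _ \<gamma>] conjI allI impI)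
    show "gauge \<gamma>" unfolding gauge_def \<gamma>_def using U r(1) by auto
    fix \<D> assume "\<D> tagged_division_of {a..b} \<and> \<gamma> fine \<D>"
    then have tag: "\<D> tagged_division_of {a..b}" and fine: "\<gamma> fine \<D>" by auto
    have k: "\<exists>s t. k = {s..t} \<and> s \<le> x \<and> x \<le> t \<and> a \<le> s \<and> t \<le> b \<and> {s..t} \<subseteq> \<gamma> x" if xk: "(x, k) \<in> \<D>" for x k
    proof -
      obtain s t where st: "k = cbox s t" using tagged_division_ofD(4)[OF tag xk] by blast
      moreover have "x \<in> k" "k \<subseteq> {a..b}" using tagged_division_ofD(2,3)[OF tag xk] .
      moreover have "k \<subseteq> \<gamma> x" using fine xk by (auto simp: fine_def)
      ultimately show ?thesis by auto
    qed
    let ?A = "{xk \<in> \<D>. fst xk \<in> N}" and ?B = "{xk \<in> \<D>. fst xk \<notin> N}"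
    have fin: "finite \<D>" using tag by blast
    let ?t = "\<lambda>(x, k). measure lborel k *\<^sub>R ?g x - incr f k"
    have eq: "(\<Sum>(x, k)\<in>\<D>. measure lborel k *\<^sub>R ?g x) - (f b - f a) = (\<Sum>xk\<in>?A. ?t xk) + (\<Sum>xk\<in>?B. ?t xk)"
    proof -
      have "(\<Sum>(x, k)\<in>\<D>. measure lborel k *\<^sub>R ?g x) - (f b - f a) = (\<Sum>xk\<in>\<D>. ?t xk)"
        unfolding additive_tagged_division_1[OF \<open>a \<le> b\<close> tag, of f, symmetric] by (simp add: sum_subtractf split_def)
      also have "\<dots> = (\<Sum>xk\<in>?A \<union> ?B. ?t xk)" by (rule sum.cong) auto
      also have "\<dots> = (\<Sum>xk\<in>?A. ?t xk) + (\<Sum>xk\<in>?B. ?t xk)" by (rule sum.union_disjoint) (use fin in auto)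
      finally show ?thesis .
    qed
    have A: "\<bar>\<Sum>xk\<in>?A. ?t xk\<bar> < e / 2"
    proof -
      have ptag: "?A tagged_partial_division_of {a..b}"
        using tag by (metis (no_types, lifting) mem_Collect_eq subsetI tagged_division_of_def tagged_partial_division_subset)
      note tagA = tagged_partial_division_of_Union_self[OF ptag]
      note divA = division_of_tagged_division[OF tagA]
      have sub: "\<Union>(snd ` ?A) \<subseteq> U"
      proof
        fix y assume "y \<in> \<Union>(snd ` ?A)"
        then obtain x l where xl: "(x, l) \<in> \<D>" "x \<in> N" "y \<in> l" by auto
        then show "y \<in> U" using k[OF xl(1)] by (auto simp: \<gamma>_def)
      qed
      have sub2: "\<Union>(snd ` ?A) \<subseteq> {a..b}" using divA tagged_division_ofD(3)[OF tag] by fastforce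
      have "(\<Sum>l\<in>snd ` ?A. Sup l - Inf l) = (\<Sum>l\<in>snd ` ?A. measure lebesgue l)"
        by (rule sum.cong) (use k in \<open>fastforce+\<close>)
      also have "\<dots> = measure lebesgue (\<Union>(snd ` ?A))" by (rule content_division[OF divA])
      also have "\<dots> \<le> measure lebesgue U"
        by (rule measure_mono_fmeasurable[OF sub fmeasurableD[OF lmeasurable_division[OF divA]] Ul])
      finally have "(\<Sum>l\<in>snd ` ?A. \<bar>incr f l\<bar>) < e / 2" using d(2)[OF divA sub2] Ud by simp
      moreover have "(\<Sum>(x, l)\<in>?A. \<bar>incr f l\<bar>) = (\<Sum>l\<in>snd ` ?A. \<bar>incr f l\<bar>)"
      proof -
        have ne: "l \<noteq> {}" if "(x, l) \<in> \<D>" for x l using tagged_division_ofD(2)[OF tag that] by blast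
        \<comment> \<open>\<open>Sup {}\<close> and \<open>Inf {}\<close> are unspecified, so the summand is set to \<open>0\<close> there.\<close>
        let ?d = "\<lambda>l. if l = {} then 0 else \<bar>incr f l\<bar>"
        have "(\<Sum>(x, l)\<in>?A. ?d l) = (\<Sum>l\<in>snd ` ?A. ?d l)"
          by (rule sum.over_tagged_division_lemma[OF tagA]) (auto simp: not_less)
        moreover have "(\<Sum>(x, l)\<in>?A. ?d l) = (\<Sum>(x, l)\<in>?A. \<bar>incr f l\<bar>)"
          by (rule sum.cong) (auto dest: ne)
        moreover have "(\<Sum>l\<in>snd ` ?A. ?d l) = (\<Sum>l\<in>snd ` ?A. \<bar>incr f l\<bar>)"
          by (rule sum.cong) (auto dest: ne)
        ultimately show ?thesis by simp
      qed
      moreover have "\<bar>\<Sum>xk\<in>?A. ?t xk\<bar> \<le> (\<Sum>(x, l)\<in>?A. \<bar>incr f l\<bar>)"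
      proof -
        have "(\<Sum>xk\<in>?A. ?t xk) = (\<Sum>(x, l)\<in>?A. - incr f l)"
          by (rule sum.cong) (auto simp: N_def)
        also have "\<bar>\<dots>\<bar> \<le> (\<Sum>(x, l)\<in>?A. \<bar>incr f l\<bar>)"
          by (rule order_trans[OF sum_abs], rule sum_mono) auto
        finally show ?thesis .
      qed
      ultimately show ?thesis by linarith
    qed
    have B: "\<bar>\<Sum>xk\<in>?B. ?t xk\<bar> \<le> e / 2"
    proof -
      have "\<bar>\<Sum>xk\<in>?B. ?t xk\<bar> \<le> (\<Sum>(x, l)\<in>?B. \<epsilon> * (Sup l - Inf l))"
      proof (rule order_trans[OF sum_abs], rule sum_mono)
        fix xk assume "xk \<in> ?B"
        then obtain x l where xl: "xk = (x, l)" "(x, l) \<in> \<D>" "x \<notin> N" by (cases xk) auto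
        then obtain s t where st: "l = {s..t}" "s \<le> x" "x \<le> t" "a \<le> s" "t \<le> b" "{s..t} \<subseteq> \<gamma> x" using k by blast
        then have xab: "x \<in> {a..b}" by auto
        then have "{s..t} \<subseteq> ball x (r x)" using st(6) xl(3) by (simp add: \<gamma>_def)
        moreover have "s \<in> {s..t}" "t \<in> {s..t}" using st by auto
        ultimately have "dist x s < r x" "dist x t < r x" by (auto simp: subset_iff)
        then have "\<bar>s - x\<bar> < r x" "\<bar>t - x\<bar> < r x" by (auto simp: dist_real_def abs_minus_commute)
        then have "\<bar>f s - f x - ?g x * (s - x)\<bar> \<le> \<epsilon> * (x - s)" "\<bar>f t - f x - ?g x * (t - x)\<bar> \<le> \<epsilon> * (t - x)"
          using r(2)[OF xab xl(3), of s] r(2)[OF xab xl(3), of t] st by auto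
        moreover have "?t xk = (f s - f x - ?g x * (s - x)) - (f t - f x - ?g x * (t - x))"
          using st xl by (simp add: algebra_simps)
        ultimately have "\<bar>?t xk\<bar> \<le> \<epsilon> * (x - s) + \<epsilon> * (t - x)" by linarith
        then show "\<bar>?t xk\<bar> \<le> (case xk of (x, l) \<Rightarrow> \<epsilon> * (Sup l - Inf l))" using st xl by (simp add: algebra_simps)
      qed
      also have "\<dots> \<le> (\<Sum>(x, l)\<in>\<D>. \<epsilon> * (Sup l - Inf l))"
      proof (rule sum_mono2[OF fin])
        fix xk assume "xk \<in> \<D> - ?B"
        then obtain x l where "xk = (x, l)" "(x, l) \<in> \<D>" by (cases xk) auto
        then show "0 \<le> (case xk of (x, l) \<Rightarrow> \<epsilon> * (Sup l - Inf l))" using k[of x l] \<epsilon> by auto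
      qed auto
      also have "\<dots> = \<epsilon> * (\<Sum>(x, l)\<in>\<D>. Sup l - Inf l)" by (simp add: sum_distrib_left split_def)
      also have "\<dots> = \<epsilon> * (b - a)" using additive_tagged_division_1[OF \<open>a \<le> b\<close> tag, of "\<lambda>x. x"] by simp
      also have "\<dots> \<le> e / 2" using e \<open>a \<le> b\<close> by (simp add: \<epsilon>_def field_simps)
      finally show ?thesis .
    qed
    show "norm ((\<Sum>(x, k)\<in>\<D>. measure lborel k *\<^sub>R ?g x) - (f b - f a)) < e"
      unfolding eq using A B by simp
  qed
qed

text \<open>The speed that the definition of length assigns to a curve is arbitrary where the curve is not
  differentiable, hence the exceptional set \<open>N\<close> and an arbitrary function \<open>h\<close>, whose integral is a lower integral.
  The measurable function \<open>\<bar>f'\<bar> / C\<close> lies below \<open>h\<close> almost everywhere; dividing \<open>f'\<close> by \<open>C\<close> keeps the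
  constant out of the integral of \<open>h\<close>.\<close>

theorem abs_continuous_increment_le:
  fixes f :: "real \<Rightarrow> real" and h :: "real \<Rightarrow> ennreal"
  assumes ac: "abs_continuous_on_interval a b f" and "a \<le> b" and "0 < C"
    and N: "negligible N"
    and bound: "\<And>t D. t \<in> {a<..<b} - N \<Longrightarrow> DERIV f t :> D \<Longrightarrow> ennreal \<bar>D\<bar> \<le> ennreal C * h t"
  shows "ennreal \<bar>f b - f a\<bar> \<le> ennreal C * (\<integral>\<^sup>+t\<in>{a..b}. h t \<partial>lborel)"
proof (cases "(\<integral>\<^sup>+t\<in>{a..b}. h t \<partial>lborel) = top")
  case True
  then show ?thesis using \<open>0 < C\<close> by (simp add: ennreal_mult_top)
next
  case False
  define g where "g = (\<lambda>t. if t \<in> {a<..<b} \<and> f differentiable (at t) then deriv f t else 0)"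
  have "(g has_integral (f b - f a)) {a..b}"
    unfolding g_def by (rule abs_continuous_has_integral[OF ac \<open>a \<le> b\<close>])
  moreover have "(\<lambda>x. if x \<in> {a..b} then g x else 0) = g" by (auto simp: g_def fun_eq_iff)
  ultimately have hi: "(g has_integral (f b - f a)) UNIV" using has_integral_restrict_UNIV[of "{a..b}" g] by simp
  have gm: "g \<in> borel_measurable lebesgue" using has_integral_implies_lebesgue_measurable_real[OF hi] by simp
  have le: "ennreal \<bar>g t / C\<bar> \<le> h t * indicator {a..b} t" if "t \<notin> N" for t
  proof (cases "t \<in> {a<..<b} \<and> f differentiable (at t)")
    case True
    then have "DERIV f t :> deriv f t" by (simp add: DERIV_deriv_iff_real_differentiable)
    then have "ennreal \<bar>g t\<bar> \<le> ennreal C * h t" using True bound[of t] that by (simp add: g_def)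
    then have "ennreal (1 / C) * ennreal \<bar>g t\<bar> \<le> ennreal (1 / C) * (ennreal C * h t)" by (rule mult_left_mono) simp
    also have "\<dots> = h t" using \<open>0 < C\<close> by (simp add: mult.assoc[symmetric] ennreal_mult[symmetric])
    finally show ?thesis using True \<open>0 < C\<close> by (simp add: ennreal_mult[symmetric])
  qed (auto simp: g_def)
  have nn: "(\<integral>\<^sup>+t. ennreal \<bar>g t / C\<bar> \<partial>lebesgue) \<le> (\<integral>\<^sup>+t\<in>{a..b}. h t \<partial>lborel)"
  proof -
    have "AE t in lebesgue. t \<notin> N" using N by (intro AE_not_in) (simp add: negligible_iff_null_sets)
    then have "AE t in lebesgue. ennreal \<bar>g t / C\<bar> \<le> h t * indicator {a..b} t" by eventually_elim (rule le)
    then show ?thesis unfolding nn_integral_completion[of lborel "\<lambda>t. h t * indicator {a..b} t", symmetric]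
      by (rule nn_integral_mono_AE)
  qed
  have eq: "(\<integral>\<^sup>+t. ennreal \<bar>g t\<bar> \<partial>lebesgue) = ennreal C * (\<integral>\<^sup>+t. ennreal \<bar>g t / C\<bar> \<partial>lebesgue)"
  proof -
    have "(\<integral>\<^sup>+t. ennreal C * ennreal \<bar>g t / C\<bar> \<partial>lebesgue) = ennreal C * (\<integral>\<^sup>+t. ennreal \<bar>g t / C\<bar> \<partial>lebesgue)"
      by (rule nn_integral_cmult) (use gm in measurable)
    moreover have "ennreal C * ennreal \<bar>g t / C\<bar> = ennreal \<bar>g t\<bar>" for t
      using \<open>0 < C\<close> by (simp add: ennreal_mult[symmetric])
    ultimately show ?thesis by simp
  qed
  have "(\<integral>\<^sup>+t. ennreal \<bar>g t / C\<bar> \<partial>lebesgue) < top" using nn False by (metis less_top top_unique)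
  then have "(\<integral>\<^sup>+t. ennreal \<bar>g t\<bar> \<partial>lebesgue) < top" unfolding eq by (simp add: ennreal_mult_less_top del: abs_divide)
  then have int: "integrable lebesgue g"
    by (intro integrableI_bounded[OF gm]) simp
  have "f b - f a = integral\<^sup>L lebesgue g"
    using has_integral_integral_lebesgue[OF int] hi has_integral_unique by blast
  then have "ennreal \<bar>f b - f a\<bar> \<le> (\<integral>\<^sup>+t. ennreal \<bar>g t\<bar> \<partial>lebesgue)"
    using integral_norm_bound_ennreal[OF int] by simp
  also have "\<dots> \<le> ennreal C * (\<integral>\<^sup>+t\<in>{a..b}. h t \<partial>lborel)" unfolding eq using nn by (rule mult_left_mono) simp
  finally show ?thesis .
qed

section \<open>Displacement along curves of finite length\<close>

lemma abs_continuous_subinterval: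
  assumes ac: "abs_continuous_on_interval a b f" and cd: "a \<le> c" "d \<le> b"
  shows "abs_continuous_on_interval c d f"
proof -
  have "small_family a b r D" if "small_family c d r D" for r D
    using that cd unfolding small_family_def by fastforce
  then show ?thesis using ac unfolding abs_continuous_iff by meson
qed

lemma sr_metric_eq:
  "sr_metric (x, y, z) (a, b, w) = (if w = - x * b then ennreal (a\<^sup>2 + b\<^sup>2) else top)"
proof (cases "w = - x * b")
  case True
  then have "{ennreal (u\<^sub>1\<^sup>2 + u\<^sub>2\<^sup>2) | u\<^sub>1 u\<^sub>2. (a, b, w) = u\<^sub>1 *\<^sub>R X1 (x, y, z) + u\<^sub>2 *\<^sub>R Y1 (x, y, z)} = {ennreal (a\<^sup>2 + b\<^sup>2)}"
    by (auto simp: mult.commute)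
  then show ?thesis unfolding sr_metric_def using True by simp
next
  case False
  then have "{ennreal (u\<^sub>1\<^sup>2 + u\<^sub>2\<^sup>2) | u\<^sub>1 u\<^sub>2. (a, b, w) = u\<^sub>1 *\<^sub>R X1 (x, y, z) + u\<^sub>2 *\<^sub>R Y1 (x, y, z)} = {}"
    by (auto simp: mult.commute)
  then have "sr_metric (x, y, z) (a, b, w) = Inf {}" unfolding sr_metric_def by simp
  then show ?thesis using False by simp
qed

lemma ennreal_sqrt_ennreal: "0 \<le> r \<Longrightarrow> ennreal_sqrt (ennreal r) = ennreal (sqrt r)"
  by (simp add: ennreal_sqrt_def)

text \<open>A horizontal vector over a point with first coordinate \<open>x\<close> is \<open>(a, b, - x * b)\<close>, so that
  \<open>w + c * b = (c - x) * b\<close>; all other vectors have infinite speed.\<close>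

lemma sr_speed_ge:
  defines "speed \<equiv> \<lambda>p v. ennreal_sqrt (sr_metric p v)"
  shows "ennreal \<bar>a\<bar> \<le> speed (x, y, z) (a, b, w)" "ennreal \<bar>b\<bar> \<le> speed (x, y, z) (a, b, w)"
    and "0 < C \<Longrightarrow> \<bar>x - c\<bar> \<le> C \<Longrightarrow> ennreal \<bar>w + c * b\<bar> \<le> ennreal C * speed (x, y, z) (a, b, w)"
proof -
  have "speed (x, y, z) (a, b, w) = (if w = - x * b then ennreal (sqrt (a\<^sup>2 + b\<^sup>2)) else top)"
    unfolding speed_def sr_metric_eq using ennreal_sqrt_ennreal[of "a\<^sup>2 + b\<^sup>2"]
    by (simp del: ennreal_plus) (simp add: ennreal_sqrt_def)
  note * = this
  show "ennreal \<bar>a\<bar> \<le> speed (x, y, z) (a, b, w)" "ennreal \<bar>b\<bar> \<le> speed (x, y, z) (a, b, w)"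
    unfolding * by (auto intro!: ennreal_leI simp: real_le_rsqrt)
  assume C: "0 < C" "\<bar>x - c\<bar> \<le> C"
  show "ennreal \<bar>w + c * b\<bar> \<le> ennreal C * speed (x, y, z) (a, b, w)"
  proof (cases "w = - x * b")
    case True
    have "\<bar>w + c * b\<bar> = \<bar>x - c\<bar> * \<bar>b\<bar>" unfolding abs_mult[symmetric] True by (simp add: algebra_simps abs_minus_commute)
    also have "\<dots> \<le> C * sqrt (a\<^sup>2 + b\<^sup>2)" using C by (intro mult_mono) (auto simp: real_le_rsqrt)
    finally show ?thesis using True C unfolding * by (simp add: ennreal_mult[symmetric] ennreal_leI)
  next
    case False
    then show ?thesis using C unfolding * by (simp add: ennreal_mult_top)
  qed
qed

text \<open>The inclusion of a ball in a box, in left-invariant form. Along the curve \<open>x\<close> stays within \<open>L\<close> of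
  \<open>x0\<close>, and then \<open>z + x0 * y\<close>, whose derivative is \<open>(x0 - x) * y'\<close>, moves at most \<open>L\<close> times the length.\<close>

theorem sr_length_bounds_displacement:
  assumes ac: "abs_continuous_on_interval 0 1 \<gamma>" and len: "sr_length \<gamma> \<le> ennreal L" and L: "0 < L"
    and P: "\<gamma> 0 = (x0, y0, z0)" and Q: "\<gamma> 1 = (x1, y1, z1)"
  shows "\<bar>x1 - x0\<bar> \<le> L" "\<bar>y1 - y0\<bar> \<le> L" "\<bar>z1 - z0 + x0 * (y1 - y0)\<bar> \<le> L\<^sup>2"
proof -
  define x y z where "x = (\<lambda>t. fst (\<gamma> t))" and "y = (\<lambda>t. fst (snd (\<gamma> t)))" and "z = (\<lambda>t. snd (snd (\<gamma> t)))"
  have \<gamma>: "\<gamma> = (\<lambda>t. (x t, y t, z t))" by (simp add: x_def y_def z_def)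
  define Z where "Z = (\<lambda>t. z t + x0 * y t)"
  have dx: "dist (x s) (x t) \<le> dist (\<gamma> s) (\<gamma> t)" for s t unfolding x_def by (rule dist_fst_le)
  have dy: "dist (y s) (y t) \<le> dist (\<gamma> s) (\<gamma> t)" for s t
    unfolding y_def by (rule order_trans[OF dist_fst_le dist_snd_le])
  have dz: "dist (z s) (z t) \<le> dist (\<gamma> s) (\<gamma> t)" for s t
    unfolding z_def by (rule order_trans[OF dist_snd_le dist_snd_le])
  have dZ: "dist (Z s) (Z t) \<le> (1 + \<bar>x0\<bar>) * dist (\<gamma> s) (\<gamma> t)" for s t
  proof -
    have "dist (Z s) (Z t) \<le> \<bar>z s - z t\<bar> + \<bar>x0\<bar> * \<bar>y s - y t\<bar>"
      unfolding abs_mult[symmetric] dist_real_def Z_def by (simp add: algebra_simps)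
    also have "\<dots> \<le> dist (\<gamma> s) (\<gamma> t) + \<bar>x0\<bar> * dist (\<gamma> s) (\<gamma> t)"
      using dy dz by (intro add_mono mult_left_mono) (auto simp: dist_real_def)
    finally show ?thesis by (simp add: algebra_simps)
  qed
  have ax: "abs_continuous_on_interval 0 1 x" using dx by (intro abs_continuous_lipschitz[OF ac zero_less_one]) simp
  have ay: "abs_continuous_on_interval 0 1 y" using dy by (intro abs_continuous_lipschitz[OF ac zero_less_one]) simp
  have az: "abs_continuous_on_interval 0 1 z" using dz by (intro abs_continuous_lipschitz[OF ac zero_less_one]) simp
  have aZ: "abs_continuous_on_interval 0 1 Z"
    by (rule abs_continuous_lipschitz[OF ac, of "1 + \<bar>x0\<bar>"]) (use dZ in auto)
  define N where "N = {t \<in> {0<..<1}. \<not> x differentiable (at t)} \<union> {t \<in> {0<..<1}. \<not> y differentiable (at t)}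
    \<union> {t \<in> {0<..<1}. \<not> z differentiable (at t)}"
  have N: "negligible N" unfolding N_def
    using ax ay az by (intro negligible_Un abs_continuous_differentiable_ae) auto
  define h where "h = (\<lambda>t. ennreal_sqrt (sr_metric (\<gamma> t) (vector_derivative \<gamma> (at t))))"
  have hL: "(\<integral>\<^sup>+t\<in>{0..1}. h t \<partial>lborel) \<le> ennreal L" using len unfolding sr_length_def h_def .
  have D: "\<exists>a b w. DERIV x t :> a \<and> DERIV y t :> b \<and> DERIV z t :> w \<and> vector_derivative \<gamma> (at t) = (a, b, w)"
    if t: "t \<in> {0<..<1} - N" for t
  proof -
    have "x differentiable (at t)" "y differentiable (at t)" "z differentiable (at t)" using t by (auto simp: N_def)
    then obtain a b w where D: "DERIV x t :> a" "DERIV y t :> b" "DERIV z t :> w"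
      unfolding real_differentiable_def by blast
    have "(\<gamma> has_vector_derivative (a, b, w)) (at t)"
      unfolding \<gamma> using D by (intro has_vector_derivative_Pair) (simp_all add: has_real_derivative_iff_has_vector_derivative)
    then show ?thesis using D vector_derivative_at by blast
  qed
  have x_le: "\<bar>x s - x0\<bar> \<le> L" if s: "s \<in> {0..1}" for s
  proof -
    have "ennreal \<bar>x s - x 0\<bar> \<le> ennreal 1 * (\<integral>\<^sup>+t\<in>{0..s}. h t \<partial>lborel)"
    proof (rule abs_continuous_increment_le[OF abs_continuous_subinterval[OF ax] _ _ N])
      fix t D assume t: "t \<in> {0<..<s} - N" "DERIV x t :> D"
      then have "t \<in> {0<..<1} - N" using s by auto
      then obtain a b w where "DERIV x t :> a" "vector_derivative \<gamma> (at t) = (a, b, w)" using D by blast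
      moreover have "a = D" using t(2) \<open>DERIV x t :> a\<close> by (rule DERIV_unique[symmetric])
      ultimately show "ennreal \<bar>D\<bar> \<le> ennreal 1 * h t" using sr_speed_ge(1)[of D] by (simp add: h_def \<gamma>)
    qed (use s in auto)
    also have "\<dots> \<le> (\<integral>\<^sup>+t\<in>{0..1}. h t \<partial>lborel)"
      using s by (auto intro!: nn_integral_mono simp: indicator_def)
    also note hL
    finally show ?thesis using L P by (simp add: x_def)
  qed
  show "\<bar>x1 - x0\<bar> \<le> L" using x_le[of 1] Q by (simp add: x_def)
  have "ennreal \<bar>y 1 - y 0\<bar> \<le> ennreal 1 * (\<integral>\<^sup>+t\<in>{0..1}. h t \<partial>lborel)"
  proof (rule abs_continuous_increment_le[OF ay _ _ N])
    fix t D' assume t: "t \<in> {0<..<1} - N" "DERIV y t :> D'"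
    then obtain a b w where "DERIV y t :> b" "vector_derivative \<gamma> (at t) = (a, b, w)" using D by blast
    moreover have "b = D'" using t(2) \<open>DERIV y t :> b\<close> by (rule DERIV_unique[symmetric])
    ultimately show "ennreal \<bar>D'\<bar> \<le> ennreal 1 * h t" using sr_speed_ge(2)[of D'] by (simp add: h_def \<gamma>)
  qed auto
  also have "\<dots> \<le> ennreal L" using hL by simp
  finally have "ennreal \<bar>y 1 - y 0\<bar> \<le> ennreal L" .
  then show "\<bar>y1 - y0\<bar> \<le> L" using L P Q by (simp add: y_def)
  have "ennreal \<bar>Z 1 - Z 0\<bar> \<le> ennreal L * (\<integral>\<^sup>+t\<in>{0..1}. h t \<partial>lborel)"
  proof (rule abs_continuous_increment_le[OF aZ _ L N])
    fix t D' assume t: "t \<in> {0<..<1} - N" "DERIV Z t :> D'"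
    then obtain a b w where *: "DERIV y t :> b" "DERIV z t :> w" "vector_derivative \<gamma> (at t) = (a, b, w)" using D by blast
    have "DERIV Z t :> w + x0 * b" unfolding Z_def using * by (auto intro!: derivative_eq_intros)
    then have "D' = w + x0 * b" using t(2) DERIV_unique by blast
    moreover have "\<bar>x t - x0\<bar> \<le> L" using x_le t(1) by simp
    ultimately show "ennreal \<bar>D'\<bar> \<le> ennreal L * h t"
      using sr_speed_ge(3)[OF L, of "x t" x0 w b] *(3) by (simp add: h_def \<gamma>)
  qed auto
  also have "\<dots> \<le> ennreal L * ennreal L" using hL by (rule mult_left_mono) simp
  finally have "\<bar>Z 1 - Z 0\<bar> \<le> L\<^sup>2" using L by (simp add: ennreal_mult[symmetric] power2_eq_square)
  then show "\<bar>z1 - z0 + x0 * (y1 - y0)\<bar> \<le> L\<^sup>2" using P Q by (simp add: Z_def y_def z_def algebra_simps)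
qed

section \<open>Hausdorff measure of sets meeting many fibres\<close>

abbreviation period :: real where "period \<equiv> sqrt (2 * pi)"

text \<open>The part of the group in which the sheets are counted: \<open>x\<close> stays away from \<open>0\<close>, where planes
  \<open>z = const\<close> are tangent to the horizontal fields, and the cell is small enough for a short curve in the
  quotient to join only points that are close in the cell.\<close>

definition cell :: "heis set" where
  "cell = {(x, y, z). x \<in> {period / 8..period / 4} \<and> y \<in> {0..period / 2} \<and> z \<in> {- pi / 16..pi / 16}}"

lemma period_sq: "period * period = 2 * pi"
  by simp

lemma period_pos: "period > 0"
  by simp

lemma of_int_multiple_small:
  assumes "\<bar>of_int m * c\<bar> < (c :: real)"
  shows "m = 0"
proof (rule ccontr)
  assume "m \<noteq> 0"
  then have "1 \<le> \<bar>m\<bar>" by simp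
  then have "1 \<le> \<bar>of_int m :: real\<bar>" by (metis of_int_1_le_iff of_int_abs)
  moreover have "c > 0" using assms by (smt (verit) abs_ge_zero)
  ultimately have "c \<le> \<bar>of_int m * c\<bar>" by (simp add: abs_mult)
  then show False using assms by simp
qed

text \<open>A short curve from a lift \<open>g\<cdot>p\<close> to a lift \<open>h\<cdot>q\<close> forces \<open>g = h\<close>: in every coordinate two points of the
  cell and one short displacement together are shorter than a period. The estimates for the
  displacement are invariant under the common left translation, so they hold for \<open>p\<close> and \<open>q\<close>.\<close>

lemma sr_dist_cell:
  assumes p: "(a, b, c) \<in> cell" and q: "(x, y, z) \<in> cell"
    and dist: "sr_dist (proj_mfd (a, b, c)) (proj_mfd (x, y, z)) \<le> ennreal d" and d: "0 \<le> d" "d \<le> 1 / 8"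
  shows "\<bar>x - a\<bar> \<le> d" "\<bar>y - b\<bar> \<le> d" "\<bar>z - c + a * (y - b)\<bar> \<le> d\<^sup>2"
proof -
  have s2: "period > 2" using pi_gt3 by (intro real_less_rsqrt) simp
  have main: "\<bar>x - a\<bar> \<le> L \<and> \<bar>y - b\<bar> \<le> L \<and> \<bar>z - c + a * (y - b)\<bar> \<le> L\<^sup>2"
    if L: "d < L" "L \<le> 1 / 4" for L
  proof -
    have "sr_dist (proj_mfd (a, b, c)) (proj_mfd (x, y, z)) < ennreal L"
      using dist L d by (intro le_less_trans[OF dist]) (simp add: ennreal_less_iff)
    then obtain \<gamma> where \<gamma>: "sr_length \<gamma> < ennreal L" "abs_continuous_on_interval 0 1 \<gamma>"
      "proj_mfd (\<gamma> 0) = proj_mfd (a, b, c)" "proj_mfd (\<gamma> 1) = proj_mfd (x, y, z)"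
      unfolding sr_dist_def Inf_less_iff by blast
    obtain g where g: "g \<in> heis_lattice" "\<gamma> 0 = heis_mult g (a, b, c)" using \<gamma>(3) proj_mfd_eq_iff by metis
    obtain h where h: "h \<in> heis_lattice" "\<gamma> 1 = heis_mult h (x, y, z)" using \<gamma>(4) proj_mfd_eq_iff by metis
    obtain i j k where g': "g = (period * of_int i, period * of_int j, 2 * pi * of_int k)"
      using g(1) unfolding heis_lattice_def by blast
    obtain i' j' k' where h': "h = (period * of_int i', period * of_int j', 2 * pi * of_int k')"
      using h(1) unfolding heis_lattice_def by blast
    have P: "\<gamma> 0 = (period * of_int i + a, period * of_int j + b, 2 * pi * of_int k + c - period * of_int i * b)"
      unfolding g(2) g' by simp
    have Q: "\<gamma> 1 = (period * of_int i' + x, period * of_int j' + y, 2 * pi * of_int k' + z - period * of_int i' * y)"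
      unfolding h(2) h' by simp
    note est = sr_length_bounds_displacement[OF \<gamma>(2) less_imp_le[OF \<gamma>(1)] _ P Q]
    have L0: "0 < L" using L d by simp
    have abxy: "period / 8 \<le> a" "a \<le> period / 4" "period / 8 \<le> x" "x \<le> period / 4" "0 \<le> b" "b \<le> period / 2"
      "0 \<le> y" "y \<le> period / 2" and zc: "- pi / 16 \<le> z" "z \<le> pi / 16" "- pi / 16 \<le> c" "c \<le> pi / 16"
      using p q by (auto simp: cell_def)
    have "\<bar>z - c\<bar> \<le> pi / 8" using zc by linarith
    have "\<bar>of_int (i' - i) * period\<bar> < period"
      using est(1)[OF L0] abxy L s2 by (simp add: algebra_simps abs_le_iff abs_less_iff)
    then have i: "i' = i" using of_int_multiple_small[of "i' - i" period] by simp
    have "\<bar>of_int (j' - j) * period\<bar> < period"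
      using est(2)[OF L0] abxy L s2 by (simp add: algebra_simps abs_le_iff abs_less_iff)
    then have j: "j' = j" using of_int_multiple_small[of "j' - j" period] by simp
    have e3: "\<bar>of_int (k' - k) * (2 * pi) + (z - c + a * (y - b))\<bar> \<le> L\<^sup>2"
      using est(3)[OF L0] i j by (simp add: algebra_simps)
    have "\<bar>a\<bar> \<le> period / 4" "\<bar>y - b\<bar> \<le> period / 2" using abxy s2 by linarith+
    then have "\<bar>a * (y - b)\<bar> \<le> (period / 4) * (period / 2)"
      unfolding abs_mult by (intro mult_mono) auto
    then have "\<bar>a * (y - b)\<bar> \<le> pi / 4" using period_sq by simp
    moreover have "L\<^sup>2 \<le> 1" using L L0 by (simp add: power_le_one)
    ultimately have "\<bar>of_int (k' - k) * (2 * pi)\<bar> < 2 * pi" using e3 \<open>\<bar>z - c\<bar> \<le> pi / 8\<close> pi_gt3 by linarith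
    then have k: "k' = k" using of_int_multiple_small[of "k' - k" "2 * pi"] by simp
    show ?thesis using est(1,2)[OF L0] e3 i j k by (simp add: algebra_simps)
  qed
  \<comment> \<open>The distance is an infimum, so a curve of length below \<open>L\<close> exists only for \<open>L > d\<close>.\<close>
  have lim: "\<forall>\<^sub>F L in at_right d. d < L \<and> L \<le> 1 / 4"
    using d by (auto simp: eventually_at_right_field intro!: exI[of _ "1/4"])
  show "\<bar>x - a\<bar> \<le> d"
    by (rule tendsto_lowerbound[OF tendsto_ident_at[of d "{d<..}"]]) (use lim main in \<open>auto elim!: eventually_mono\<close>)
  show "\<bar>y - b\<bar> \<le> d"
    by (rule tendsto_lowerbound[OF tendsto_ident_at[of d "{d<..}"]]) (use lim main in \<open>auto elim!: eventually_mono\<close>)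
  show "\<bar>z - c + a * (y - b)\<bar> \<le> d\<^sup>2"
    by (rule tendsto_lowerbound[OF tendsto_power[OF tendsto_ident_at[of d "{d<..}"]]]) (use lim main in \<open>auto elim!: eventually_mono\<close>)
qed

lemma shear_box_area:
  fixes a b t0 d :: real
  assumes "0 \<le> d"
  shows "(\<integral>\<^sup>+x. \<integral>\<^sup>+t. indicator {(x, t). \<bar>x - a\<bar> \<le> d \<and> \<bar>t - t0 - (x - a) * b\<bar> \<le> 2 * d\<^sup>2} (x, t) \<partial>lborel \<partial>lborel)
    = ennreal (8 * d ^ 3)"
proof -
  have "(\<integral>\<^sup>+t. indicator {(x, t). \<bar>x - a\<bar> \<le> d \<and> \<bar>t - t0 - (x - a) * b\<bar> \<le> 2 * d\<^sup>2} (x, t) \<partial>lborel)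
      = ennreal (4 * d\<^sup>2) * indicator {a - d..a + d} x" for x
  proof (cases "\<bar>x - a\<bar> \<le> d")
    case True
    let ?m = "t0 + (x - a) * b"
    have "(\<integral>\<^sup>+t. indicator {(x, t). \<bar>x - a\<bar> \<le> d \<and> \<bar>t - t0 - (x - a) * b\<bar> \<le> 2 * d\<^sup>2} (x, t) \<partial>lborel)
        = (\<integral>\<^sup>+t. indicator {?m - 2 * d\<^sup>2..?m + 2 * d\<^sup>2} t \<partial>lborel)"
      by (rule nn_integral_cong) (use True in \<open>auto simp: indicator_def abs_le_iff\<close>)
    also have "\<dots> = ennreal (4 * d\<^sup>2)" by simp
    finally show ?thesis using True by (simp add: abs_le_iff algebra_simps)
  next
    case False
    then show ?thesis by (auto simp: indicator_def)
  qed
  then show ?thesis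
    using assms by (simp add: nn_integral_cmult ennreal_mult[symmetric] power2_eq_square power3_eq_cube algebra_simps)
qed

text \<open>The points \<open>(x, (t - z) / x, z)\<close> are those of the fibre of \<open>(x, y, z) \<mapsto> (x, z + x * y)\<close> over \<open>(x, t)\<close>,
  parametrized by \<open>z\<close>; the fibre meets \<open>Z\<close> once in each of \<open>K\<close> slabs that are separated by gaps of
  height \<open>pi / (32 * K)\<close>. Given a cover by sets \<open>U i\<close> of small diameter \<open>d i\<close>, the image of \<open>U i\<close> lies in a
  parallelogram \<open>B i\<close> of area \<open>8 * (d i) ^ 3\<close>. Because of the gaps one \<open>U i\<close> cannot serve two slabs on the same
  fibre, so each point of the rectangle lies in at least \<open>K\<close> of the \<open>B i\<close>, and integration over the
  rectangle bounds the sum of the areas from below.\<close>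

theorem hausdorff_measure_sheets_ge:
  fixes K :: nat and Z :: "heis_mfd set"
  assumes K: "0 < K"
    and Z: "\<And>x t k. x \<in> {period / 8..period / 4} \<Longrightarrow> t \<in> {0..pi / 16} \<Longrightarrow> k < K \<Longrightarrow>
      \<exists>z\<in>{- (real k + 3 / 4) * pi / (16 * real K)..- (real k + 1 / 4) * pi / (16 * real K)}.
        proj_mfd (x, (t - z) / x, z) \<in> Z"
  shows "ennreal (period * pi / 1024 * real K) \<le> hausdorff_measure sr_dist 3 Z"
proof -
  define \<delta> where "\<delta> = 1 / (16 * real K)"
  have \<delta>: "0 < \<delta>" "\<delta> \<le> 1 / 8" using K by (auto simp: \<delta>_def field_simps)
  let ?C = "period * pi / 1024 * real K"
  have s2: "period > 2" using pi_gt3 by (intro real_less_rsqrt) simp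
  have "ennreal ?C \<le> (\<Sum>i. ediam sr_dist (U i) ^ 3)"
    if cov: "Z \<subseteq> (\<Union>i. U i)" and diam: "\<And>i. ediam sr_dist (U i) \<le> ennreal \<delta>" for U :: "nat \<Rightarrow> heis_mfd set"
  proof -
    define d where "d = (\<lambda>i. enn2real (ediam sr_dist (U i)))"
    have ed: "ediam sr_dist (U i) = ennreal (d i)" for i
      using diam[of i] unfolding d_def by (metis ennreal_enn2real ennreal_less_top le_less_trans)
    have d0: "0 \<le> d i" for i by (simp add: d_def)
    have d\<delta>: "d i \<le> \<delta>" for i using diam[of i] \<delta> unfolding ed by simp
    have dist: "sr_dist q q' \<le> ennreal (d i)" if "q \<in> U i" "q' \<in> U i" for q q' i
      unfolding ed[symmetric] ediam_def using that by (intro SUP_upper2[of q] SUP_upper2[of q']) auto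
    define base where "base = (\<lambda>i. SOME p. p \<in> cell \<and> proj_mfd p \<in> U i)"
    define B where "B = (\<lambda>i. case base i of (a, b, c) \<Rightarrow>
      {(x, t). \<bar>x - a\<bar> \<le> d i \<and> \<bar>t - (c + a * b) - (x - a) * b\<bar> \<le> 2 * (d i)\<^sup>2})"
    have in_B: "(x, z + x * y) \<in> B i" if q: "(x, y, z) \<in> cell" "proj_mfd (x, y, z) \<in> U i" for x y z i
    proof -
      obtain a b c where abc: "base i = (a, b, c)" by (cases "base i")
      have "base i \<in> cell \<and> proj_mfd (base i) \<in> U i"
        unfolding base_def by (rule someI[of _ "(x, y, z)"]) (use q in blast)
      then have p: "(a, b, c) \<in> cell" "proj_mfd (a, b, c) \<in> U i" unfolding abc by auto
      note est = sr_dist_cell[OF p(1) q(1) dist[OF p(2) q(2)] d0 order_trans[OF d\<delta> \<delta>(2)]]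
      \<comment> \<open>Relative to the base point of \<open>U i\<close>, the second coordinate of the map is sheared by \<open>b\<close>.\<close>
      have "z + x * y - (c + a * b) - (x - a) * b = (z - c + a * (y - b)) + (x - a) * (y - b)"
        by (simp add: algebra_simps)
      moreover have "\<bar>(x - a) * (y - b)\<bar> \<le> (d i)\<^sup>2"
        unfolding abs_mult power2_eq_square using est d0 by (intro mult_mono) auto
      ultimately have "\<bar>z + x * y - (c + a * b) - (x - a) * b\<bar> \<le> 2 * (d i)\<^sup>2" using est(3) by linarith
      then show ?thesis using est(1) by (simp add: B_def abc)
    qed
    have count: "ennreal (real K) \<le> (\<Sum>i. indicator (B i) (x, t))"
      if xt: "x \<in> {period / 8..period / 4}" "t \<in> {0..pi / 16}" for x t
    proof -
      have x0: "x > 0" using xt(1) s2 by (auto intro: less_le_trans[of _ "period / 8"])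
      have "\<exists>z. \<exists>i. z \<in> {- (real k + 3 / 4) * pi / (16 * real K)..- (real k + 1 / 4) * pi / (16 * real K)} \<and>
          proj_mfd (x, (t - z) / x, z) \<in> U i" if "k < K" for k
        using Z[OF xt that] cov by blast
      then obtain z i where zi: "\<And>k. k < K \<Longrightarrow> z k \<in> {- (real k + 3 / 4) * pi / (16 * real K)..- (real k + 1 / 4) * pi / (16 * real K)}"
          "\<And>k. k < K \<Longrightarrow> proj_mfd (x, (t - z k) / x, z k) \<in> U (i k)" by metis
      have cell: "(x, (t - z k) / x, z k) \<in> cell" if k: "k < K" for k
      proof -
        have "(real k + 3 / 4) \<le> real K" using k by (simp add: of_nat_less_iff[symmetric] del: of_nat_less_iff)
        then have "(real k + 3 / 4) * pi / (16 * real K) \<le> real K * pi / (16 * real K)"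
          by (intro divide_right_mono mult_right_mono) auto
        also have "\<dots> = pi / 16" using K by simp
        finally have "(real k + 3 / 4) * pi / (16 * real K) \<le> pi / 16" .
        moreover have "- ((real k + 3 / 4) * pi / (16 * real K)) \<le> z k"
          using zi(1)[OF k] unfolding atLeastAtMost_iff mult_minus_left divide_minus_left by (rule conjunct1)
        ultimately have z1: "- pi / 16 \<le> z k" by linarith
        have "0 \<le> (real k + 1 / 4) * pi / (16 * real K)" by simp
        moreover have "z k \<le> - ((real k + 1 / 4) * pi / (16 * real K))"
          using zi(1)[OF k] unfolding atLeastAtMost_iff mult_minus_left divide_minus_left by (rule conjunct2)
        ultimately have z2: "z k \<le> 0" by linarith
        have "t - z k \<le> pi / 8" using z1 xt(2) by simp
        also have "\<dots> = (period / 2) * (period / 8)" using period_sq by simp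
        also have "\<dots> \<le> (period / 2) * x" using xt(1) by (intro mult_left_mono) auto
        finally have "(t - z k) / x \<le> period / 2" using x0 by (simp add: divide_le_eq)
        moreover have "0 \<le> (t - z k) / x" using z2 xt(2) x0 by simp
        ultimately show ?thesis using z1 z2 xt(1) pi_gt_zero by (simp add: cell_def)
      qed
      \<comment> \<open>Two zeros on the same fibre differ in \<open>y\<close> by more than the diameter of a covering set.\<close>
      have "inj_on i {..<K}"
      proof (rule linorder_inj_onI)
        fix k l assume kl: "k < l" "k \<in> {..<K}" "l \<in> {..<K}"
        show "i k \<noteq> i l"
        proof
          assume eq: "i k = i l"
          have k: "k < K" and l: "l < K" using kl by auto
          have "\<bar>(t - z l) / x - (t - z k) / x\<bar> \<le> \<delta>"
            using sr_dist_cell(2)[OF cell[OF k] cell[OF l] dist[OF zi(2)[OF k]] d0 order_trans[OF d\<delta> \<delta>(2)]]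
              zi(2)[OF l] eq d\<delta>[of "i k"] by simp
          moreover have "(t - z l) / x - (t - z k) / x = (z k - z l) / x" by (simp add: diff_divide_distrib)
          ultimately have "(z k - z l) / x \<le> \<delta>" by linarith
          then have "z k - z l \<le> \<delta> * x" using x0 by (simp add: divide_le_eq)
          also have "\<dots> \<le> \<delta> * 1"
          proof (rule mult_left_mono)
            have "period \<le> 4" using pi_less_4 by (intro real_le_lsqrt) auto
            then show "x \<le> 1" using xt(1) by simp
          qed (use \<delta> in simp)
          finally have "z k - z l \<le> 1 / (16 * real K)" by (simp add: \<delta>_def)
          moreover have "(pi / 2) / (16 * real K) \<le> z k - z l"
          proof -
            have "(pi / 2) \<le> ((real l + 1 / 4) * pi - (real k + 3 / 4) * pi)"
            proof -
              have "real k + 1 \<le> real l" using kl(1) by simp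
              then have "(1 / 2) * pi \<le> ((real l + 1 / 4) - (real k + 3 / 4)) * pi" by (intro mult_right_mono) auto
              then show ?thesis by (simp add: algebra_simps)
            qed
            then have "(pi / 2) / (16 * real K) \<le> ((real l + 1 / 4) * pi - (real k + 3 / 4) * pi) / (16 * real K)"
              by (rule divide_right_mono) simp
            moreover have "z l \<le> - ((real l + 1 / 4) * pi / (16 * real K))"
              using zi(1)[OF l] unfolding atLeastAtMost_iff mult_minus_left divide_minus_left by (rule conjunct2)
            moreover have "- ((real k + 3 / 4) * pi / (16 * real K)) \<le> z k"
              using zi(1)[OF k] unfolding atLeastAtMost_iff mult_minus_left divide_minus_left by (rule conjunct1)
            ultimately show ?thesis unfolding diff_divide_distrib by linarith
          qed
          ultimately have "(pi / 2) / (16 * real K) \<le> 1 / (16 * real K)" by linarith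
          moreover have "1 / (16 * real K) < (pi / 2) / (16 * real K)"
            using pi_gt3 K by (intro divide_strict_right_mono) auto
          ultimately show False by linarith
        qed
      qed auto
      then have "ennreal (real K) = (\<Sum>j\<in>i ` {..<K}. indicator (B j) (x, t))"
      proof (subst sum.reindex)
        show "ennreal (real K) = sum ((\<lambda>j. indicator (B j) (x, t)) \<circ> i) {..<K}"
        proof -
          have "(x, t) \<in> B (i k)" if "k < K" for k
            using in_B[OF cell[OF that] zi(2)[OF that]] x0 by simp
          then have "sum ((\<lambda>j. indicator (B j) (x, t)) \<circ> i) {..<K} = (\<Sum>k<K. 1 :: ennreal)"
            by (intro sum.cong) auto
          then show ?thesis by (simp add: ennreal_of_nat_eq_real_of_nat)
        qed
      qed
      also have "\<dots> \<le> (\<Sum>j. indicator (B j) (x, t))" by (rule sum_le_suminf) auto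
      finally show ?thesis .
    qed
    have Bm: "B i \<in> sets (borel \<Otimes>\<^sub>M borel)" for i
    proof -
      have "closed {xt :: real \<times> real. \<bar>fst xt - a\<bar> \<le> e \<and> \<bar>snd xt - t0 - (fst xt - a) * b\<bar> \<le> e'}" for a b e e' t0
        by (intro closed_Collect_conj closed_Collect_le continuous_intros)
      then show ?thesis
        unfolding B_def borel_prod by (cases "base i") (auto simp: split_def intro!: borel_closed)
    qed
    have area: "(\<integral>\<^sup>+x. \<integral>\<^sup>+t. indicator (B i) (x, t) \<partial>lborel \<partial>lborel) = 8 * ediam sr_dist (U i) ^ 3" for i
    proof -
      obtain a b c where abc: "base i = (a, b, c)" by (cases "base i")
      have "(\<integral>\<^sup>+x. \<integral>\<^sup>+t. indicator (B i) (x, t) \<partial>lborel \<partial>lborel) = ennreal (8 * d i ^ 3)"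
        unfolding B_def abc prod.case by (rule shear_box_area[OF d0])
      then show ?thesis unfolding ed using d0[of i] by (simp add: ennreal_mult ennreal_power)
    qed
    have meas[measurable]: "(\<lambda>t. indicator (B i) (x, t) :: ennreal) \<in> borel_measurable lborel" for i x
      using Bm[of i] by measurable
    have meas2[measurable]: "(\<lambda>x. \<integral>\<^sup>+t. indicator (B i) (x, t) \<partial>lborel) \<in> borel_measurable lborel" for i
    proof -
      have "(\<lambda>xt. indicator (B i) xt :: ennreal) \<in> borel_measurable (lborel \<Otimes>\<^sub>M lborel)"
        using Bm[of i] by (intro borel_measurable_indicator) (simp add: sets_pair_measure_cong[OF sets_lborel sets_lborel])
      then show ?thesis using lborel.borel_measurable_nn_integral_fst by fastforce
    qed
    have "ennreal (real K * (period / 8) * (pi / 16)) = (\<integral>\<^sup>+x\<in>{period / 8..period / 4}. (\<integral>\<^sup>+t\<in>{0..pi / 16}. ennreal (real K) \<partial>lborel) \<partial>lborel)"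
      by (simp add: nn_integral_cmult_indicator ennreal_mult[symmetric] mult_ac)
    also have "\<dots> \<le> (\<integral>\<^sup>+x. \<integral>\<^sup>+t. (\<Sum>i. indicator (B i) (x, t)) \<partial>lborel \<partial>lborel)"
    proof (rule nn_integral_mono)
      fix x
      have "(\<integral>\<^sup>+t\<in>{0..pi / 16}. ennreal (real K) \<partial>lborel) \<le> (\<integral>\<^sup>+t. (\<Sum>i. indicator (B i) (x, t)) \<partial>lborel)"
        if "x \<in> {period / 8..period / 4}"
        by (rule nn_integral_mono) (use count[OF that] in \<open>auto simp: indicator_def\<close>)
      then show "(\<integral>\<^sup>+t\<in>{0..pi / 16}. ennreal (real K) \<partial>lborel) * indicator {period / 8..period / 4} x
          \<le> (\<integral>\<^sup>+t. (\<Sum>i. indicator (B i) (x, t)) \<partial>lborel)"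
        by (cases "x \<in> {period / 8..period / 4}") auto
    qed
    also have "\<dots> = (\<Sum>i. \<integral>\<^sup>+x. \<integral>\<^sup>+t. indicator (B i) (x, t) \<partial>lborel \<partial>lborel)"
      by (simp add: nn_integral_suminf meas meas2)
    also have "\<dots> = 8 * (\<Sum>i. ediam sr_dist (U i) ^ 3)" unfolding area by simp
    finally have le: "ennreal (real K * (period / 8) * (pi / 16)) \<le> 8 * (\<Sum>i. ediam sr_dist (U i) ^ 3)" .
    have "ennreal ?C = ennreal (1 / 8) * ennreal (real K * (period / 8) * (pi / 16))"
      by (simp add: ennreal_mult[symmetric] field_simps)
    also have "\<dots> \<le> ennreal (1 / 8) * (8 * (\<Sum>i. ediam sr_dist (U i) ^ 3))"
      using le by (rule mult_left_mono) simp
    also have "\<dots> = (\<Sum>i. ediam sr_dist (U i) ^ 3)"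
    proof -
      have "ennreal (1 / 8) * 8 = ennreal (1 / 8) * ennreal 8" by simp
      also have "\<dots> = 1" by (subst ennreal_mult[symmetric]) auto
      finally show ?thesis by (simp add: mult.assoc[symmetric])
    qed
    finally show ?thesis .
  qed
  then have "ennreal ?C \<le> Inf {(\<Sum>i. ediam sr_dist (U i) ^ 3) | U :: nat \<Rightarrow> heis_mfd set.
        Z \<subseteq> (\<Union>i. U i) \<and> (\<forall>i. ediam sr_dist (U i) \<le> ennreal \<delta>)}"
    by (intro Inf_greatest) blast
  also have "\<dots> \<le> hausdorff_measure sr_dist 3 Z"
    unfolding hausdorff_measure_def by (rule SUP_upper) (use \<delta> in simp)
  finally show ?thesis .
qed

section \<open>Hausdorff measure of vertical planes\<close>

lemma bounded_derivative_abs_continuous: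
  fixes \<gamma> :: "real \<Rightarrow> 'a::real_normed_vector"
  assumes der: "\<And>t. (\<gamma> has_vector_derivative v t) (at t)" and bound: "\<And>t. norm (v t) \<le> B"
  shows "abs_continuous_on_interval a b \<gamma>"
proof (rule abs_continuous_lipschitz[of a b "\<lambda>t. t" "\<bar>B\<bar> + 1"])
  show "abs_continuous_on_interval a b (\<lambda>t :: real. t)"
    unfolding abs_continuous_iff
  proof (intro allI impI exI conjI)
    fix e :: real and D assume D: "small_family a b e D"
    then have "(\<Sum>(s, t)\<in>D. dist s t) = (\<Sum>(s, t)\<in>D. t - s)"
      unfolding small_family_def by (intro sum.cong) (auto simp: dist_real_def)
    then show "(\<Sum>(s, t)\<in>D. dist s t) < e" using D by (simp add: small_family_def)
  qed
  show "dist (\<gamma> s) (\<gamma> t) \<le> (\<bar>B\<bar> + 1) * dist s t" for s t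
  proof -
    have "norm (\<gamma> s - \<gamma> t) \<le> (\<bar>B\<bar> + 1) * norm (s - t)"
    proof (rule differentiable_bound[of UNIV \<gamma> "\<lambda>t h. h *\<^sub>R v t"])
      show "(\<gamma> has_derivative (\<lambda>h. h *\<^sub>R v t)) (at t within UNIV)" for t
        using der[of t] by (simp add: has_vector_derivative_def)
      show "onorm (\<lambda>h. h *\<^sub>R v t) \<le> \<bar>B\<bar> + 1" for t
      proof (rule onorm_le)
        fix h :: real
        show "norm (h *\<^sub>R v t) \<le> (\<bar>B\<bar> + 1) * norm h"
        proof -
          have "norm (v t) \<le> \<bar>B\<bar> + 1" using bound[of t] by linarith
          from mult_left_mono[OF this abs_ge_zero[of h]] show ?thesis by (simp add: mult.commute)
        qed
      qed
    qed auto
    then show ?thesis by (simp add: dist_norm)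
  qed
qed simp

text \<open>An explicit curve: a straight motion in \<open>y\<close> to which a loop in the \<open>(x, y)\<close>-plane is added. The loop
  is a circle of radius \<open>r\<close>, oriented by the sign of \<open>B\<close>; its area \<open>pi * r\<^sup>2 = \<bar>\<zeta> + x0 * \<eta>\<bar>\<close> is the correction
  that \<open>z\<close> needs.\<close>

lemma sr_dist_vertical_plane_le:
  "sr_dist (proj_mfd (x0, y0, z0)) (proj_mfd (x0, y0 + \<eta>, z0 + \<zeta>))
    \<le> ennreal (\<bar>\<eta>\<bar> + 4 * pi * sqrt (\<bar>\<zeta> + x0 * \<eta>\<bar> / pi))"
proof -
  define r where "r = sqrt (\<bar>\<zeta> + x0 * \<eta>\<bar> / pi)"
  define B where "B = - sgn (\<zeta> + x0 * \<eta>) * r"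
  have r0: "0 \<le> r" by (simp add: r_def)
  have rB: "pi * (r * B) = - (\<zeta> + x0 * \<eta>)"
  proof -
    have "pi * (r * B) = - sgn (\<zeta> + x0 * \<eta>) * (pi * (r * r))" by (simp add: B_def)
    also have "pi * (r * r) = \<bar>\<zeta> + x0 * \<eta>\<bar>" unfolding r_def by simp
    finally show ?thesis by (simp add: sgn_mult_abs)
  qed
  have Br: "\<bar>B\<bar> \<le> r" using r0 by (simp add: B_def abs_mult sgn_if)
  define S where "S = (\<lambda>t::real. sin (2 * pi * t))"
  define C where "C = (\<lambda>t::real. cos (2 * pi * t))"
  have S': "DERIV S t :> 2 * pi * C t" and C': "DERIV C t :> - 2 * pi * S t" for t
    unfolding S_def C_def by (auto intro!: derivative_eq_intros)
  have S1: "\<bar>S t\<bar> \<le> 1" and C1: "\<bar>C t\<bar> \<le> 1" for t by (auto simp: S_def C_def)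
  have SC: "(C t)\<^sup>2 = 1 - (S t)\<^sup>2" for t by (simp add: S_def C_def cos_squared_eq)
  define x where "x = (\<lambda>t. x0 + r * S t)"
  define y where "y = (\<lambda>t. y0 + \<eta> * t + B * (1 - C t))"
  define z where "z = (\<lambda>t. z0 - x0 * (\<eta> * t + B * (1 - C t)) - r * \<eta> * (1 - C t) / (2 * pi) - r * B * (pi * t - S t * C t / 2))"
  define u1 where "u1 = (\<lambda>t. 2 * pi * r * C t)"
  define u2 where "u2 = (\<lambda>t. \<eta> + 2 * pi * B * S t)"
  define \<gamma> where "\<gamma> = (\<lambda>t. (x t, y t, z t))"
  have x': "DERIV x t :> u1 t" for t
    unfolding x_def u1_def by (auto intro!: derivative_eq_intros S')
  have y': "DERIV y t :> u2 t" for t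
    unfolding y_def u2_def by (auto intro!: derivative_eq_intros C')
  have z': "DERIV z t :> - x t * u2 t" for t
  proof -
    have "DERIV z t :> - x0 * (\<eta> - B * (- 2 * pi * S t)) - r * \<eta> * (- (- 2 * pi * S t)) / (2 * pi)
      - r * B * (pi - (2 * pi * C t * C t + (- 2 * pi * S t) * S t) / 2)"
      unfolding z_def by (auto intro!: derivative_eq_intros S' C' simp: field_simps)
    moreover have "C t * C t = 1 - S t * S t" using SC[of t] by (simp add: power2_eq_square)
    then have "- x0 * (\<eta> - B * (- 2 * pi * S t)) - r * \<eta> * (- (- 2 * pi * S t)) / (2 * pi)
      - r * B * (pi - (2 * pi * C t * C t + (- 2 * pi * S t) * S t) / 2) = - x t * u2 t"
      unfolding x_def u2_def by (simp add: mult.assoc[of _ "C t" "C t"]) (simp add: field_simps)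
    ultimately show ?thesis by simp
  qed
  have der: "(\<gamma> has_vector_derivative (u1 t, u2 t, - x t * u2 t)) (at t)" for t
    unfolding \<gamma>_def using x' y' z'
    by (intro has_vector_derivative_Pair) (simp_all add: has_real_derivative_iff_has_vector_derivative)
  have u1: "\<bar>u1 t\<bar> \<le> 2 * pi * r" for t
    using mult_left_mono[OF C1[of t], of "2 * pi * r"] r0 by (simp add: u1_def abs_mult)
  have u2: "\<bar>u2 t\<bar> \<le> \<bar>\<eta>\<bar> + 2 * pi * r" for t
  proof -
    have "\<bar>B * S t\<bar> \<le> r * 1" unfolding abs_mult using Br S1 r0 by (intro mult_mono) auto
    then have "\<bar>2 * pi * (B * S t)\<bar> \<le> 2 * pi * r" by (simp add: abs_mult)
    then show ?thesis unfolding u2_def by (simp add: mult.assoc)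
  qed
  have ac: "abs_continuous_on_interval 0 1 \<gamma>"
  proof (rule bounded_derivative_abs_continuous[OF der])
    fix t
    have "\<bar>x t\<bar> \<le> \<bar>x0\<bar> + r"
      using mult_left_mono[OF S1[of t] r0] r0 by (simp add: x_def abs_mult abs_triangle_ineq[THEN order_trans])
    then have "\<bar>x t * u2 t\<bar> \<le> (\<bar>x0\<bar> + r) * (\<bar>\<eta>\<bar> + 2 * pi * r)"
      unfolding abs_mult using u2 r0 by (intro mult_mono) auto
    moreover have "norm (u1 t, u2 t, - x t * u2 t) \<le> \<bar>u1 t\<bar> + (\<bar>u2 t\<bar> + \<bar>x t * u2 t\<bar>)"
      using norm_Pair_le[of "u1 t" "(u2 t, - x t * u2 t)"] norm_Pair_le[of "u2 t" "- x t * u2 t"] by (simp add: abs_mult)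
    ultimately show "norm (u1 t, u2 t, - x t * u2 t) \<le> 2 * pi * r + ((\<bar>\<eta>\<bar> + 2 * pi * r) + (\<bar>x0\<bar> + r) * (\<bar>\<eta>\<bar> + 2 * pi * r))"
      using u1[of t] u2[of t] by linarith
  qed
  have speed: "ennreal_sqrt (sr_metric (\<gamma> t) (vector_derivative \<gamma> (at t))) \<le> ennreal (\<bar>\<eta>\<bar> + 4 * pi * r)" for t
  proof -
    have "sqrt ((u1 t)\<^sup>2 + (u2 t)\<^sup>2) \<le> \<bar>u1 t\<bar> + \<bar>u2 t\<bar>" by (rule sqrt_sum_squares_le_sum_abs)
    also have "\<dots> \<le> \<bar>\<eta>\<bar> + 4 * pi * r" using u1[of t] u2[of t] by simp
    finally have "ennreal (sqrt ((u1 t)\<^sup>2 + (u2 t)\<^sup>2)) \<le> ennreal (\<bar>\<eta>\<bar> + 4 * pi * r)" by (rule ennreal_leI)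
    moreover have "sr_metric (\<gamma> t) (vector_derivative \<gamma> (at t)) = ennreal ((u1 t)\<^sup>2 + (u2 t)\<^sup>2)"
      unfolding vector_derivative_at[OF der] unfolding \<gamma>_def sr_metric_eq by simp
    ultimately show ?thesis
      using ennreal_sqrt_ennreal[of "(u1 t)\<^sup>2 + (u2 t)\<^sup>2"] by (simp del: ennreal_plus)
  qed
  have "sr_length \<gamma> \<le> (\<integral>\<^sup>+t\<in>{0..1::real}. ennreal (\<bar>\<eta>\<bar> + 4 * pi * r) \<partial>lborel)"
    unfolding sr_length_def by (rule nn_integral_mono) (use speed in \<open>auto simp: indicator_def simp del: ennreal_plus\<close>)
  also have "\<dots> = ennreal (\<bar>\<eta>\<bar> + 4 * pi * r)" by (simp add: nn_integral_cmult_indicator del: ennreal_plus)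
  finally have len: "sr_length \<gamma> \<le> ennreal (\<bar>\<eta>\<bar> + 4 * pi * r)" .
  have "\<gamma> 0 = (x0, y0, z0)" by (simp add: \<gamma>_def x_def y_def z_def S_def C_def)
  moreover have "\<gamma> 1 = (x0, y0 + \<eta>, z0 + \<zeta>)"
    using rB by (simp add: \<gamma>_def x_def y_def z_def S_def C_def algebra_simps)
  ultimately have "sr_dist (proj_mfd (x0, y0, z0)) (proj_mfd (x0, y0 + \<eta>, z0 + \<zeta>)) \<le> sr_length \<gamma>"
    unfolding sr_dist_def using ac by (intro Inf_lower) auto
  then show ?thesis using len unfolding r_def by (rule order_trans)
qed

lemma hausdorff_measure_finite_cover_le:
  fixes A :: "'a set"
  assumes k: "0 < k"
    and cov: "\<And>e :: real. 0 < e \<Longrightarrow> \<exists>(I :: 'i set) V. finite I \<and> A \<subseteq> \<Union>(V ` I) \<and> (\<forall>i\<in>I. ediam d (V i) \<le> ennreal e) \<and>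
        (\<Sum>i\<in>I. ediam d (V i) ^ k) \<le> C"
  shows "hausdorff_measure d k A \<le> C"
  unfolding hausdorff_measure_def
proof (rule SUP_least)
  fix \<delta> :: ennreal assume "\<delta> \<in> {0<..}"
  then obtain e where e: "0 < e" "ennreal e \<le> \<delta>"
    by (cases \<delta>) (auto simp: ennreal_zero_less_top intro: that[of 1])
  from cov[OF e(1)] obtain I :: "'i set" and V where I: "finite I" "A \<subseteq> \<Union>(V ` I)" "\<And>i. i \<in> I \<Longrightarrow> ediam d (V i) \<le> ennreal e"
    "(\<Sum>i\<in>I. ediam d (V i) ^ k) \<le> C" by blast
  obtain f where f: "bij_betw f {..<card I} I" using ex_bij_betw_nat_finite[OF I(1)] by (auto simp: atLeast0LessThan)
  define U where "U = (\<lambda>n. if n < card I then V (f n) else {})"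
  have e0: "ediam d ({} :: 'a set) = 0" by (simp add: ediam_def bot_ennreal)
  have "(\<Sum>n. ediam d (U n) ^ k) = (\<Sum>n<card I. ediam d (U n) ^ k)"
    by (rule suminf_finite) (use k in \<open>auto simp: U_def e0\<close>)
  also have "\<dots> = (\<Sum>n<card I. ediam d (V (f n)) ^ k)" by (simp add: U_def)
  also have "\<dots> = (\<Sum>i\<in>I. ediam d (V i) ^ k)" using sum.reindex_bij_betw[OF f] .
  finally have sum: "(\<Sum>n. ediam d (U n) ^ k) \<le> C" using I(4) by simp
  have "A \<subseteq> (\<Union>n. U n)"
  proof
    fix a assume "a \<in> A"
    then obtain i where "i \<in> I" "a \<in> V i" using I(2) by blast
    then obtain n where "n < card I" "f n = i" using f by (metis bij_betw_imp_surj_on imageE lessThan_iff)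
    then show "a \<in> (\<Union>n. U n)" using \<open>a \<in> V i\<close> by (auto simp: U_def intro!: exI[of _ n])
  qed
  moreover have "ediam d (U n) \<le> \<delta>" for n
    using I(3)[of "f n"] e f by (auto simp: U_def e0 dest: bij_betwE intro: order_trans)
  ultimately have "Inf {(\<Sum>i. ediam d (U i) ^ k) | U :: nat \<Rightarrow> 'a set. A \<subseteq> (\<Union>i. U i) \<and> (\<forall>i. ediam d (U i) \<le> \<delta>)}
      \<le> (\<Sum>n. ediam d (U n) ^ k)" by (intro Inf_lower) blast
  then show "Inf {(\<Sum>i. ediam d (U i) ^ k) | U :: nat \<Rightarrow> 'a set. A \<subseteq> (\<Union>i. U i) \<and> (\<forall>i. ediam d (U i) \<le> \<delta>)} \<le> C"
    using sum by (rule order_trans)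
qed

lemma grid_index:
  fixes t c :: real
  assumes "0 \<le> t" "t < c" "0 < N"
  obtains i where "i < N" "c * real i / real N \<le> t" "t \<le> c * (real i + 1) / real N"
proof
  let ?i = "nat \<lfloor>t * real N / c\<rfloor>"
  have c: "0 < c" using assms by simp
  have q: "0 \<le> t * real N / c" "t * real N / c < real N" using assms c by (auto simp: divide_less_eq)
  have i: "real ?i \<le> t * real N / c" "t * real N / c < real ?i + 1" using q(1) by linarith+
  show "?i < N" using i q by linarith
  show "c * real ?i / real N \<le> t" using i(1) c assms(3) by (simp add: field_simps)
  show "t \<le> c * (real ?i + 1) / real N" using i(2) c assms(3) by (simp add: field_simps)
qed

text \<open>Every plane is cut into \<open>N * (N * N)\<close> boxes in the coordinates \<open>y\<close> and \<open>w = z + x * y\<close>, with steps of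
  order \<open>1 / N\<close> in \<open>y\<close> and \<open>1 / N\<^sup>2\<close> in \<open>w\<close>; modulo the lattice, \<open>y\<close> and \<open>w\<close> range over one period each.\<close>

theorem hausdorff_measure_vertical_planes_le:
  fixes xs :: "nat \<Rightarrow> real"
  shows "hausdorff_measure sr_dist 3 (\<Union>l<m. {proj_mfd (xs l, y, z) | y z. True})
    \<le> ennreal (real m * (period + 4 * pi * sqrt 2) ^ 3)"
proof (rule hausdorff_measure_finite_cover_le)
  let ?C = "period + 4 * pi * sqrt 2"
  have C: "0 < ?C" by (simp add: add_pos_pos)
  fix e :: real assume "0 < e"
  obtain N where N: "?C / e < real N" using reals_Archimedean2 by blast
  then have N0: "0 < N" using C \<open>0 < e\<close> by (metis divide_pos_pos gr0I less_trans of_nat_0 less_irrefl)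
  have CN: "?C / real N \<le> e" using N N0 \<open>0 < e\<close> by (simp add: field_simps)
  define I where "I = {..<m} \<times> {..<N} \<times> {..<N * N}"
  define V where "V = (\<lambda>(l, i, j). {proj_mfd (xs l, y, w - xs l * y) | y w.
      y \<in> {period * real i / real N..period * (real i + 1) / real N} \<and>
      w \<in> {2 * pi * real j / real (N * N)..2 * pi * (real j + 1) / real (N * N)}})"
  have diam: "ediam sr_dist (V i) \<le> ennreal (?C / real N)" if "i \<in> I" for i
    unfolding ediam_def
  proof (intro SUP_least)
    fix q q' assume q: "q \<in> V i" "q' \<in> V i"
    obtain l i0 j where i: "i = (l, i0, j)" by (cases i) auto
    obtain y w where yw: "q = proj_mfd (xs l, y, w - xs l * y)" 
      "y \<in> {period * real i0 / real N..period * (real i0 + 1) / real N}"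
      "w \<in> {2 * pi * real j / real (N * N)..2 * pi * (real j + 1) / real (N * N)}"
      using q(1) unfolding V_def i by auto
    obtain y' w' where yw': "q' = proj_mfd (xs l, y', w' - xs l * y')" 
      "y' \<in> {period * real i0 / real N..period * (real i0 + 1) / real N}"
      "w' \<in> {2 * pi * real j / real (N * N)..2 * pi * (real j + 1) / real (N * N)}"
      using q(2) unfolding V_def i by auto
    have "\<bar>y' - y\<bar> \<le> period * (real i0 + 1) / real N - period * real i0 / real N" using yw yw' by auto
    also have "\<dots> = period / real N" by (simp add: diff_divide_distrib[symmetric] algebra_simps)
    finally have dy: "\<bar>y' - y\<bar> \<le> period / real N" .
    have "\<bar>w' - w\<bar> \<le> 2 * pi * (real j + 1) / real (N * N) - 2 * pi * real j / real (N * N)" using yw yw' by auto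
    also have "\<dots> = 2 * pi / real (N * N)" by (simp add: diff_divide_distrib[symmetric] algebra_simps)
    finally have dw: "\<bar>w' - w\<bar> \<le> 2 * pi / real (N * N)" .
    have "sr_dist q q' \<le> ennreal (\<bar>y' - y\<bar> + 4 * pi * sqrt (\<bar>w' - w\<bar> / pi))"
      using sr_dist_vertical_plane_le[of "xs l" y "w - xs l * y" "y' - y" "w' - w - xs l * (y' - y)"]
      unfolding yw(1) yw'(1) by (simp add: algebra_simps)
    also have "\<dots> \<le> ennreal (?C / real N)"
    proof (rule ennreal_leI)
      have "\<bar>w' - w\<bar> / pi \<le> 2 / (real N)\<^sup>2"
        using divide_right_mono[OF dw, of pi] by (simp add: power2_eq_square)
      then have "sqrt (\<bar>w' - w\<bar> / pi) \<le> sqrt (2 / (real N)\<^sup>2)" by (rule real_sqrt_le_mono)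
      also have "\<dots> = sqrt 2 / real N" by (simp add: real_sqrt_divide)
      finally have "4 * pi * sqrt (\<bar>w' - w\<bar> / pi) \<le> 4 * pi * (sqrt 2 / real N)" by (intro mult_left_mono) auto
      then show "\<bar>y' - y\<bar> + 4 * pi * sqrt (\<bar>w' - w\<bar> / pi) \<le> ?C / real N"
        using dy by (simp add: add_divide_distrib)
    qed
    finally show "sr_dist q q' \<le> ennreal (?C / real N)" .
  qed
  have cover: "(\<Union>l<m. {proj_mfd (xs l, y, z) | y z. True}) \<subseteq> \<Union>(V ` I)"
  proof clarify
    fix l y z assume l: "l < m"
    define b where "b = \<lfloor>y / period\<rfloor>"
    define y' where "y' = y - period * of_int b"
    define c where "c = \<lfloor>(z + xs l * y') / (2 * pi)\<rfloor>"
    define w where "w = z + xs l * y' - 2 * pi * of_int c"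
    have y': "0 \<le> y'" "y' < period"
      using floor_divide_lower[of period y] floor_divide_upper[of period y] by (auto simp: y'_def b_def algebra_simps)
    have w: "0 \<le> w" "w < 2 * pi"
      using floor_divide_lower[of "2 * pi" "z + xs l * y'"] floor_divide_upper[of "2 * pi" "z + xs l * y'"]
      by (auto simp: w_def c_def algebra_simps)
    obtain i where i: "i < N" "period * real i / real N \<le> y'" "y' \<le> period * (real i + 1) / real N"
      by (rule grid_index[OF y' N0])
    have "0 < N * N" using N0 by simp
    then obtain j where j: "j < N * N" "2 * pi * real j / real (N * N) \<le> w" "w \<le> 2 * pi * (real j + 1) / real (N * N)"
      by (rule grid_index[OF w])
    have "(period * of_int 0, period * of_int b, 2 * pi * of_int c) \<in> heis_lattice" unfolding heis_lattice_def by blast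
    from proj_mfd_mult[OF this, of "(xs l, y', w - xs l * y')"]
    have "proj_mfd (xs l, y, z) = proj_mfd (xs l, y', w - xs l * y')"
      by (simp add: y'_def w_def)
    then have "proj_mfd (xs l, y, z) \<in> V (l, i, j)"
      unfolding V_def prod.case using i j by (intro CollectI exI[of _ y'] exI[of _ w]) (simp del: of_nat_mult)
    moreover have "(l, i, j) \<in> I" using l i j by (simp add: I_def)
    ultimately show "proj_mfd (xs l, y, z) \<in> \<Union>(V ` I)" by blast
  qed
  have "(\<Sum>i\<in>I. ediam sr_dist (V i) ^ 3) \<le> (\<Sum>i\<in>I. ennreal (?C / real N) ^ 3)"
    by (intro sum_mono power_mono diam) auto
  also have "\<dots> = ennreal (real (card I) * (?C / real N) ^ 3)"
    using C by (simp add: ennreal_power ennreal_mult ennreal_of_nat_eq_real_of_nat del: ennreal_plus)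
  also have "real (card I) * (?C / real N) ^ 3 = real m * ?C ^ 3"
    using N0 by (simp add: I_def power_divide power3_eq_cube del: power_mult_distrib)
  finally have sum: "(\<Sum>i\<in>I. ediam sr_dist (V i) ^ 3) \<le> ennreal (real m * ?C ^ 3)" .
  show "\<exists>(I :: (nat \<times> nat \<times> nat) set) V. finite I \<and> (\<Union>l<m. {proj_mfd (xs l, y, z) | y z. True}) \<subseteq> \<Union>(V ` I) \<and>
      (\<forall>i\<in>I. ediam sr_dist (V i) \<le> ennreal e) \<and> (\<Sum>i\<in>I. ediam sr_dist (V i) ^ 3) \<le> ennreal (real m * ?C ^ 3)"
  proof (intro exI[of _ I] exI[of _ V] conjI ballI)
    show "finite I" by (simp add: I_def)
    show "ediam sr_dist (V i) \<le> ennreal e" if "i \<in> I" for i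
      using diam[OF that] CN by (meson ennreal_leI order_trans)
  qed (fact cover, fact sum)
qed simp

section \<open>Smooth functions on the quotient\<close>

text \<open>The class \<open>Ck\<close> is handled through derivatives given in closed form, so that smoothness follows by
  induction for families that are closed under differentiation.\<close>

lemma Ck_SucI:
  assumes "\<And>x. (f has_derivative D x) (at x)" and "\<And>h. Ck k (\<lambda>x. D x h)"
  shows "Ck (Suc k) f"
proof -
  have "frechet_derivative f (at x) = D x" for x using frechet_derivative_at[OF assms(1)] by simp
  then show ?thesis using assms by (auto simp: differentiable_def)
qed

lemma Ck_has_derivative: "Ck (Suc k) f \<Longrightarrow> (f has_derivative frechet_derivative f (at x)) (at x)"
  by (simp add: frechet_derivative_works[symmetric])

lemma Ck_SucD: "Ck (Suc k) f \<Longrightarrow> Ck k f"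
proof (induction k arbitrary: f)
  case 0
  then show ?case by (auto intro!: continuous_at_imp_continuous_on differentiable_imp_continuous_within)
next
  case (Suc k)
  then show ?case by auto
qed

lemma Ck_const: "Ck k (\<lambda>x. c)"
proof (induction k arbitrary: c)
  case (Suc k)
  show ?case by (rule Ck_SucI[where D = "\<lambda>x h. 0"]) (auto intro: Suc)
qed simp

lemma Ck_bounded_linear: "bounded_linear f \<Longrightarrow> Ck k f"
proof (cases k)
  case 0
  assume "bounded_linear f"
  then show ?thesis using 0 by (simp add: linear_continuous_on)
next
  case (Suc l)
  assume f: "bounded_linear f"
  show ?thesis unfolding Suc
    by (rule Ck_SucI[OF bounded_linear.has_derivative[OF f has_derivative_ident]]) (rule Ck_const)
qed

lemma Ck_add: "Ck k f \<Longrightarrow> Ck k g \<Longrightarrow> Ck k (\<lambda>x. f x + g x)"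
proof (induction k arbitrary: f g)
  case 0
  then show ?case by (simp add: continuous_on_add)
next
  case (Suc k)
  show ?case
    by (rule Ck_SucI[OF has_derivative_add[OF Ck_has_derivative[OF Suc.prems(1)] Ck_has_derivative[OF Suc.prems(2)]]])
      (use Suc in auto)
qed

lemma Ck_mult: "Ck k f \<Longrightarrow> Ck k g \<Longrightarrow> Ck k (\<lambda>x. f x * g x)"
proof (induction k arbitrary: f g)
  case 0
  then show ?case by (simp add: continuous_on_mult)
next
  case (Suc k)
  show ?case
    by (rule Ck_SucI[OF has_derivative_mult[OF Ck_has_derivative[OF Suc.prems(1)] Ck_has_derivative[OF Suc.prems(2)]]],
        rule Ck_add; rule Suc.IH) (use Suc.prems Ck_SucD in auto)
qed

lemma Ck_diff: "Ck k f \<Longrightarrow> Ck k g \<Longrightarrow> Ck k (\<lambda>x. f x - g x)"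
  using Ck_add[of k f "\<lambda>x. (-1) * g x"] Ck_mult[OF Ck_const[of k "-1"], of g] by simp

lemma continuous_proj_mfd: "continuous_on UNIV proj_mfd"
  by (simp add: continuous_on_open_vimage open_heis_mfd_def)

lemma continuous_on_mfd_iff:
  fixes f :: "heis_mfd \<Rightarrow> 'a::topological_space"
  shows "continuous_on UNIV f \<longleftrightarrow> continuous_on UNIV (\<lambda>p. f (proj_mfd p))"
  by (simp add: continuous_on_open_vimage open_heis_mfd_def vimage_def)

lemma heis_fund_dom_representative: "\<exists>p\<in>heis_fund_dom. proj_mfd p = q"
proof -
  let ?s = "sqrt (2 * pi)"
  obtain x y z where q: "q = proj_mfd (x, y, z)" by (metis proj_rep_mfd surj_pair)
  have ex: "\<exists>k. 0 \<le> t + P * of_int k \<and> t + P * of_int k < P" if "0 < P" for t P :: real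
  proof -
    have "0 \<le> t + P * of_int (- \<lfloor>t / P\<rfloor>) \<and> t + P * of_int (- \<lfloor>t / P\<rfloor>) < P"
      using floor_divide_lower[OF that, of t] floor_divide_upper[OF that, of t] by (simp add: algebra_simps)
    then show ?thesis by blast
  qed
  obtain a where a: "0 \<le> x + ?s * of_int a" "x + ?s * of_int a < ?s" using ex[of ?s x] by auto
  obtain b where b: "0 \<le> y + ?s * of_int b" "y + ?s * of_int b < ?s" using ex[of ?s y] by auto
  obtain c where c: "0 \<le> (z - ?s * of_int a * y) + 2 * pi * of_int c" "(z - ?s * of_int a * y) + 2 * pi * of_int c < 2 * pi"
    using ex[of "2 * pi" "z - ?s * of_int a * y"] by auto
  let ?g = "(?s * of_int a, ?s * of_int b, 2 * pi * of_int c)"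
  have "?g \<in> heis_lattice" unfolding heis_lattice_def by blast
  then have "proj_mfd (heis_mult ?g (x, y, z)) = q" unfolding q by (rule proj_mfd_mult)
  moreover have "heis_mult ?g (x, y, z) \<in> heis_fund_dom" using a b c by (simp add: heis_fund_dom_def algebra_simps)
  ultimately show ?thesis by blast
qed

lemma compact_mfd: "compact (UNIV :: heis_mfd set)"
proof -
  let ?s = "sqrt (2 * pi)"
  have "heis_fund_dom \<subseteq> cbox (0, 0, 0) (?s, ?s, 2 * pi)"
    by (auto simp: heis_fund_dom_def cbox_Pair_eq)
  then have "(UNIV :: heis_mfd set) = proj_mfd ` cbox (0, 0, 0) (?s, ?s, 2 * pi)"
    using heis_fund_dom_representative by (metis UNIV_eq_I image_eqI subsetD)
  also have "compact \<dots>"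
    by (rule compact_continuous_image[OF continuous_on_subset[OF continuous_proj_mfd]]) auto
  finally show ?thesis .
qed

text \<open>Closed subsets of the compact quotient are compact, so all supports are admissible.\<close>

lemma test_fun_UNIV: "test_fun UNIV v \<longleftrightarrow> mfd_smooth v"
  unfolding test_fun_def using compact_Int_closed[OF compact_mfd closed_closure] by auto

lemma mfd_smooth_continuous: "mfd_smooth v \<Longrightarrow> continuous_on UNIV v"
  unfolding continuous_on_mfd_iff[of v] mfd_smooth_def using Ck.simps(1) by metis

lemma mfd_smooth_has_derivative:
  "mfd_smooth v \<Longrightarrow> ((\<lambda>p. v (proj_mfd p)) has_derivative frechet_derivative (\<lambda>p. v (proj_mfd p)) (at p)) (at p)"
  unfolding mfd_smooth_def by (rule Ck_has_derivative[of 0]) blast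

lemma mfd_smooth_add: "mfd_smooth v \<Longrightarrow> mfd_smooth w \<Longrightarrow> mfd_smooth (\<lambda>q. v q + w q)"
  and mfd_smooth_diff: "mfd_smooth v \<Longrightarrow> mfd_smooth w \<Longrightarrow> mfd_smooth (\<lambda>q. v q - w q)"
  and mfd_smooth_mult: "mfd_smooth v \<Longrightarrow> mfd_smooth w \<Longrightarrow> mfd_smooth (\<lambda>q. v q * w q)"
  unfolding mfd_smooth_def by (simp_all add: Ck_add Ck_diff Ck_mult)

lemma mfd_deriv_eqI:
  assumes "mfd_smooth v" "V = X1 \<or> V = Y1" "((\<lambda>p. v (proj_mfd p)) has_derivative D) (at p)"
  shows "mfd_deriv V v (proj_mfd p) = D (V p)"
  using mfd_deriv_proj[OF assms(1,2)] frechet_derivative_at[OF assms(3)] by simp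

lemma mfd_deriv_diff:
  assumes "mfd_smooth v" "mfd_smooth w" "V = X1 \<or> V = Y1"
  shows "mfd_deriv V (\<lambda>q. v q - w q) = (\<lambda>q. mfd_deriv V v q - mfd_deriv V w q)"
proof
  fix q
  obtain p where q: "q = proj_mfd p" by (metis proj_rep_mfd)
  show "mfd_deriv V (\<lambda>q. v q - w q) q = mfd_deriv V v q - mfd_deriv V w q"
    unfolding q mfd_deriv_eqI[OF mfd_smooth_diff[OF assms(1,2)] assms(3)
        has_derivative_diff[OF mfd_smooth_has_derivative[OF assms(1)] mfd_smooth_has_derivative[OF assms(2)]]]
    using assms by (simp add: mfd_deriv_proj)
qed

lemma mfd_deriv_mult:
  assumes "mfd_smooth v" "mfd_smooth w" "V = X1 \<or> V = Y1"
  shows "mfd_deriv V (\<lambda>q. v q * w q) q = mfd_deriv V v q * w q + v q * mfd_deriv V w q"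
proof -
  obtain p where q: "q = proj_mfd p" by (metis proj_rep_mfd)
  show ?thesis
    unfolding q mfd_deriv_eqI[OF mfd_smooth_mult[OF assms(1,2)] assms(3)
        has_derivative_mult[OF mfd_smooth_has_derivative[OF assms(1)] mfd_smooth_has_derivative[OF assms(2)]]]
    using assms by (simp add: mfd_deriv_proj)
qed

lemma Y1_eq: "Y1 p = (0, 1, 0) - fst p *\<^sub>R (0, 0, 1)"
  by (cases p) simp

lemma X1_eq: "X1 p = (1, 0, 0)"
  by (cases p) simp

lemma mfd_smooth_deriv:
  assumes v: "mfd_smooth v" and V: "V = X1 \<or> V = Y1"
  shows "mfd_smooth (mfd_deriv V v)"
  unfolding mfd_smooth_def
proof
  fix k
  let ?D = "\<lambda>p. frechet_derivative (\<lambda>p. v (proj_mfd p)) (at p)"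
  have D: "Ck k (\<lambda>p. ?D p h)" for h using v unfolding mfd_smooth_def by (metis Ck.simps(2))
  have lin: "linear (?D p)" for p
    using mfd_smooth_has_derivative[OF v] has_derivative_linear by blast
  have eq: "(\<lambda>p. mfd_deriv V v (proj_mfd p)) = (\<lambda>p. ?D p (V p))" using mfd_deriv_proj[OF assms] by (simp add: fun_eq_iff)
  show "Ck k (\<lambda>p. mfd_deriv V v (proj_mfd p))"
  proof (cases "V = X1")
    case True
    show ?thesis unfolding eq unfolding True by (simp only: X1_eq D)
  next
    case False
    then have "V = Y1" using V by simp
    have "(\<lambda>p. ?D p (Y1 p)) = (\<lambda>p. ?D p (0, 1, 0) - fst p * ?D p (0, 0, 1))"
      unfolding Y1_eq using lin by (simp add: linear_diff linear_cmul del: Pair_le scaleR_Pair)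
    then show ?thesis unfolding eq unfolding \<open>V = Y1\<close>
      by (simp only:) (intro Ck_diff Ck_mult D Ck_bounded_linear bounded_linear_fst)
  qed
qed

section \<open>Integration by parts on the quotient\<close>

lemma space_mfd_measure: "space mfd_measure = UNIV" and sets_mfd_measure: "sets mfd_measure = sets borel"
  by (simp_all add: mfd_measure_def)

lemma restrict_mfd_measure: "restrict_space mfd_measure UNIV = mfd_measure"
proof (rule measure_eqI)
  show "emeasure (restrict_space mfd_measure UNIV) A = emeasure mfd_measure A"
    if "A \<in> sets (restrict_space mfd_measure UNIV)" for A
    by (rule emeasure_restrict_space) (auto simp: sets_mfd_measure space_mfd_measure)
qed (simp add: sets_restrict_space)

lemma heis_fund_dom_borel: "heis_fund_dom \<in> sets borel"
proof -
  have "{0..<sqrt (2 * pi)} \<times> ({0..<sqrt (2 * pi)} \<times> {0..<2 * pi}) \<in> sets (borel :: heis measure)"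
    by (intro borel_Times) auto
  then show ?thesis by (simp add: heis_fund_dom_def)
qed

lemma proj_mfd_measurable [measurable]: "proj_mfd \<in> restrict_space lborel heis_fund_dom \<rightarrow>\<^sub>M borel"
  by (rule measurable_restrict_space1) (use continuous_proj_mfd in \<open>simp add: borel_measurable_continuous_onI\<close>)

lemma mfd_smooth_measurable: "mfd_smooth v \<Longrightarrow> v \<in> borel_measurable mfd_measure"
  using mfd_smooth_continuous[of v] borel_measurable_continuous_onI[of v]
  by (simp add: measurable_cong_sets[OF sets_mfd_measure refl])

lemma heis_fund_dom_sub_box: "heis_fund_dom \<subseteq> cbox (0, 0, 0) (sqrt (2 * pi), sqrt (2 * pi), 2 * pi)"
  by (auto simp: heis_fund_dom_def cbox_Pair_eq)

lemma finite_measure_mfd: "finite_measure mfd_measure"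
proof (rule finite_measureI)
  have "emeasure mfd_measure (space mfd_measure) = emeasure lborel heis_fund_dom"
    unfolding mfd_measure_def by (simp add: emeasure_distr emeasure_restrict_space heis_fund_dom_borel space_restrict_space)
  also have "\<dots> < \<infinity>"
    by (rule emeasure_bounded_finite) (rule bounded_subset[OF bounded_cbox heis_fund_dom_sub_box])
  finally show "emeasure mfd_measure (space mfd_measure) \<noteq> \<infinity>" by simp
qed

lemma mfd_smooth_integrable:
  assumes v: "mfd_smooth v"
  shows "integrable mfd_measure v"
proof -
  interpret finite_measure mfd_measure by (rule finite_measure_mfd)
  have "compact (v ` UNIV)" by (rule compact_continuous_image[OF mfd_smooth_continuous[OF v] compact_mfd])
  then obtain B where "\<And>q. norm (v q) \<le> B" using compact_imp_bounded bounded_iff by (metis UNIV_I image_eqI)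
  then show ?thesis by (intro integrable_const_bound[of _ B] mfd_smooth_measurable[OF v]) simp
qed

lemma integral_mfd_measure:
  fixes v :: "heis_mfd \<Rightarrow> real"
  assumes v: "continuous_on UNIV v"
  shows "integral\<^sup>L mfd_measure v
    = integral (cbox (0, 0, 0) (sqrt (2 * pi), sqrt (2 * pi), 2 * pi)) (\<lambda>p. v (proj_mfd p))"
proof -
  let ?B = "cbox (0, 0, 0) (sqrt (2 * pi), sqrt (2 * pi), 2 * pi) :: heis set"
  let ?u = "\<lambda>p. v (proj_mfd p)"
  have u: "continuous_on UNIV ?u" using v by (simp add: continuous_on_mfd_iff)
  have "integral\<^sup>L mfd_measure v = (LINT p|restrict_space lborel heis_fund_dom. ?u p)"
    unfolding mfd_measure_def by (rule Bochner_Integration.integral_distr) (use v in \<open>auto intro: borel_measurable_continuous_onI\<close>)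
  also have "\<dots> = (LINT p:heis_fund_dom|lborel. ?u p)"
    unfolding set_lebesgue_integral_def by (rule integral_restrict_space) (simp add: heis_fund_dom_borel)
  also have "\<dots> = integral heis_fund_dom ?u"
  proof (rule set_borel_integral_eq_integral)
    have "set_integrable lborel ?B ?u"
      using borel_integrable_compact[of ?B ?u] continuous_on_subset[OF u] unfolding set_integrable_def by simp
    then show "set_integrable lborel heis_fund_dom ?u"
      by (rule set_integrable_subset) (auto simp: heis_fund_dom_borel heis_fund_dom_sub_box)
  qed
  also have "\<dots> = integral ?B ?u"
  proof (rule integral_subset_negligible[OF heis_fund_dom_sub_box])
    have "box (0, 0, 0) (sqrt (2 * pi), sqrt (2 * pi), 2 * pi) \<subseteq> heis_fund_dom"
      by (auto simp: heis_fund_dom_def mem_box Basis_prod_def)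
    then have "?B - heis_fund_dom \<subseteq> ?B - box (0, 0, 0) (sqrt (2 * pi), sqrt (2 * pi), 2 * pi)" by blast
    then show "negligible (?B - heis_fund_dom)" using negligible_frontier_interval negligible_subset by blast
  qed
  finally show ?thesis .
qed

lemma integral_periodic_shift:
  fixes f :: "real \<Rightarrow> real"
  assumes f: "continuous_on UNIV f" and per: "\<And>z. f (z + P) = f z" and "0 \<le> P" "0 \<le> c"
  shows "integral {0..P} (\<lambda>z. f (z + c)) = integral {0..P} f"
proof -
  have i: "f integrable_on {a..b}" for a b
    using integrable_continuous_real continuous_on_subset[OF f] by blast
  have shift: "integral {a..b} (\<lambda>z. f (z + d)) = integral {a + d..b + d} f" for a b d
    using integral_shift_Icc_real[of a b f d] by (simp add: o_def add.commute)
  have "integral {0..c} f = integral {0..c} (\<lambda>z. f (z + P))" by (simp add: per)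
  also have "\<dots> = integral {P..P + c} f" by (simp add: shift add.commute)
  finally have 1: "integral {0..c} f = integral {P..P + c} f" .
  have "integral {0..c} f + integral {c..P + c} f = integral {0..P + c} f"
    by (rule Henstock_Kurzweil_Integration.integral_combine) (use assms i in auto)
  moreover have "integral {0..P} f + integral {P..P + c} f = integral {0..P + c} f"
    by (rule Henstock_Kurzweil_Integration.integral_combine) (use assms i in auto)
  ultimately have "integral {c..P + c} f = integral {0..P} f" using 1 by linarith
  then show ?thesis by (simp add: shift)
qed

lemma mfd_lift_invariant:
  fixes v :: "heis_mfd \<Rightarrow> real"
  shows "v (proj_mfd (sqrt (2 * pi), y, z)) = v (proj_mfd (0, y, z + sqrt (2 * pi) * y))"
    and "v (proj_mfd (x, sqrt (2 * pi), z)) = v (proj_mfd (x, 0, z))"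
    and "v (proj_mfd (x, y, z + 2 * pi)) = v (proj_mfd (x, y, z))"
proof -
  let ?s = "sqrt (2 * pi)"
  have l: "(?s * of_int a, ?s * of_int b, 2 * pi * of_int c) \<in> heis_lattice" for a b c
    unfolding heis_lattice_def by blast
  show "v (proj_mfd (sqrt (2 * pi), y, z)) = v (proj_mfd (0, y, z + sqrt (2 * pi) * y))"
    using proj_mfd_mult[OF l[of 1 0 0], of "(0, y, z + ?s * y)"] by simp
  show "v (proj_mfd (x, sqrt (2 * pi), z)) = v (proj_mfd (x, 0, z))"
    using proj_mfd_mult[OF l[of 0 1 0], of "(x, 0, z)"] by simp
  show "v (proj_mfd (x, y, z + 2 * pi)) = v (proj_mfd (x, y, z))"
    using proj_mfd_mult[OF l[of 0 0 1], of "(x, y, z)"] by (simp add: add.commute)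
qed

text \<open>The derivative along the direction of one coordinate is integrated first. For \<open>X1\<close> the boundary values at
  \<open>x = 0\<close> and \<open>x = sqrt (2 * pi)\<close> differ by the shift \<open>z \<mapsto> z + sqrt (2 * pi) * y\<close>, which the integral over
  a full period in \<open>z\<close> does not see. For \<open>Y1\<close> the lift is periodic in \<open>y\<close> and in \<open>z\<close>, and the
  coefficient \<open>x\<close> is constant in these integrations.\<close>

theorem integral_mfd_deriv_zero:
  assumes v: "mfd_smooth v" and V: "V = X1 \<or> V = Y1"
  shows "integral\<^sup>L mfd_measure (mfd_deriv V v) = 0"
proof -
  let ?s = "sqrt (2 * pi)"
  let ?u = "\<lambda>p. v (proj_mfd p)"
  define D where "D = (\<lambda>p. frechet_derivative ?u (at p))"
  have u: "Ck k ?u" for k using v unfolding mfd_smooth_def by blast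
  have Dc: "continuous_on UNIV (\<lambda>p. D p h)" for h using u[of "Suc 0"] unfolding D_def Ck.simps by blast
  have uc: "continuous_on UNIV ?u" using u[of 0] by simp
  have Dd: "(?u has_derivative D p) (at p)" for p unfolding D_def by (rule mfd_smooth_has_derivative[OF v])
  have lin: "linear (D p)" for p using Dd has_derivative_linear by blast
  note comp = continuous_on_compose2[OF Dc _ subset_UNIV] continuous_on_compose2[OF uc _ subset_UNIV]
  have der: "((\<lambda>t. ?u (c t)) has_vector_derivative D (c t) c') (at t within S)"
    if "(c has_vector_derivative c') (at t within S)" for c c' t S
  proof -
    have "(c has_derivative (\<lambda>h. h *\<^sub>R c')) (at t within S)" using that by (simp add: has_vector_derivative_def)
    from has_derivative_in_compose[OF this has_derivative_at_withinI[OF Dd]]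
    have "((\<lambda>t. ?u (c t)) has_derivative (\<lambda>h. D (c t) (h *\<^sub>R c'))) (at t within S)" .
    then show ?thesis unfolding has_vector_derivative_def using lin by (simp add: linear_cmul)
  qed
  have "continuous_on UNIV (mfd_deriv V v)" by (rule mfd_smooth_continuous[OF mfd_smooth_deriv[OF assms]])
  then have "integral\<^sup>L mfd_measure (mfd_deriv V v) = integral (cbox (0, 0, 0) (?s, ?s, 2 * pi)) (\<lambda>p. D p (V p))"
    by (simp add: integral_mfd_measure mfd_deriv_proj[OF assms] D_def)
  also have "\<dots> = 0"
  proof (cases "V = X1")
    case True
    have "integral (cbox (0, 0, 0) (?s, ?s, 2 * pi)) (\<lambda>p. D p (V p))
        = integral (cbox 0 ?s) (\<lambda>x. integral (cbox (0, 0) (?s, 2 * pi)) (\<lambda>yz. D (x, yz) (1, 0, 0)))"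
      unfolding True X1_eq by (rule integral_prod_continuous) (rule continuous_on_subset[OF Dc], simp)
    also have "\<dots> = integral (cbox (0, 0) (?s, 2 * pi)) (\<lambda>yz. integral (cbox 0 ?s) (\<lambda>x. D (x, yz) (1, 0, 0)))"
      by (rule integral_swap_continuous) (auto simp: split_def intro!: comp continuous_intros)
    also have "\<dots> = integral (cbox (0, 0) (?s, 2 * pi)) (\<lambda>yz. ?u (0, fst yz, snd yz + ?s * fst yz) - ?u (0, yz))"
    proof (rule integral_cong)
      fix yz :: "real \<times> real"
      have "((\<lambda>x. D (x, yz) (1, 0, 0)) has_integral ?u (?s, yz) - ?u (0, yz)) {0..?s}"
      proof (rule fundamental_theorem_of_calculus)
        show "((\<lambda>x. ?u (x, yz)) has_vector_derivative D (x, yz) (1, 0, 0)) (at x within {0..?s})" for x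
        proof (rule der)
          have "((\<lambda>x::real. (x, yz)) has_vector_derivative (1, 0)) (at x within {0..?s})"
            by (intro has_vector_derivative_Pair has_vector_derivative_id[unfolded id_def] has_vector_derivative_const)
          then show "((\<lambda>x::real. (x, yz)) has_vector_derivative (1, 0, 0)) (at x within {0..?s})" by (simp add: zero_prod_def)
        qed
      qed simp
      then show "integral (cbox 0 ?s) (\<lambda>x. D (x, yz) (1, 0, 0)) = ?u (0, fst yz, snd yz + ?s * fst yz) - ?u (0, yz)"
        using mfd_lift_invariant(1)[of v "fst yz" "snd yz"] by (simp add: integral_unique)
    qed
    also have "\<dots> = integral (cbox (0, 0) (?s, 2 * pi)) (\<lambda>yz. ?u (0, fst yz, snd yz + ?s * fst yz))
        - integral (cbox (0, 0) (?s, 2 * pi)) (\<lambda>yz. ?u (0, yz))"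
      by (rule Henstock_Kurzweil_Integration.integral_diff; rule integrable_continuous) (auto intro!: comp continuous_intros)
    also have "integral (cbox (0, 0) (?s, 2 * pi)) (\<lambda>yz. ?u (0, fst yz, snd yz + ?s * fst yz))
        = integral (cbox 0 ?s) (\<lambda>y. integral (cbox 0 (2 * pi)) (\<lambda>z. ?u (0, y, z + ?s * y)))"
      by (subst integral_prod_continuous) (auto intro!: comp continuous_intros)
    also have "\<dots> = integral (cbox 0 ?s) (\<lambda>y. integral (cbox 0 (2 * pi)) (\<lambda>z. ?u (0, y, z)))"
    proof (rule integral_cong)
      fix y assume "y \<in> cbox 0 ?s"
      moreover have "continuous_on UNIV (\<lambda>z. ?u (0, y, z))" by (intro comp continuous_intros)
      ultimately show "integral (cbox 0 (2 * pi)) (\<lambda>z. ?u (0, y, z + ?s * y)) = integral (cbox 0 (2 * pi)) (\<lambda>z. ?u (0, y, z))"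
        using integral_periodic_shift[of "\<lambda>z. ?u (0, y, z)" "2 * pi" "?s * y"] mfd_lift_invariant(3)[of v 0 y]
        by auto
    qed
    also have "\<dots> = integral (cbox (0, 0) (?s, 2 * pi)) (\<lambda>yz. ?u (0, yz))"
      by (subst integral_prod_continuous) (auto intro!: comp continuous_intros)
    finally show ?thesis by simp
  next
    case False
    then have "V = Y1" using V by simp
    then have "integral (cbox (0, 0, 0) (?s, ?s, 2 * pi)) (\<lambda>p. D p (V p))
        = integral (cbox (0, 0, 0) (?s, ?s, 2 * pi)) (\<lambda>p. D p (0, 1, 0) - fst p * D p (0, 0, 1))"
      unfolding Y1_eq using lin by (simp add: linear_diff linear_cmul Y1_eq del: scaleR_Pair diff_Pair)
    also have "\<dots> = integral (cbox 0 ?s) (\<lambda>x. integral (cbox (0, 0) (?s, 2 * pi))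
        (\<lambda>yz. D (x, yz) (0, 1, 0) - x * D (x, yz) (0, 0, 1)))"
      by (subst integral_prod_continuous) (auto intro!: comp continuous_intros)
    also have "\<dots> = integral (cbox 0 ?s) (\<lambda>x. 0)"
    proof (rule integral_cong)
      fix x
      have "integral (cbox (0, 0) (?s, 2 * pi)) (\<lambda>yz. D (x, yz) (0, 1, 0) - x * D (x, yz) (0, 0, 1))
          = integral (cbox (0, 0) (?s, 2 * pi)) (\<lambda>yz. D (x, yz) (0, 1, 0))
          - x * integral (cbox (0, 0) (?s, 2 * pi)) (\<lambda>yz. D (x, yz) (0, 0, 1))"
        unfolding integral_mult_right[symmetric]
        by (rule Henstock_Kurzweil_Integration.integral_diff; rule integrable_continuous) (auto intro!: comp continuous_intros)
      also have "integral (cbox (0, 0) (?s, 2 * pi)) (\<lambda>yz. D (x, yz) (0, 0, 1))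
          = integral (cbox 0 ?s) (\<lambda>y. integral (cbox 0 (2 * pi)) (\<lambda>z. D (x, y, z) (0, 0, 1)))"
        by (subst integral_prod_continuous) (auto intro!: comp continuous_intros)
      also have "\<dots> = integral (cbox 0 ?s) (\<lambda>y. 0)"
      proof (rule integral_cong)
        fix y
        have "((\<lambda>z. D (x, y, z) (0, 0, 1)) has_integral ?u (x, y, 2 * pi) - ?u (x, y, 0)) {0..2 * pi}"
        proof (rule fundamental_theorem_of_calculus)
          show "((\<lambda>z. ?u (x, y, z)) has_vector_derivative D (x, y, z) (0, 0, 1)) (at z within {0..2 * pi})" for z
            by (rule der) (intro has_vector_derivative_Pair has_vector_derivative_id[unfolded id_def] has_vector_derivative_const)
        qed simp
        then show "integral (cbox 0 (2 * pi)) (\<lambda>z. D (x, y, z) (0, 0, 1)) = 0"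
          using mfd_lift_invariant(3)[of v x y 0] by (simp add: integral_unique)
      qed
      also have "integral (cbox (0, 0) (?s, 2 * pi)) (\<lambda>yz. D (x, yz) (0, 1, 0))
          = integral (cbox 0 ?s) (\<lambda>y. integral (cbox 0 (2 * pi)) (\<lambda>z. D (x, y, z) (0, 1, 0)))"
        by (subst integral_prod_continuous) (auto intro!: comp continuous_intros)
      also have "\<dots> = integral (cbox 0 (2 * pi)) (\<lambda>z. integral (cbox 0 ?s) (\<lambda>y. D (x, y, z) (0, 1, 0)))"
        by (rule integral_swap_continuous) (auto simp: split_def intro!: comp continuous_intros)
      also have "\<dots> = integral (cbox 0 (2 * pi)) (\<lambda>z. 0)"
      proof (rule integral_cong)
        fix z
        have "((\<lambda>y. D (x, y, z) (0, 1, 0)) has_integral ?u (x, ?s, z) - ?u (x, 0, z)) {0..?s}"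
        proof (rule fundamental_theorem_of_calculus)
          show "((\<lambda>y. ?u (x, y, z)) has_vector_derivative D (x, y, z) (0, 1, 0)) (at y within {0..?s})" for y
            by (rule der) (intro has_vector_derivative_Pair has_vector_derivative_id[unfolded id_def] has_vector_derivative_const)
        qed simp
        then show "integral (cbox 0 ?s) (\<lambda>y. D (x, y, z) (0, 1, 0)) = 0"
          using mfd_lift_invariant(2)[of v x z] by (simp add: integral_unique)
      qed
      finally show "integral (cbox (0, 0) (?s, 2 * pi)) (\<lambda>yz. D (x, yz) (0, 1, 0) - x * D (x, yz) (0, 0, 1)) = 0" by simp
    qed
    finally show ?thesis by simp
  qed
  finally show ?thesis .
qed

section \<open>Square-integrable functions\<close>

definition square_integrable :: "'a measure \<Rightarrow> ('a \<Rightarrow> real) \<Rightarrow> bool" where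
  "square_integrable M v \<longleftrightarrow> v \<in> borel_measurable M \<and> integrable M (\<lambda>x. (v x)\<^sup>2)"

lemma square_integrable_mult:
  assumes "square_integrable M v" "square_integrable M w"
  shows "integrable M (\<lambda>x. v x * w x)"
proof (rule Bochner_Integration.integrable_bound)
  show "integrable M (\<lambda>x. (v x)\<^sup>2 + (w x)\<^sup>2)" using assms by (simp add: square_integrable_def)
  show "(\<lambda>x. v x * w x) \<in> borel_measurable M" using assms by (auto simp: square_integrable_def)
  have "\<bar>a * b\<bar> \<le> a\<^sup>2 + b\<^sup>2" for a b :: real
  proof -
    have "0 \<le> (\<bar>a\<bar> - \<bar>b\<bar>)\<^sup>2" by simp
    then have "2 * (\<bar>a\<bar> * \<bar>b\<bar>) \<le> a\<^sup>2 + b\<^sup>2" by (simp add: power2_diff)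
    moreover have "0 \<le> \<bar>a\<bar> * \<bar>b\<bar>" by simp
    ultimately show ?thesis unfolding abs_mult by linarith
  qed
  then show "AE x in M. norm (v x * w x) \<le> norm ((v x)\<^sup>2 + (w x)\<^sup>2)" by (intro AE_I2) (simp add: order_trans[OF _ abs_ge_self])
qed

lemma square_integrable_diff:
  assumes "square_integrable M v" "square_integrable M w"
  shows "square_integrable M (\<lambda>x. v x - w x)"
proof -
  have "integrable M (\<lambda>x. (v x)\<^sup>2 + (w x)\<^sup>2 - 2 * (v x * w x))"
    using assms square_integrable_mult[OF assms] by (auto simp: square_integrable_def)
  then show ?thesis using assms by (auto simp: square_integrable_def power2_diff algebra_simps)
qed

lemma Cauchy_Schwarz_integral:
  assumes v: "square_integrable M v" and w: "square_integrable M w"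
  shows "(\<integral>x. v x * w x \<partial>M)\<^sup>2 \<le> (\<integral>x. (v x)\<^sup>2 \<partial>M) * (\<integral>x. (w x)\<^sup>2 \<partial>M)"
proof -
  have vm[measurable]: "v \<in> borel_measurable M" "w \<in> borel_measurable M" using v w by (auto simp: square_integrable_def)
  have sq: "(\<integral>\<^sup>+x. (ennreal \<bar>u x\<bar>)\<^sup>2 \<partial>M) = ennreal (\<integral>x. (u x)\<^sup>2 \<partial>M)" if "square_integrable M u" for u
  proof -
    have "(\<integral>\<^sup>+x. (ennreal \<bar>u x\<bar>)\<^sup>2 \<partial>M) = (\<integral>\<^sup>+x. ennreal ((u x)\<^sup>2) \<partial>M)" by (simp add: ennreal_power)
    then show ?thesis using that by (subst nn_integral_eq_integral[symmetric]) (auto simp: square_integrable_def)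
  qed
  have int: "integrable M (\<lambda>x. v x * w x)" by (rule square_integrable_mult[OF v w])
  have "(\<integral>\<^sup>+x. ennreal \<bar>v x\<bar> * ennreal \<bar>w x\<bar> \<partial>M) = ennreal (\<integral>x. \<bar>v x * w x\<bar> \<partial>M)"
    by (subst nn_integral_eq_integral[symmetric])
      (use Bochner_Integration.integrable_abs[OF int] in \<open>auto simp: abs_mult ennreal_mult\<close>)
  moreover have "(\<integral>\<^sup>+x. ennreal \<bar>v x\<bar> * ennreal \<bar>w x\<bar> \<partial>M)\<^sup>2
      \<le> (\<integral>\<^sup>+x. (ennreal \<bar>v x\<bar>)\<^sup>2 \<partial>M) * (\<integral>\<^sup>+x. (ennreal \<bar>w x\<bar>)\<^sup>2 \<partial>M)"
    by (rule Cauchy_Schwarz_nn_integral) auto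
  ultimately have "(\<integral>x. \<bar>v x * w x\<bar> \<partial>M)\<^sup>2 \<le> (\<integral>x. (v x)\<^sup>2 \<partial>M) * (\<integral>x. (w x)\<^sup>2 \<partial>M)"
    unfolding sq[OF v] sq[OF w] by (simp add: ennreal_power ennreal_mult[symmetric])
  moreover have "\<bar>\<integral>x. v x * w x \<partial>M\<bar> \<le> (\<integral>x. \<bar>v x * w x\<bar> \<partial>M)" by (rule integral_abs_bound)
  then have "(\<integral>x. v x * w x \<partial>M)\<^sup>2 \<le> (\<integral>x. \<bar>v x * w x\<bar> \<partial>M)\<^sup>2" by (simp add: abs_le_square_iff[symmetric])
  ultimately show ?thesis by linarith
qed

lemma L2_inner_tendsto:
  assumes v: "\<And>n. square_integrable M (v n)" and a: "square_integrable M a" and w: "square_integrable M w"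
    and lim: "(\<lambda>n. \<integral>x. (v n x - a x)\<^sup>2 \<partial>M) \<longlonglongrightarrow> 0"
  shows "(\<lambda>n. \<integral>x. v n x * w x \<partial>M) \<longlonglongrightarrow> (\<integral>x. a x * w x \<partial>M)"
proof -
  let ?W = "\<integral>x. (w x)\<^sup>2 \<partial>M"
  have "(\<lambda>n. ((\<integral>x. v n x * w x \<partial>M) - (\<integral>x. a x * w x \<partial>M))\<^sup>2) \<longlonglongrightarrow> 0"
  proof (rule tendsto_sandwich[of "\<lambda>_. 0"])
    have "((\<integral>x. v n x * w x \<partial>M) - (\<integral>x. a x * w x \<partial>M))\<^sup>2 \<le> (\<integral>x. (v n x - a x)\<^sup>2 \<partial>M) * ?W" for n
    proof -
      have "(\<integral>x. v n x * w x \<partial>M) - (\<integral>x. a x * w x \<partial>M) = (\<integral>x. (v n x - a x) * w x \<partial>M)"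
        unfolding left_diff_distrib
        by (rule Bochner_Integration.integral_diff[symmetric]) (use v a w square_integrable_mult in auto)
      then show ?thesis using Cauchy_Schwarz_integral[OF square_integrable_diff[OF v[of n] a] w] by simp
    qed
    then show "\<forall>\<^sub>F n in sequentially. ((\<integral>x. v n x * w x \<partial>M) - (\<integral>x. a x * w x \<partial>M))\<^sup>2 \<le> (\<integral>x. (v n x - a x)\<^sup>2 \<partial>M) * ?W" by simp
    show "(\<lambda>n. (\<integral>x. (v n x - a x)\<^sup>2 \<partial>M) * ?W) \<longlonglongrightarrow> 0" using tendsto_mult_left_zero[OF lim] .
  qed auto
  from tendsto_real_sqrt[OF this]
  have "(\<lambda>n. \<bar>(\<integral>x. v n x * w x \<partial>M) - (\<integral>x. a x * w x \<partial>M)\<bar>) \<longlonglongrightarrow> 0" by simp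
  then have "(\<lambda>n. (\<integral>x. v n x * w x \<partial>M) - (\<integral>x. a x * w x \<partial>M)) \<longlonglongrightarrow> 0"
    by (rule tendsto_rabs_zero_cancel)
  then show ?thesis by (rule LIM_zero_cancel)
qed

text \<open>The classical proof: along a subsequence the increments \<open>g k\<close> have norms decreasing like \<open>2 ^ (- k)\<close>. The
  measure is finite, so they are absolutely summable almost everywhere; the pointwise limit is also the
  limit in the mean by Fatou's lemma.\<close>

lemma square_integrable_complete:
  assumes fin: "finite_measure M" and v: "\<And>n. square_integrable M (v n)"
    and Cauchy: "\<And>e. 0 < e \<Longrightarrow> \<exists>N. \<forall>m\<ge>N. \<forall>n\<ge>N. (\<integral>x. (v m x - v n x)\<^sup>2 \<partial>M) < e"
  obtains a where "square_integrable M a" "(\<lambda>n. \<integral>x. (v n x - a x)\<^sup>2 \<partial>M) \<longlonglongrightarrow> 0"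
proof -
  interpret finite_measure M by (rule fin)
  have vm[measurable]: "v n \<in> borel_measurable M" for n using v by (simp add: square_integrable_def)
  have vi: "integrable M (\<lambda>x. (v m x - v n x)\<^sup>2)" for m n
    using square_integrable_diff[OF v v] by (simp add: square_integrable_def)
  have "\<exists>N. \<forall>m\<ge>N. \<forall>n\<ge>N. (\<integral>x. (v m x - v n x)\<^sup>2 \<partial>M) < (1 / 4) ^ k" for k by (rule Cauchy) simp
  then obtain N where N: "\<And>k m n. m \<ge> N k \<Longrightarrow> n \<ge> N k \<Longrightarrow> (\<integral>x. (v m x - v n x)\<^sup>2 \<partial>M) < (1 / 4) ^ k" by metis
  \<comment> \<open>A strictly increasing choice of indices beyond the thresholds \<open>N k\<close>.\<close>
  define r where "r = rec_nat (N 0) (\<lambda>k r. max (r + 1) (N (Suc k)))"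
  have r: "r 0 = N 0" "r (Suc k) = max (r k + 1) (N (Suc k))" for k by (simp_all add: r_def)
  have rN: "N k \<le> r k" for k by (cases k) (simp_all add: r)
  have rS: "strict_mono r" by (simp add: strict_mono_Suc_iff r less_max_iff_disj)
  define g where "g = (\<lambda>k x. v (r (Suc k)) x - v (r k) x)"
  have gm[measurable]: "g k \<in> borel_measurable M" for k by (simp add: g_def)
  have g2: "(\<integral>x. (g k x)\<^sup>2 \<partial>M) < (1 / 4) ^ k" for k
    unfolding g_def using rN[of k] r(2)[of k] by (intro N) auto
  have gi: "integrable M (\<lambda>x. (g k x)\<^sup>2)" for k unfolding g_def by (rule vi)
  let ?\<mu> = "measure M (space M)"
  have g1: "(\<integral>\<^sup>+x. ennreal \<bar>g k x\<bar> \<partial>M) \<le> ennreal ((?\<mu> + 1) * (1 / 2) ^ k)" for k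
  proof -
    have le: "\<bar>g k x\<bar> \<le> (1 / 2) ^ k + 2 ^ k * (g k x)\<^sup>2" for x
    proof -
      have "0 \<le> ((1 / 2) ^ k - \<bar>g k x\<bar>)\<^sup>2" by simp
      then have "2 * (1 / 2) ^ k * \<bar>g k x\<bar> \<le> ((1 / 2) ^ k)\<^sup>2 + (g k x)\<^sup>2" by (simp add: power2_diff)
      then have "2 ^ k * (2 * (1 / 2) ^ k * \<bar>g k x\<bar>) \<le> 2 ^ k * (((1 / 2) ^ k)\<^sup>2 + (g k x)\<^sup>2)" by (rule mult_left_mono) simp
      moreover have "(2 :: real) ^ k * (1 / 2) ^ k = 1" by (simp add: power_mult_distrib[symmetric])
      then have "2 ^ k * (2 * (1 / 2) ^ k * \<bar>g k x\<bar>) = 2 * \<bar>g k x\<bar>" "2 ^ k * ((1 / 2) ^ k)\<^sup>2 = ((1 / 2) :: real) ^ k"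
        by (simp_all add: power2_eq_square mult.assoc[symmetric] mult.commute[of _ 2])
      ultimately show ?thesis by (simp add: distrib_left)
    qed
    have "(\<integral>\<^sup>+x. ennreal \<bar>g k x\<bar> \<partial>M) \<le> (\<integral>\<^sup>+x. ennreal ((1 / 2) ^ k + 2 ^ k * (g k x)\<^sup>2) \<partial>M)"
      by (intro nn_integral_mono ennreal_leI le)
    also have "\<dots> = ennreal (\<integral>x. (1 / 2) ^ k + 2 ^ k * (g k x)\<^sup>2 \<partial>M)"
      using gi[of k] by (intro nn_integral_eq_integral) auto
    also have "\<dots> \<le> ennreal ((?\<mu> + 1) * (1 / 2) ^ k)"
    proof (rule ennreal_leI)
      have "(\<integral>x. (1 / 2) ^ k + 2 ^ k * (g k x)\<^sup>2 \<partial>M) = (1 / 2) ^ k * ?\<mu> + 2 ^ k * (\<integral>x. (g k x)\<^sup>2 \<partial>M)"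
        using gi[of k] by (subst Bochner_Integration.integral_add) auto
      also have "\<dots> \<le> (1 / 2) ^ k * ?\<mu> + 2 ^ k * (1 / 4) ^ k"
        using g2[of k] by (intro add_left_mono mult_left_mono) auto
      also have "(2 :: real) ^ k * (1 / 4) ^ k = (1 / 2) ^ k" by (simp add: power_mult_distrib[symmetric])
      finally show "(\<integral>x. (1 / 2) ^ k + 2 ^ k * (g k x)\<^sup>2 \<partial>M) \<le> (?\<mu> + 1) * (1 / 2) ^ k"
        by (simp add: algebra_simps)
    qed
    finally show ?thesis .
  qed
  have "(\<integral>\<^sup>+x. (\<Sum>k. ennreal \<bar>g k x\<bar>) \<partial>M) = (\<Sum>k. \<integral>\<^sup>+x. ennreal \<bar>g k x\<bar> \<partial>M)"
    by (rule nn_integral_suminf) simp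
  also have "\<dots> \<le> (\<Sum>k. ennreal ((?\<mu> + 1) * (1 / 2) ^ k))" by (intro suminf_le g1) auto
  also have "\<dots> < top"
  proof -
    have "summable (\<lambda>k. (?\<mu> + 1) * (1 / 2 :: real) ^ k)" by (intro summable_mult summable_geometric) simp
    then show ?thesis by (subst suminf_ennreal2) auto
  qed
  finally have "AE x in M. (\<Sum>k. ennreal \<bar>g k x\<bar>) \<noteq> \<infinity>" by (intro nn_integral_PInf_AE) auto
  then have "AE x in M. convergent (\<lambda>k. v (r k) x)"
  proof eventually_elim
    fix x assume "(\<Sum>k. ennreal \<bar>g k x\<bar>) \<noteq> \<infinity>"
    then have "summable (\<lambda>k. \<bar>g k x\<bar>)" by (intro summable_suminf_not_top) auto
    then have "summable (\<lambda>k. g k x)" by (rule summable_rabs_cancel)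
    then have "convergent (\<lambda>n. \<Sum>k<n. g k x)" by (simp add: summable_iff_convergent)
    moreover have "(\<Sum>k<n. g k x) = v (r n) x - v (r 0) x" for n
      unfolding g_def by (rule sum_lessThan_telescope)
    ultimately have "convergent (\<lambda>n. v (r n) x - v (r 0) x)" by simp
    then show "convergent (\<lambda>n. v (r n) x)" using convergent_diff_const_right_iff by blast
  qed
  then have conv: "AE x in M. (\<lambda>k. v (r k) x) \<longlonglongrightarrow> lim (\<lambda>k. v (r k) x)" by eventually_elim (simp add: convergent_LIMSEQ_iff)
  define a where "a = (\<lambda>x. lim (\<lambda>k. v (r k) x))"
  have am[measurable]: "a \<in> borel_measurable M" unfolding a_def by measurable
  have bound: "(\<integral>\<^sup>+x. ennreal ((v m x - a x)\<^sup>2) \<partial>M) \<le> ennreal e"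
    if e: "0 < e" and m: "\<And>m n. m \<ge> K \<Longrightarrow> n \<ge> K \<Longrightarrow> (\<integral>x. (v m x - v n x)\<^sup>2 \<partial>M) < e" and "m \<ge> K" for e K m
  proof -
    have "(\<integral>\<^sup>+x. ennreal ((v m x - a x)\<^sup>2) \<partial>M) = (\<integral>\<^sup>+x. liminf (\<lambda>k. ennreal ((v m x - v (r k) x)\<^sup>2)) \<partial>M)"
    proof (rule nn_integral_cong_AE, use conv in eventually_elim)
      fix x assume "(\<lambda>k. v (r k) x) \<longlonglongrightarrow> lim (\<lambda>k. v (r k) x)"
      then have "(\<lambda>k. ennreal ((v m x - v (r k) x)\<^sup>2)) \<longlonglongrightarrow> ennreal ((v m x - a x)\<^sup>2)"
        unfolding a_def by (intro tendsto_ennrealI tendsto_intros)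
      then show "ennreal ((v m x - a x)\<^sup>2) = liminf (\<lambda>k. ennreal ((v m x - v (r k) x)\<^sup>2))"
        by (rule lim_imp_Liminf[OF trivial_limit_sequentially, symmetric])
    qed
    also have "\<dots> \<le> liminf (\<lambda>k. \<integral>\<^sup>+x. ennreal ((v m x - v (r k) x)\<^sup>2) \<partial>M)" by (rule nn_integral_liminf) simp
    also have "\<dots> \<le> ennreal e"
    proof (rule Liminf_le)
      have "(\<integral>\<^sup>+x. ennreal ((v m x - v (r k) x)\<^sup>2) \<partial>M) \<le> ennreal e" if "k \<ge> K" for k
      proof -
        have "r k \<ge> K" using seq_suble[OF rS, of k] that by simp
        then show ?thesis using m[OF \<open>m \<ge> K\<close>, of "r k"] vi by (subst nn_integral_eq_integral) (auto intro!: ennreal_leI)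
      qed
      then show "\<forall>\<^sub>F k in sequentially. (\<integral>\<^sup>+x. ennreal ((v m x - v (r k) x)\<^sup>2) \<partial>M) \<le> ennreal e"
        by (auto simp: eventually_sequentially)
    qed simp
    finally show ?thesis .
  qed
  have sq: "square_integrable M (\<lambda>x. v m x - a x)" if "e > 0" "\<And>m n. m \<ge> K \<Longrightarrow> n \<ge> K \<Longrightarrow> (\<integral>x. (v m x - v n x)\<^sup>2 \<partial>M) < e" "m \<ge> K" for e K m
    unfolding square_integrable_def
  proof
    have "(\<integral>\<^sup>+x. ennreal (norm ((v m x - a x)\<^sup>2)) \<partial>M) < \<infinity>"
      using le_less_trans[OF bound[OF that] ennreal_less_top] by simp
    then show "integrable M (\<lambda>x. (v m x - a x)\<^sup>2)" by (intro integrableI_bounded) simp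
  qed simp
  obtain K where K: "\<And>m n. m \<ge> K \<Longrightarrow> n \<ge> K \<Longrightarrow> (\<integral>x. (v m x - v n x)\<^sup>2 \<partial>M) < 1" using Cauchy[of 1] by auto
  have "square_integrable M (\<lambda>x. v K x - (v K x - a x))" by (rule square_integrable_diff[OF v sq[OF _ K]]) auto
  then have a: "square_integrable M a" by simp
  have "(\<lambda>n. \<integral>x. (v n x - a x)\<^sup>2 \<partial>M) \<longlonglongrightarrow> 0"
  proof (rule LIMSEQ_I)
    fix e :: real assume "0 < e"
    then obtain K where K: "\<And>m n. m \<ge> K \<Longrightarrow> n \<ge> K \<Longrightarrow> (\<integral>x. (v m x - v n x)\<^sup>2 \<partial>M) < e / 2" using Cauchy[of "e / 2"] by auto
    have "norm ((\<integral>x. (v m x - a x)\<^sup>2 \<partial>M) - 0) < e" if m: "m \<ge> K" for m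
    proof -
      have "ennreal (\<integral>x. (v m x - a x)\<^sup>2 \<partial>M) = (\<integral>\<^sup>+x. ennreal ((v m x - a x)\<^sup>2) \<partial>M)"
        using square_integrable_diff[OF v a] by (intro nn_integral_eq_integral[symmetric]) (auto simp: square_integrable_def)
      also have "\<dots> \<le> ennreal (e / 2)" by (rule bound[OF _ K m]) (use \<open>0 < e\<close> in auto)
      finally show ?thesis using \<open>0 < e\<close> by simp
    qed
    then show "\<exists>K. \<forall>m\<ge>K. norm ((\<integral>x. (v m x - a x)\<^sup>2 \<partial>M) - 0) < e" by blast
  qed
  then show ?thesis using that a by blast
qed

section \<open>Smooth eigenfunctions\<close>

lemma L2_UNIV: "L2 UNIV v \<longleftrightarrow> square_integrable mfd_measure v"
  by (simp add: L2_def square_integrable_def restrict_mfd_measure)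

lemma L2_inner_UNIV: "L2_inner UNIV v w = (\<integral>q. v q * w q \<partial>mfd_measure)"
  by (simp add: L2_inner_def restrict_mfd_measure)

lemma L2_normsq_UNIV: "L2_normsq UNIV v = (\<integral>q. (v q)\<^sup>2 \<partial>mfd_measure)"
  by (simp add: L2_normsq_def L2_inner_UNIV power2_eq_square)

lemma L2_lim_UNIV: "L2_lim UNIV v a \<longleftrightarrow> (\<lambda>n. \<integral>q. (v n q - a q)\<^sup>2 \<partial>mfd_measure) \<longlonglongrightarrow> 0"
  by (simp add: L2_lim_def L2_normsq_UNIV)

lemma mfd_smooth_square_integrable: "mfd_smooth v \<Longrightarrow> square_integrable mfd_measure v"
  using mfd_smooth_integrable[OF mfd_smooth_mult, of v v] mfd_smooth_measurable[of v]
  by (simp add: square_integrable_def power2_eq_square)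

lemma integration_by_parts_mfd:
  assumes v: "mfd_smooth v" and w: "mfd_smooth w" and V: "V = X1 \<or> V = Y1"
  shows "L2_inner UNIV (mfd_deriv V v) w = - L2_inner UNIV v (mfd_deriv V w)"
proof -
  have "mfd_deriv V (\<lambda>q. v q * w q) = (\<lambda>q. mfd_deriv V v q * w q + v q * mfd_deriv V w q)"
    by (rule ext) (rule mfd_deriv_mult[OF v w V])
  then have "(\<integral>q. mfd_deriv V v q * w q + v q * mfd_deriv V w q \<partial>mfd_measure) = 0"
    using integral_mfd_deriv_zero[OF mfd_smooth_mult[OF v w] V] by simp
  moreover have "(\<integral>q. mfd_deriv V v q * w q + v q * mfd_deriv V w q \<partial>mfd_measure)
      = (\<integral>q. mfd_deriv V v q * w q \<partial>mfd_measure) + (\<integral>q. v q * mfd_deriv V w q \<partial>mfd_measure)"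
    by (rule Bochner_Integration.integral_add; rule mfd_smooth_integrable; intro mfd_smooth_mult mfd_smooth_deriv v w V)
  ultimately show ?thesis by (simp add: L2_inner_UNIV)
qed

lemma L2_inner_lim:
  assumes "\<And>n. mfd_smooth (v n)" "L2 UNIV a" "L2 UNIV w" "L2_lim UNIV v a"
  shows "(\<lambda>n. L2_inner UNIV (v n) w) \<longlonglongrightarrow> L2_inner UNIV a w"
  using L2_inner_tendsto[of mfd_measure v a w] assms mfd_smooth_square_integrable
  by (simp add: L2_UNIV L2_inner_UNIV L2_lim_UNIV)

lemma L2_inner_commute: "L2_inner UNIV v w = L2_inner UNIV w v"
  by (simp add: L2_inner_UNIV mult.commute)

lemma form_dom_smooth:
  assumes v: "mfd_smooth v"
  shows "form_dom UNIV v"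
proof -
  have d: "mfd_deriv V (\<lambda>q. v q - v q) = (\<lambda>q. 0)" if "V = X1 \<or> V = Y1" for V
    using mfd_deriv_diff[OF v v that] by (simp add: fun_eq_iff)
  show ?thesis unfolding form_dom_def
    using v d[of X1] d[of Y1] mfd_smooth_square_integrable[OF v]
    by (intro conjI exI[of _ "\<lambda>n. v"]) (auto simp: test_fun_UNIV L2_UNIV L2_lim_UNIV L2_normsq_UNIV split_def)
qed

text \<open>Completeness makes the pair chosen by \<open>horiz_grad\<close> a genuine pair of limits of derivatives.\<close>

lemma form_dom_has_horiz_grad:
  assumes w: "form_dom UNIV w"
  shows "has_horiz_grad UNIV w (horiz_grad UNIV w)"
proof -
  obtain v where v: "\<And>n. mfd_smooth (v n)" "L2_lim UNIV v w"
    and C: "((\<lambda>(n, l). L2_normsq UNIV (mfd_deriv X1 (\<lambda>q. v n q - v l q))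
                 + L2_normsq UNIV (mfd_deriv Y1 (\<lambda>q. v n q - v l q)))
          \<longlongrightarrow> 0) (sequentially \<times>\<^sub>F sequentially)"
    using w unfolding form_dom_def test_fun_UNIV by blast
  have "\<exists>a. square_integrable mfd_measure a \<and> L2_lim UNIV (\<lambda>n. mfd_deriv V (v n)) a" if V: "V = X1 \<or> V = Y1" for V
  proof -
    have "\<exists>N. \<forall>m\<ge>N. \<forall>n\<ge>N. (\<integral>q. (mfd_deriv V (v m) q - mfd_deriv V (v n) q)\<^sup>2 \<partial>mfd_measure) < e" if "0 < e" for e
    proof -
      have "\<forall>\<^sub>F (n, l) in sequentially \<times>\<^sub>F sequentially. L2_normsq UNIV (mfd_deriv X1 (\<lambda>q. v n q - v l q))
                 + L2_normsq UNIV (mfd_deriv Y1 (\<lambda>q. v n q - v l q)) < e"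
        using order_tendstoD(2)[OF C \<open>0 < e\<close>] by (simp add: split_def)
      then obtain N where N: "\<And>n l. n \<ge> N \<Longrightarrow> l \<ge> N \<Longrightarrow> L2_normsq UNIV (mfd_deriv X1 (\<lambda>q. v n q - v l q))
                 + L2_normsq UNIV (mfd_deriv Y1 (\<lambda>q. v n q - v l q)) < e"
        unfolding eventually_prod_sequentially by auto
      have "(\<integral>q. (mfd_deriv V (v m) q - mfd_deriv V (v n) q)\<^sup>2 \<partial>mfd_measure) < e" if "m \<ge> N" "n \<ge> N" for m n
      proof -
        have "L2_normsq UNIV (mfd_deriv V' (\<lambda>q. v m q - v n q)) \<ge> 0" for V' by (simp add: L2_normsq_UNIV)
        then have "L2_normsq UNIV (mfd_deriv V (\<lambda>q. v m q - v n q)) < e"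
          using N[OF that] V by (smt (verit))
        then show ?thesis unfolding mfd_deriv_diff[OF v(1) v(1) V] L2_normsq_UNIV .
      qed
      then show ?thesis by blast
    qed
    then obtain a where "square_integrable mfd_measure a"
        "(\<lambda>n. \<integral>q. (mfd_deriv V (v n) q - a q)\<^sup>2 \<partial>mfd_measure) \<longlonglongrightarrow> 0"
      by (rule square_integrable_complete[OF finite_measure_mfd mfd_smooth_square_integrable[OF mfd_smooth_deriv[OF v(1) V]]])
    then show ?thesis unfolding L2_lim_UNIV by blast
  qed
  then obtain a b where "square_integrable mfd_measure a" "L2_lim UNIV (\<lambda>n. mfd_deriv X1 (v n)) a"
      "square_integrable mfd_measure b" "L2_lim UNIV (\<lambda>n. mfd_deriv Y1 (v n)) b" by blast
  then have "has_horiz_grad UNIV w (a, b)"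
    unfolding has_horiz_grad_def prod.case using v by (intro conjI exI[of _ v]) (auto simp: L2_UNIV test_fun_UNIV)
  then show ?thesis unfolding horiz_grad_def by (rule someI)
qed

text \<open>Let \<open>E \<phi>\<close> and \<open>E w\<close> be limits in the mean of \<open>V v\<^sub>n\<close> and \<open>V u\<^sub>n\<close> with smooth \<open>v\<^sub>n \<rightarrow> \<phi>\<close> and
  \<open>u\<^sub>n \<rightarrow> w\<close>. Integration by parts shows that \<open>E \<phi>\<close> and \<open>V \<phi>\<close> have the same inner product with every
  smooth function. The functions \<open>V u\<^sub>n\<close> are themselves smooth, so
  \<open>(E \<phi>, V u\<^sub>n) = (V \<phi>, V u\<^sub>n) = - (V (V \<phi>), u\<^sub>n)\<close>, and \<open>n \<rightarrow> \<infinity>\<close> gives \<open>(E \<phi>, E w) = - (V (V \<phi>), w)\<close>.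
  In this way the form is evaluated without identifying \<open>E \<phi>\<close> with \<open>V \<phi>\<close> almost everywhere.\<close>

theorem smooth_sub_laplacian:
  assumes \<phi>: "mfd_smooth \<phi>"
    and eq: "\<And>q. mfd_deriv X1 (mfd_deriv X1 \<phi>) q + mfd_deriv Y1 (mfd_deriv Y1 \<phi>) q = f q"
  shows "sub_laplacian UNIV \<phi> f"
proof -
  have grad: "\<exists>v. (\<forall>n. mfd_smooth (v n)) \<and> L2_lim UNIV v w \<and>
      L2_lim UNIV (\<lambda>n. mfd_deriv X1 (v n)) (X1_ext UNIV w) \<and> L2_lim UNIV (\<lambda>n. mfd_deriv Y1 (v n)) (Y1_ext UNIV w)"
    and gradL2: "L2 UNIV (X1_ext UNIV w)" "L2 UNIV (Y1_ext UNIV w)" if "form_dom UNIV w" for w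
    using form_dom_has_horiz_grad[OF that]
    unfolding has_horiz_grad_def X1_ext_def Y1_ext_def test_fun_UNIV by (auto simp: split_def)
  note \<phi>D = form_dom_smooth[OF \<phi>]
  have main: "L2_inner UNIV (E \<phi>) (E w) = - L2_inner UNIV (mfd_deriv V (mfd_deriv V \<phi>)) w"
    if w: "form_dom UNIV w" and VE: "V = X1 \<and> E = X1_ext UNIV \<or> V = Y1 \<and> E = Y1_ext UNIV" for w V E
  proof -
    have V: "V = X1 \<or> V = Y1" using VE by blast
    obtain v where v: "\<And>n. mfd_smooth (v n)" "L2_lim UNIV v \<phi>" "L2_lim UNIV (\<lambda>n. mfd_deriv V (v n)) (E \<phi>)"
      using grad[OF \<phi>D] VE by blast
    obtain u where u: "\<And>n. mfd_smooth (u n)" "L2_lim UNIV u w" "L2_lim UNIV (\<lambda>n. mfd_deriv V (u n)) (E w)"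
      using grad[OF w] VE by blast
    have E: "L2 UNIV (E \<phi>)" "L2 UNIV (E w)" using gradL2[OF \<phi>D] gradL2[OF w] VE by auto
    have sL2: "L2 UNIV g" if "mfd_smooth g" for g using mfd_smooth_square_integrable[OF that] by (simp add: L2_UNIV)
    have wL2: "L2 UNIV w" using w by (simp add: form_dom_def)
    note sm = mfd_smooth_deriv[OF _ V]
    have weak: "L2_inner UNIV (E \<phi>) g = L2_inner UNIV (mfd_deriv V \<phi>) g" if g: "mfd_smooth g" for g
    proof -
      have "(\<lambda>n. L2_inner UNIV (mfd_deriv V (v n)) g) \<longlonglongrightarrow> L2_inner UNIV (E \<phi>) g"
        by (rule L2_inner_lim) (use v sm E sL2[OF g] in auto)
      moreover have "(\<lambda>n. - L2_inner UNIV (v n) (mfd_deriv V g)) \<longlonglongrightarrow> - L2_inner UNIV \<phi> (mfd_deriv V g)"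
        by (intro tendsto_minus L2_inner_lim) (use v sL2[OF \<phi>] sL2[OF sm[OF g]] in auto)
      ultimately have "L2_inner UNIV (E \<phi>) g = - L2_inner UNIV \<phi> (mfd_deriv V g)"
        using integration_by_parts_mfd[OF v(1) g V] LIMSEQ_unique by fastforce
      then show ?thesis using integration_by_parts_mfd[OF \<phi> g V] by simp
    qed
    have "(\<lambda>n. L2_inner UNIV (mfd_deriv V (u n)) (E \<phi>)) \<longlonglongrightarrow> L2_inner UNIV (E w) (E \<phi>)"
      by (rule L2_inner_lim) (use u sm E in auto)
    moreover have "L2_inner UNIV (mfd_deriv V (u n)) (E \<phi>) = - L2_inner UNIV (u n) (mfd_deriv V (mfd_deriv V \<phi>))" for n
      using weak[OF sm[OF u(1)]] integration_by_parts_mfd[OF u(1) sm[OF \<phi>] V] by (simp add: L2_inner_commute)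
    moreover have "(\<lambda>n. - L2_inner UNIV (u n) (mfd_deriv V (mfd_deriv V \<phi>))) \<longlonglongrightarrow> - L2_inner UNIV w (mfd_deriv V (mfd_deriv V \<phi>))"
      by (intro tendsto_minus L2_inner_lim) (use u wL2 sL2[OF sm[OF sm[OF \<phi>]]] in auto)
    ultimately have "L2_inner UNIV (E w) (E \<phi>) = - L2_inner UNIV w (mfd_deriv V (mfd_deriv V \<phi>))"
      using LIMSEQ_unique by fastforce
    then show ?thesis by (simp add: L2_inner_commute)
  qed
  have sm: "mfd_smooth (mfd_deriv X1 (mfd_deriv X1 \<phi>))" "mfd_smooth (mfd_deriv Y1 (mfd_deriv Y1 \<phi>))"
    using \<phi> by (auto intro: mfd_smooth_deriv)
  have f: "f = (\<lambda>q. mfd_deriv X1 (mfd_deriv X1 \<phi>) q + mfd_deriv Y1 (mfd_deriv Y1 \<phi>) q)" using eq by auto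
  then have fs: "mfd_smooth f" using mfd_smooth_add[OF sm] by simp
  show ?thesis unfolding sub_laplacian_def
  proof (intro conjI allI impI)
    show "form_dom UNIV \<phi>" by (rule \<phi>D)
    show "L2 UNIV f" using mfd_smooth_square_integrable[OF fs] by (simp add: L2_UNIV)
    fix w assume w: "form_dom UNIV w"
    then have wS: "square_integrable mfd_measure w" by (simp add: form_dom_def L2_UNIV)
    have "L2_inner UNIV f w = L2_inner UNIV (mfd_deriv X1 (mfd_deriv X1 \<phi>)) w + L2_inner UNIV (mfd_deriv Y1 (mfd_deriv Y1 \<phi>)) w"
      unfolding L2_inner_UNIV f distrib_right
      by (rule Bochner_Integration.integral_add; rule square_integrable_mult[OF mfd_smooth_square_integrable wS]) (use sm in auto)
    then show "- L2_inner UNIV (X1_ext UNIV \<phi>) (X1_ext UNIV w) - L2_inner UNIV (Y1_ext UNIV \<phi>) (Y1_ext UNIV w) = L2_inner UNIV f w"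
      using main[OF w, of X1 "X1_ext UNIV"] main[OF w, of Y1 "Y1_ext UNIV"] by simp
  qed
qed

lemma smooth_eigenfunction:
  assumes \<phi>: "mfd_smooth \<phi>" and nz: "\<phi> q0 \<noteq> 0"
    and eq: "\<And>q. mfd_deriv X1 (mfd_deriv X1 \<phi>) q + mfd_deriv Y1 (mfd_deriv Y1 \<phi>) q = - ev * \<phi> q"
  shows "eigenfunction UNIV ev \<phi>"
  unfolding eigenfunction_def restrict_mfd_measure
proof (intro conjI smooth_sub_laplacian[OF \<phi>] eq notI)
  let ?s = "sqrt (2 * pi)"
  let ?B = "box (0, 0, 0) (?s, ?s, 2 * pi) :: heis set"
  let ?u = "\<lambda>p. \<phi> (proj_mfd p)"
  assume AE: "AE q in mfd_measure. \<phi> q = 0"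
  have cont: "continuous_on UNIV ?u" using mfd_smooth_continuous[OF \<phi>] by (simp add: continuous_on_mfd_iff)
  have cl: "closed {p. ?u p = 0}" by (intro closed_Collect_eq cont continuous_intros)
  have B: "?B \<subseteq> heis_fund_dom" by (auto simp: heis_fund_dom_def mem_box Basis_prod_def)
  have "AE p in restrict_space lborel heis_fund_dom. ?u p = 0"
    using AE mfd_smooth_measurable[OF \<phi>] unfolding mfd_measure_def
    by (subst (asm) AE_distr_iff) auto
  then have "AE p in lborel. p \<in> heis_fund_dom \<longrightarrow> ?u p = 0"
    by (subst (asm) AE_restrict_space_iff) (auto simp: heis_fund_dom_borel)
  then have "AE p in lebesgue. p \<in> ?B \<longrightarrow> p \<in> {p. ?u p = 0}"
    by (intro AE_completion) (use B in \<open>auto elim!: eventually_mono\<close>)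
  then have zero: "?u p = 0" if "p \<in> ?B" for p
    using mem_closed_if_AE_lebesgue_open[OF open_box cl _ that] by simp
  have "closure ?B \<subseteq> {p. ?u p = 0}" by (rule closure_minimal[OF _ cl]) (use zero in auto)
  moreover have "closure ?B = cbox (0, 0, 0) (?s, ?s, 2 * pi)"
    by (rule closure_box) (simp add: box_ne_empty Basis_prod_def)
  ultimately have "?u p = 0" if "p \<in> heis_fund_dom" for p using that heis_fund_dom_sub_box by blast
  then show False using nz heis_fund_dom_representative[of q0] by blast
qed

section \<open>Theta functions\<close>

text \<open>For \<open>b = c = 0\<close> the summand is the translate of \<open>exp (- n * x\<^sup>2 / 2) * cos (n * z)\<close> by a lattice element. The
  exponent \<open>b\<close> and the phase shift by \<open>c\<close> quarter turns are there to make the family closed under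
  differentiation, up to multiplication by \<open>x\<close>.\<close>

definition theta_term :: "nat \<Rightarrow> nat \<Rightarrow> nat \<Rightarrow> int \<Rightarrow> heis \<Rightarrow> real" where
  "theta_term n b c j p = of_int j ^ b
     * cos (real n * (period * of_int j * fst (snd p) + snd (snd p)) + real c * (pi / 2))
     * exp (- real n * (fst p - period * of_int j)\<^sup>2 / 2)"

definition theta :: "nat \<Rightarrow> nat \<Rightarrow> nat \<Rightarrow> heis \<Rightarrow> real" where
  "theta n b c p = (\<Sum>\<^sub>\<infinity>j. theta_term n b c j p)"

lemma power_le_fact_exp:
  fixes t :: real
  assumes "0 \<le> t"
  shows "t ^ b \<le> fact b * exp t"
proof -
  have "(\<Sum>k\<in>{b}. t ^ k /\<^sub>R fact k) \<le> (\<Sum>k. t ^ k /\<^sub>R fact k)"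
    using assms by (intro sum_le_suminf summable_exp_generic) auto
  then have "t ^ b / fact b \<le> exp t" by (simp add: exp_def divide_inverse mult.commute)
  then show ?thesis by (simp add: divide_le_eq mult.commute)
qed

lemma abs_int_decode_ge: "real m \<le> 2 * \<bar>real_of_int (int_decode m)\<bar>"
proof (cases "even m")
  case True
  then show ?thesis by (auto simp: int_decode_def sum_decode_def elim!: evenE)
next
  case False
  then show ?thesis by (auto simp: int_decode_def sum_decode_def elim!: oddE)
qed

lemma abs_of_int_le_square: "\<bar>of_int i :: real\<bar> \<le> (of_int i)\<^sup>2"
proof (cases "i = 0")
  case False
  then have "1 \<le> \<bar>i\<bar>" by simp
  then have "1 \<le> \<bar>of_int i :: real\<bar>" by (metis of_int_1_le_iff of_int_abs)
  then have "\<bar>of_int i :: real\<bar> * 1 \<le> \<bar>of_int i\<bar> * \<bar>of_int i\<bar>" by (intro mult_left_mono) auto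
  then show ?thesis by (simp add: power2_eq_square)
qed simp

text \<open>For \<open>\<bar>x\<bar> \<le> R\<close> the exponent is at most \<open>n * R\<^sup>2 / 2 - pi * \<bar>j\<bar> / 2\<close>. One half of the decay in \<open>\<bar>j\<bar>\<close> absorbs
  the factor \<open>\<bar>j\<bar> ^ b\<close>, the other half gives a geometric series in the index \<open>m \<le> 2 * \<bar>j\<bar>\<close> of \<open>j\<close> in the
  enumeration \<open>int_decode\<close>.\<close>

definition theta_majorant :: "nat \<Rightarrow> nat \<Rightarrow> real \<Rightarrow> nat \<Rightarrow> real" where
  "theta_majorant n b R m = exp (real n * R\<^sup>2 / 2) * (fact b / (pi / 4) ^ b) * exp (- pi / 8) ^ m"

lemma summable_theta_majorant: "summable (theta_majorant n b R)"
  unfolding theta_majorant_def by (intro summable_mult summable_geometric) simp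

lemma theta_term_le_majorant:
  assumes n: "0 < n" and x: "\<bar>fst p\<bar> \<le> R"
  shows "\<bar>theta_term n b c (int_decode m) p\<bar> \<le> theta_majorant n b R m"
proof -
  define j where "j = real_of_int (int_decode m)"
  have jm: "real m \<le> 2 * \<bar>j\<bar>" unfolding j_def by (rule abs_int_decode_ge)
  have jj: "\<bar>j\<bar> \<le> j\<^sup>2" unfolding j_def by (rule abs_of_int_le_square)
  have "(fst p)\<^sup>2 \<le> R\<^sup>2" using x by (metis abs_ge_zero order_trans power2_abs power_mono)
  moreover have "0 \<le> (2 * fst p - period * j)\<^sup>2" by simp
  then have "pi * j\<^sup>2 - (fst p)\<^sup>2 \<le> (fst p - period * j)\<^sup>2"
    by (simp add: power2_diff power_mult_distrib algebra_simps)
  ultimately have "pi * \<bar>j\<bar> - R\<^sup>2 \<le> (fst p - period * j)\<^sup>2"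
    using mult_left_mono[OF jj pi_ge_zero] by linarith
  then have "real n * (pi * \<bar>j\<bar> - R\<^sup>2) \<le> real n * (fst p - period * j)\<^sup>2" by (rule mult_left_mono) simp
  then have "real n * (pi * \<bar>j\<bar>) - real n * R\<^sup>2 \<le> real n * (fst p - period * j)\<^sup>2"
    unfolding right_diff_distrib .
  moreover have "1 * (pi * \<bar>j\<bar>) \<le> real n * (pi * \<bar>j\<bar>)" using n by (intro mult_right_mono) auto
  ultimately have "- (real n * (fst p - period * j)\<^sup>2) / 2 \<le> real n * R\<^sup>2 / 2 + (- (pi / 4 * \<bar>j\<bar>) - pi / 4 * \<bar>j\<bar>)"
    by linarith
  then have "- real n * (fst p - period * j)\<^sup>2 / 2 \<le> real n * R\<^sup>2 / 2 + (- (pi / 4 * \<bar>j\<bar>) - pi / 4 * \<bar>j\<bar>)"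
    unfolding mult_minus_left .
  then have "exp (- real n * (fst p - period * j)\<^sup>2 / 2) \<le> exp (real n * R\<^sup>2 / 2 + (- (pi / 4 * \<bar>j\<bar>) - pi / 4 * \<bar>j\<bar>))"
    by simp
  also have "\<dots> = exp (real n * R\<^sup>2 / 2) * (exp (- (pi / 4 * \<bar>j\<bar>)) * exp (- (pi / 4 * \<bar>j\<bar>)))"
    by (simp add: exp_add[symmetric])
  finally have e: "exp (- real n * (fst p - period * j)\<^sup>2 / 2)
      \<le> exp (real n * R\<^sup>2 / 2) * (exp (- (pi / 4 * \<bar>j\<bar>)) * exp (- (pi / 4 * \<bar>j\<bar>)))" .
  have "(pi / 4 * \<bar>j\<bar>) ^ b \<le> fact b * exp (pi / 4 * \<bar>j\<bar>)" by (rule power_le_fact_exp) simp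
  then have "\<bar>j\<bar> ^ b \<le> (fact b / (pi / 4) ^ b) * exp (pi / 4 * \<bar>j\<bar>)"
    by (simp add: power_mult_distrib field_simps)
  then have "\<bar>j\<bar> ^ b * exp (- (pi / 4 * \<bar>j\<bar>)) \<le> (fact b / (pi / 4) ^ b) * exp (pi / 4 * \<bar>j\<bar>) * exp (- (pi / 4 * \<bar>j\<bar>))"
    by (rule mult_right_mono) simp
  also have "\<dots> = fact b / (pi / 4) ^ b" by (simp add: mult.assoc exp_add[symmetric] del: times_divide_eq_left)
  finally have jb: "\<bar>j\<bar> ^ b * exp (- (pi / 4 * \<bar>j\<bar>)) \<le> fact b / (pi / 4) ^ b" .
  have "- (pi / 4 * \<bar>j\<bar>) \<le> real m * (- pi / 8)" using mult_left_mono[OF jm, of "pi / 8"] by (simp add: algebra_simps)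
  then have "exp (- (pi / 4 * \<bar>j\<bar>)) \<le> exp (real m * (- pi / 8))" by simp
  also have "\<dots> = exp (- pi / 8) ^ m" by (rule exp_of_nat_mult)
  finally have em: "exp (- (pi / 4 * \<bar>j\<bar>)) \<le> exp (- pi / 8) ^ m" .
  have "\<bar>theta_term n b c (int_decode m) p\<bar> = \<bar>j\<bar> ^ b
     * \<bar>cos (real n * (period * j * fst (snd p) + snd (snd p)) + real c * (pi / 2))\<bar>
     * exp (- real n * (fst p - period * j)\<^sup>2 / 2)"
    by (simp add: theta_term_def j_def abs_mult power_abs)
  also have "\<dots> \<le> \<bar>j\<bar> ^ b * 1 * (exp (real n * R\<^sup>2 / 2) * (exp (- (pi / 4 * \<bar>j\<bar>)) * exp (- (pi / 4 * \<bar>j\<bar>))))"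
    by (intro mult_mono mult_left_mono e) auto
  also have "\<dots> = exp (real n * R\<^sup>2 / 2) * (\<bar>j\<bar> ^ b * exp (- (pi / 4 * \<bar>j\<bar>))) * exp (- (pi / 4 * \<bar>j\<bar>))"
    by (simp add: mult_ac)
  also have "\<dots> \<le> exp (real n * R\<^sup>2 / 2) * (fact b / (pi / 4) ^ b) * exp (- pi / 8) ^ m"
    using jb em by (intro mult_mono mult_left_mono) auto
  finally show ?thesis by (simp add: theta_majorant_def)
qed

lemma theta_sums:
  assumes n: "0 < n"
  shows "(\<lambda>m. theta_term n b c (int_decode m) p) sums theta n b c p"
proof -
  let ?f = "\<lambda>m. theta_term n b c (int_decode m) p"
  have abs: "summable (\<lambda>m. norm (?f m))"
    by (rule summable_comparison_test'[OF summable_theta_majorant[of n b "\<bar>fst p\<bar>"], of 0])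
      (use theta_term_le_majorant[OF n order_refl] in auto)
  then have s: "?f sums suminf ?f" by (rule summable_sums[OF summable_norm_cancel])
  have "(?f has_sum suminf ?f) UNIV" by (rule norm_summable_imp_has_sum[OF abs s])
  then have "((\<lambda>j. theta_term n b c j p) has_sum suminf ?f) UNIV"
    using has_sum_reindex_bij_betw[OF bij_int_decode, of "\<lambda>j. theta_term n b c j p"] by simp
  then have "theta n b c p = suminf ?f" unfolding theta_def by (rule infsumI)
  then show ?thesis using s by simp
qed

text \<open>A translation by the lattice element \<open>(sqrt (2 * pi) * a, sqrt (2 * pi) * b, 2 * pi * c)\<close> shifts the summation
  index by \<open>a\<close>, and changes the phase by a multiple of \<open>2 * pi\<close> because \<open>sqrt (2 * pi)\<close> squared is
  \<open>2 * pi\<close>.\<close>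

lemma theta_invariant:
  assumes "g \<in> heis_lattice"
  shows "theta n 0 0 (heis_mult g p) = theta n 0 0 p"
proof -
  obtain x y z where p: "p = (x, y, z)" by (cases p)
  obtain a b c where g: "g = (period * of_int a, period * of_int b, 2 * pi * of_int c)"
    using assms unfolding heis_lattice_def by blast
  have "theta_term n 0 0 j (heis_mult g p) = theta_term n 0 0 (j - a) p" for j
  proof -
    have pp: "period * (period * r) = 2 * pi * r" for r :: real by (simp add: mult.assoc[symmetric])
    have "real n * (period * of_int j * (period * of_int b + y) + (2 * pi * of_int c + z - period * of_int a * y))
        = real n * (period * of_int (j - a) * y + z) + of_int (int n * (j * b + c)) * (2 * pi)"
      by (simp add: algebra_simps pp)
    then have E1: "cos (real n * (period * of_int j * (period * of_int b + y) + (2 * pi * of_int c + z - period * of_int a * y)))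
        = cos (real n * (period * of_int (j - a) * y + z))"
      by (simp only: cos.plus_of_int[where 'a = real, unfolded of_real_eq_id id_apply])
    have E2: "period * of_int a + x - period * of_int j = x - period * of_int (j - a)" by (simp add: algebra_simps)
    show ?thesis
      unfolding p g by (simp only: theta_term_def heis_mult.simps fst_conv snd_conv power_0 of_nat_0 mult_zero_left add_0_right E1 E2)
  qed
  then have "theta n 0 0 (heis_mult g p) = (\<Sum>\<^sub>\<infinity>j. theta_term n 0 0 (j - a) p)" by (simp add: theta_def)
  also have "\<dots> = theta n 0 0 p" unfolding theta_def
    by (rule infsum_reindex_bij_betw) (rule bij_betwI[of _ _ _ "\<lambda>j. j + a"]; simp)
  finally show ?thesis .
qed

text \<open>The derivative in closed form, for a single term and for the series alike; \<open>T b c\<close> stands for either.\<close>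

definition theta_deriv :: "(nat \<Rightarrow> nat \<Rightarrow> heis \<Rightarrow> real) \<Rightarrow> nat \<Rightarrow> nat \<Rightarrow> nat \<Rightarrow> heis \<Rightarrow> heis \<Rightarrow> real" where
  "theta_deriv T n b c p h =
      fst h * (real n * period * T (b + 1) c p - real n * (fst p * T b c p))
    + fst (snd h) * (real n * period * T (b + 1) (c + 1) p)
    + snd (snd h) * (real n * T b (c + 1) p)"

lemma theta_term_has_derivative:
  "(theta_term n b c j has_derivative theta_deriv (\<lambda>b c. theta_term n b c j) n b c p) (at p)"
proof -
  define ph where "ph = (\<lambda>p::heis. real n * (period * of_int j * fst (snd p) + snd (snd p)) + real c * (pi / 2))"
  define ex where "ex = (\<lambda>p::heis. - real n * (fst p - period * of_int j)\<^sup>2 / 2)"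
  have ph': "(ph has_derivative (\<lambda>h. real n * (period * of_int j * fst (snd h) + snd (snd h)))) (at p)"
    unfolding ph_def by (auto intro!: derivative_eq_intros)
  have ex': "(ex has_derivative (\<lambda>h. - (real n * (fst p - period * of_int j) * fst h))) (at p)"
    unfolding ex_def by (auto intro!: derivative_eq_intros simp: power2_eq_square fun_eq_iff field_simps)
  have T: "theta_term n b c j = (\<lambda>p. of_int j ^ b * cos (ph p) * exp (ex p))"
    by (simp add: fun_eq_iff theta_term_def ph_def ex_def)
  have s: "cos (\<theta> + real (c + 1) * (pi / 2)) = - sin (\<theta> + real c * (pi / 2))" for \<theta>
  proof -
    have "\<theta> + real (c + 1) * (pi / 2) = (\<theta> + real c * (pi / 2)) + pi / 2" by (simp add: algebra_simps)
    then show ?thesis by (simp only: cos_add sin_pi_half cos_pi_half)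
  qed
  have U: "theta_deriv (\<lambda>b c. theta_term n b c j) n b c p h = of_int j ^ b * exp (ex p) *
      (fst h * (real n * period * of_int j * cos (ph p) - real n * fst p * cos (ph p))
       - sin (ph p) * real n * (period * of_int j * fst (snd h) + snd (snd h)))" for h
    unfolding theta_deriv_def theta_term_def s ph_def ex_def power_add power_one_right
    by (simp add: algebra_simps)
  have "((\<lambda>p. of_int j ^ b * cos (ph p) * exp (ex p)) has_derivative theta_deriv (\<lambda>b c. theta_term n b c j) n b c p) (at p)"
  proof (rule has_derivative_eq_rhs)
    show "((\<lambda>p. of_int j ^ b * cos (ph p) * exp (ex p)) has_derivative
        (\<lambda>h. of_int j ^ b * cos (ph p) * (exp (ex p) * - (real n * (fst p - period * of_int j) * fst h))
          + of_int j ^ b * (- sin (ph p) * (real n * (period * of_int j * fst (snd h) + snd (snd h)))) * exp (ex p))) (at p)"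
      by (auto intro!: derivative_eq_intros ph' ex' simp: fun_eq_iff)
    show "(\<lambda>h. of_int j ^ b * cos (ph p) * (exp (ex p) * - (real n * (fst p - period * of_int j) * fst h))
          + of_int j ^ b * (- sin (ph p) * (real n * (period * of_int j * fst (snd h) + snd (snd h)))) * exp (ex p))
        = theta_deriv (\<lambda>b c. theta_term n b c j) n b c p"
      unfolding fun_eq_iff U by (simp add: algebra_simps)
  qed
  then show ?thesis unfolding T[symmetric] .
qed

text \<open>Termwise differentiation on the ball around \<open>0\<close> of radius \<open>R\<close>: the four series that enter the derivative
  converge uniformly there, and the coefficients are bounded by \<open>n * R\<close>, \<open>n * sqrt (2 * pi)\<close> and \<open>n\<close>.\<close>

lemma theta_has_derivative:
  assumes n: "0 < n"
  shows "(theta n b c has_derivative theta_deriv (theta n) n b c p) (at p)"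
proof -
  define R where "R = norm p + 1"
  have R: "0 \<le> R" by (simp add: R_def)
  let ?B = "ball 0 R :: heis set"
  let ?T = "\<lambda>m b c. theta_term n b c (int_decode m)"
  have xR: "\<bar>fst q\<bar> \<le> R" if "q \<in> ?B" for q
    using that norm_fst_le[of "fst q" "snd q"] by simp
  have unif: "uniform_limit ?B (\<lambda>N q. \<Sum>m<N. ?T m b c q) (theta n b c) sequentially" for b c
  proof -
    have "uniform_limit ?B (\<lambda>N q. \<Sum>m<N. ?T m b c q) (\<lambda>q. \<Sum>m. ?T m b c q) sequentially"
      by (rule Weierstrass_m_test[OF _ summable_theta_majorant[of n b R]])
        (use theta_term_le_majorant[OF n xR] in auto)
    moreover have "(\<lambda>q. \<Sum>m. ?T m b c q) = theta n b c" using theta_sums[OF n] by (auto simp: sums_iff)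
    ultimately show ?thesis by simp
  qed
  have "\<exists>g. \<forall>q\<in>?B. (\<lambda>m. ?T m b c q) sums g q \<and> (g has_derivative theta_deriv (theta n) n b c q) (at q within ?B)"
  proof (rule has_derivative_series[where f' = "\<lambda>m q. theta_deriv (?T m) n b c q" and x = p])
    show "p \<in> ?B" by (simp add: R_def)
    show "(?T m b c has_derivative theta_deriv (?T m) n b c q) (at q within ?B)" for m q
      by (rule has_derivative_at_withinI[OF theta_term_has_derivative])
    show "(\<lambda>m. ?T m b c p) sums theta n b c p" by (rule theta_sums[OF n])
    fix e :: real assume e: "0 < e"
    define L where "L = real n * (R + 2 * period + 1)"
    have L: "0 < L" using n R by (simp add: L_def add_nonneg_pos)
    have e': "0 < e / L" using e L by simp
    have small: "\<forall>\<^sub>F N in sequentially. \<forall>q\<in>?B. \<bar>(\<Sum>m<N. ?T m b' c' q) - theta n b' c' q\<bar> < e / L" for b' c'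
      using uniform_limitD[OF unif[of b' c'] e'] by (simp add: dist_real_def)
    show "\<forall>\<^sub>F N in sequentially. \<forall>q\<in>?B. \<forall>h. norm ((\<Sum>m<N. theta_deriv (?T m) n b c q h) - theta_deriv (theta n) n b c q h) \<le> e * norm h"
      using small[of b c] small[of "b + 1" c] small[of "b + 1" "c + 1"] small[of b "c + 1"]
    proof eventually_elim
      case (elim N)
      show ?case
      proof (intro ballI allI)
        fix q h assume q: "q \<in> ?B"
        define d where "d = (\<lambda>b' c'. (\<Sum>m<N. ?T m b' c' q) - theta n b' c' q)"
        have d: "\<bar>d b c\<bar> \<le> e / L" "\<bar>d (b + 1) c\<bar> \<le> e / L" "\<bar>d (b + 1) (c + 1)\<bar> \<le> e / L" "\<bar>d b (c + 1)\<bar> \<le> e / L"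
          using elim q unfolding d_def by (auto intro: less_imp_le)
        have h: "\<bar>fst h\<bar> \<le> norm h" "\<bar>fst (snd h)\<bar> \<le> norm h" "\<bar>snd (snd h)\<bar> \<le> norm h"
          using norm_fst_le[of "fst h" "snd h"] norm_fst_le[of "fst (snd h)" "snd (snd h)"]
            norm_snd_le[of "snd (snd h)" "fst (snd h)"] norm_snd_le[of "snd h" "fst h"]
          by auto
        have "(\<Sum>m<N. theta_deriv (?T m) n b c q h) - theta_deriv (theta n) n b c q h
            = fst h * (real n * period * d (b + 1) c - real n * (fst q * d b c))
            + fst (snd h) * (real n * period * d (b + 1) (c + 1)) + snd (snd h) * (real n * d b (c + 1))"
          unfolding theta_deriv_def d_def
          by (simp add: sum.distrib sum_subtractf sum_distrib_left[symmetric] algebra_simps)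
        also have "\<bar>\<dots>\<bar> \<le> norm h * (real n * period * (e / L) + real n * (R * (e / L)))
            + norm h * (real n * period * (e / L)) + norm h * (real n * (e / L))"
        proof -
          have "\<bar>real n * period * d (b + 1) c - real n * (fst q * d b c)\<bar> \<le> real n * period * (e / L) + real n * (R * (e / L))"
          proof -
            have "\<bar>real n * period * d (b + 1) c\<bar> \<le> real n * period * (e / L)"
              unfolding abs_mult using d by (intro mult_mono) auto
            moreover have "\<bar>real n * (fst q * d b c)\<bar> \<le> real n * (R * (e / L))"
              unfolding abs_mult using d xR[OF q] R by (intro mult_mono) auto
            ultimately show ?thesis by linarith
          qed
          then have 1: "\<bar>fst h * (real n * period * d (b + 1) c - real n * (fst q * d b c))\<bar>
              \<le> norm h * (real n * period * (e / L) + real n * (R * (e / L)))"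
            unfolding abs_mult[of "fst h"] using h by (intro mult_mono) auto
          have "\<bar>fst (snd h) * (real n * period * d (b + 1) (c + 1))\<bar>
              = \<bar>fst (snd h)\<bar> * (real n * period * \<bar>d (b + 1) (c + 1)\<bar>)"
            by (simp only: abs_mult abs_of_nat abs_of_pos[OF period_pos])
          also have "\<dots> \<le> norm h * (real n * period * (e / L))"
            by (rule mult_mono[OF h(2) mult_left_mono[OF d(3)]]) simp_all
          finally have 2: "\<bar>fst (snd h) * (real n * period * d (b + 1) (c + 1))\<bar> \<le> norm h * (real n * period * (e / L))" .
          have "\<bar>snd (snd h) * (real n * d b (c + 1))\<bar> = \<bar>snd (snd h)\<bar> * (real n * \<bar>d b (c + 1)\<bar>)"
            by (simp only: abs_mult abs_of_nat)
          also have "\<dots> \<le> norm h * (real n * (e / L))"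
            by (rule mult_mono[OF h(3) mult_left_mono[OF d(4)]]) simp_all
          finally have 3: "\<bar>snd (snd h) * (real n * d b (c + 1))\<bar> \<le> norm h * (real n * (e / L))" .
          have abs3: "\<bar>u + v + w\<bar> \<le> \<bar>u\<bar> + \<bar>v\<bar> + \<bar>w\<bar>" for u v w :: real by linarith
          show ?thesis by (rule order_trans[OF abs3 add_mono[OF add_mono[OF 1 2] 3]])
        qed
        also have "\<dots> = norm h * ((real n * (R + 2 * period + 1)) * (e / L))"
        proof -
          have "u * (a * P * E + a * (R * E)) + u * (a * P * E) + u * (a * E) = u * ((a * (R + 2 * P + 1)) * E)" for u a P E :: real
            by (simp add: algebra_simps)
          then show ?thesis .
        qed
        also have "\<dots> = norm h * (L * (e / L))" by (simp only: L_def[symmetric])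
        also have "\<dots> = e * norm h" using L by simp
        finally show "norm ((\<Sum>m<N. theta_deriv (?T m) n b c q h) - theta_deriv (theta n) n b c q h) \<le> e * norm h"
          by simp
      qed
    qed
  qed auto
  then obtain g where g: "\<And>q. q \<in> ?B \<Longrightarrow> (\<lambda>m. ?T m b c q) sums g q"
    "\<And>q. q \<in> ?B \<Longrightarrow> (g has_derivative theta_deriv (theta n) n b c q) (at q within ?B)" by blast
  have gt: "g q = theta n b c q" if "q \<in> ?B" for q using g(1)[OF that] theta_sums[OF n] sums_unique2 by blast
  have p: "p \<in> ?B" by (simp add: R_def)
  have "(theta n b c has_derivative theta_deriv (theta n) n b c p) (at p within ?B)"
    by (rule has_derivative_transform[OF p _ g(2)[OF p]]) (use gt in auto)
  then show ?thesis using at_within_open[OF p] by simp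
qed

lemma Ck_theta:
  assumes n: "0 < n"
  shows "Ck k (theta n b c)"
proof (induction k arbitrary: b c)
  case 0
  have "isCont (theta n b c) p" for p by (rule has_derivative_continuous, rule theta_has_derivative, rule n)
  then have "continuous_on UNIV (theta n b c)" by (intro continuous_at_imp_continuous_on ballI)
  then show ?case unfolding Ck.simps .
next
  case (Suc k)
  have fstC: "Ck k (fst :: heis \<Rightarrow> real)" by (rule Ck_bounded_linear) (rule bounded_linear_fst)
  show ?case
  proof (rule Ck_SucI[where D = "theta_deriv (theta n) n b c"])
    show "(theta n b c has_derivative theta_deriv (theta n) n b c p) (at p)" for p
      by (rule theta_has_derivative[OF n])
    show "Ck k (\<lambda>p. theta_deriv (theta n) n b c p h)" for h
      unfolding theta_deriv_def by (intro Ck_add Ck_diff Ck_mult Ck_const Suc fstC)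
  qed
qed

lemma theta_phase_shift: "theta n b (c + 2) p = - theta n b c p"
proof -
  have s: "cos (\<theta> + real (c + 2) * (pi / 2)) = - cos (\<theta> + real c * (pi / 2))" for \<theta>
  proof -
    have "\<theta> + real (c + 2) * (pi / 2) = (\<theta> + real c * (pi / 2)) + pi" by (simp add: algebra_simps)
    then show ?thesis by (simp only: cos_periodic_pi)
  qed
  have "theta_term n b (c + 2) j p = - theta_term n b c j p" for j
    unfolding theta_term_def s by simp
  then show ?thesis by (simp add: theta_def infsum_uminus)
qed

definition theta_mfd :: "nat \<Rightarrow> heis_mfd \<Rightarrow> real" where
  "theta_mfd n q = theta n 0 0 (rep_mfd q)"

lemma theta_mfd_proj: "theta_mfd n (proj_mfd p) = theta n 0 0 p"
proof -
  obtain g where "g \<in> heis_lattice" "rep_mfd (proj_mfd p) = heis_mult g p"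
    using proj_mfd_eq_iff[of p "rep_mfd (proj_mfd p)"] by auto
  then show ?thesis by (simp add: theta_mfd_def theta_invariant)
qed

lemma mfd_smooth_theta: "0 < n \<Longrightarrow> mfd_smooth (theta_mfd n)"
  by (simp add: mfd_smooth_def theta_mfd_proj Ck_theta)

text \<open>Each application of \<open>Y1\<close> makes a quarter turn, and two of them change the sign
  (\<open>theta_phase_shift\<close>), so the second-order terms of \<open>X1\<close> and \<open>Y1\<close> cancel. What remains is
  \<open>- n * theta n 0 0\<close>, from differentiating the factor \<open>x\<close> in the first derivative along \<open>X1\<close>.\<close>

lemma sub_laplacian_theta:
  assumes n: "0 < n"
  shows "mfd_deriv X1 (mfd_deriv X1 (theta_mfd n)) q + mfd_deriv Y1 (mfd_deriv Y1 (theta_mfd n)) q = - real n * theta_mfd n q"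
proof -
  obtain p where q: "q = proj_mfd p" by (metis proj_rep_mfd)
  let ?x = "fst p"
  have Y: "fst (Y1 p) = 0" "fst (snd (Y1 p)) = 1" "snd (snd (Y1 p)) = - fst p" for p by (cases p; simp)+
  note sm = mfd_smooth_theta[OF n]
  have lift: "(\<lambda>p. theta_mfd n (proj_mfd p)) = theta n 0 0" by (simp add: theta_mfd_proj fun_eq_iff)
  have D: "mfd_deriv V (theta_mfd n) (proj_mfd p) = theta_deriv (theta n) n 0 0 p (V p)" if "V = X1 \<or> V = Y1" for V p
    by (rule mfd_deriv_eqI[OF sm that]) (unfold lift, rule theta_has_derivative[OF n])
  have DX: "(\<lambda>p. mfd_deriv X1 (theta_mfd n) (proj_mfd p)) = (\<lambda>p. real n * period * theta n 1 0 p - real n * (fst p * theta n 0 0 p))"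
    by (rule ext) (simp add: D theta_deriv_def X1_eq)
  have DY: "(\<lambda>p. mfd_deriv Y1 (theta_mfd n) (proj_mfd p)) = (\<lambda>p. real n * period * theta n 1 1 p - real n * (fst p * theta n 0 1 p))"
    by (rule ext) (simp add: D theta_deriv_def Y)
  have "mfd_deriv X1 (mfd_deriv X1 (theta_mfd n)) (proj_mfd p)
      = real n * period * theta_deriv (theta n) n 1 0 p (X1 p)
        - real n * (?x * theta_deriv (theta n) n 0 0 p (X1 p) + fst (X1 p) * theta n 0 0 p)"
    by (rule mfd_deriv_eqI[OF mfd_smooth_deriv[OF sm]], simp, simp, unfold DX)
      (rule has_derivative_diff has_derivative_mult_right has_derivative_mult has_derivative_fst has_derivative_ident theta_has_derivative[OF n])+
  moreover have "mfd_deriv Y1 (mfd_deriv Y1 (theta_mfd n)) (proj_mfd p)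
      = real n * period * theta_deriv (theta n) n 1 1 p (Y1 p)
        - real n * (?x * theta_deriv (theta n) n 0 1 p (Y1 p) + fst (Y1 p) * theta n 0 1 p)"
    by (rule mfd_deriv_eqI[OF mfd_smooth_deriv[OF sm]], simp, simp, unfold DY)
      (rule has_derivative_diff has_derivative_mult_right has_derivative_mult has_derivative_fst has_derivative_ident theta_has_derivative[OF n])+
  moreover have "theta n b (Suc (Suc 0)) p = - theta n b 0 p" for b using theta_phase_shift[of n b 0 p] by simp
  ultimately show ?thesis
    unfolding q by (simp add: theta_deriv_def X1_eq Y theta_mfd_proj numeral_2_eq_2) (simp add: algebra_simps)
qed

text \<open>The other translates are centred at \<open>x = sqrt (2 * pi) * j\<close>. For \<open>x\<close> at most a quarter period,
  \<open>(x - sqrt (2 * pi) * j)\<^sup>2 \<ge> x\<^sup>2 + pi * \<bar>j\<bar>\<close>, so they are bounded by a geometric series with small ratio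
  \<open>r = exp (- n * pi / 4)\<close>.\<close>

lemma theta_dominant_term:
  assumes n: "16 \<le> n" and x: "0 \<le> x" "x \<le> period / 4"
  shows "\<bar>theta n 0 0 (x, y, z) - exp (- real n * x\<^sup>2 / 2) * cos (real n * z)\<bar> \<le> exp (- real n * x\<^sup>2 / 2) / 2"
proof -
  let ?f = "\<lambda>m. theta_term n 0 0 (int_decode m) (x, y, z)"
  let ?e = "exp (- real n * x\<^sup>2 / 2)"
  define r where "r = exp (- real n * pi / 4)"
  have r: "0 < r" "r \<le> 1 / 3"
  proof -
    show "0 < r" by (simp add: r_def)
    have "2 \<le> real n * pi / 4"
    proof -
      have "16 * 3 \<le> real n * pi" using n pi_gt3 by (intro mult_mono) auto
      then show ?thesis by simp
    qed
    then have "3 \<le> exp (real n * pi / 4)" using exp_ge_add_one_self[of "real n * pi / 4"] by linarith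
    then have "inverse (exp (real n * pi / 4)) \<le> inverse 3" by (intro le_imp_inverse_le) auto
    moreover have "r = inverse (exp (real n * pi / 4))" unfolding r_def exp_minus[symmetric] by simp
    ultimately show "r \<le> 1 / 3" by simp
  qed
  have term_le: "\<bar>?f m\<bar> \<le> ?e * r ^ m" for m
  proof -
    define j where "j = real_of_int (int_decode m)"
    have jm: "real m \<le> 2 * \<bar>j\<bar>" unfolding j_def by (rule abs_int_decode_ge)
    have jj: "\<bar>j\<bar> \<le> j\<^sup>2" unfolding j_def by (rule abs_of_int_le_square)
    have "period * x * j \<le> pi * \<bar>j\<bar> / 2"
    proof -
      have "period * x * j \<le> period * x * \<bar>j\<bar>" using x by (intro mult_left_mono) auto
      also have "\<dots> \<le> period * (period / 4) * \<bar>j\<bar>" using x by (intro mult_right_mono mult_left_mono) auto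
      finally show ?thesis by (simp add: field_simps)
    qed
    moreover have "(x - period * j)\<^sup>2 = x\<^sup>2 - 2 * (period * x * j) + 2 * (pi * j\<^sup>2)"
      by (simp add: power2_diff power_mult_distrib)
    moreover have "pi * \<bar>j\<bar> \<le> pi * j\<^sup>2" using jj by (intro mult_left_mono) auto
    moreover have "pi * real m \<le> pi * (2 * \<bar>j\<bar>)" using jm by (intro mult_left_mono) auto
    ultimately have "x\<^sup>2 + pi * real m / 2 \<le> (x - period * j)\<^sup>2" by linarith
    then have "real n * (x\<^sup>2 + pi * real m / 2) \<le> real n * (x - period * j)\<^sup>2" by (rule mult_left_mono) simp
    then have "real n * x\<^sup>2 + real n * (pi * real m / 2) \<le> real n * (x - period * j)\<^sup>2" unfolding distrib_left .
    moreover have "real m * (- real n * pi / 4) = - (real n * (pi * real m / 2)) / 2" by simp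
    ultimately have "- (real n * (x - period * j)\<^sup>2) / 2 \<le> - (real n * x\<^sup>2) / 2 + real m * (- real n * pi / 4)"
      by linarith
    then have "- real n * (x - period * j)\<^sup>2 / 2 \<le> - real n * x\<^sup>2 / 2 + real m * (- real n * pi / 4)"
      unfolding mult_minus_left .
    then have "exp (- real n * (x - period * j)\<^sup>2 / 2) \<le> exp (- real n * x\<^sup>2 / 2 + real m * (- real n * pi / 4))" by simp
    also have "\<dots> = ?e * r ^ m" unfolding exp_add r_def exp_of_nat_mult[symmetric] by simp
    finally have "exp (- real n * (x - period * j)\<^sup>2 / 2) \<le> ?e * r ^ m" .
    moreover have "\<bar>?f m\<bar> \<le> 1 * exp (- real n * (x - period * j)\<^sup>2 / 2)"
      unfolding theta_term_def j_def abs_mult by (intro mult_mono) auto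
    ultimately show ?thesis by linarith
  qed
  have f0: "?f 0 = ?e * cos (real n * z)" by (simp add: theta_term_def int_decode_def sum_decode_def)
  have "?f sums theta n 0 0 (x, y, z)" by (rule theta_sums) (use n in simp)
  then have s: "(\<lambda>m. ?f (Suc m)) sums (theta n 0 0 (x, y, z) - ?f 0)"
    using sums_Suc_iff[of ?f "theta n 0 0 (x, y, z) - ?f 0"] by simp
  have geo: "(\<lambda>m. ?e * r ^ Suc m) sums (?e * (r * (1 / (1 - r))))"
    unfolding power_Suc by (intro sums_mult geometric_sums) (use r in auto)
  have "\<bar>theta n 0 0 (x, y, z) - ?f 0\<bar> \<le> ?e * (r * (1 / (1 - r)))"
  proof -
    have sum: "summable (\<lambda>m. \<bar>?f (Suc m)\<bar>)"
    proof (rule summable_comparison_test'[OF sums_summable[OF geo], of 0])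
      show "norm \<bar>?f (Suc m)\<bar> \<le> ?e * r ^ Suc m" for m
        using term_le[of "Suc m"] by (simp only: real_norm_def abs_idempotent)
    qed
    have "\<bar>theta n 0 0 (x, y, z) - ?f 0\<bar> \<le> (\<Sum>m. \<bar>?f (Suc m)\<bar>)"
      unfolding sums_unique[OF s] by (rule summable_rabs[OF sum])
    also have "\<dots> \<le> (\<Sum>m. ?e * r ^ Suc m)"
      by (rule suminf_le[OF term_le sum sums_summable[OF geo]])
    also have "\<dots> = ?e * (r * (1 / (1 - r)))" by (rule sums_unique[OF geo, symmetric])
    finally show ?thesis .
  qed
  also have "\<dots> \<le> ?e * (1 / 2)"
    using r by (intro mult_left_mono) (auto simp: divide_le_eq field_simps)
  finally show ?thesis unfolding f0 by simp
qed

section \<open>Sine functions and conclusion\<close>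

text \<open>At the two ends of the slab \<open>cos (n * z)\<close> takes the values \<open>sqrt 2 / 2\<close> and \<open>- sqrt 2 / 2\<close>, up to a
  common sign, while after division by \<open>exp (- n * x\<^sup>2 / 2)\<close> the other terms amount to at most one half. The theta function changes
  sign, and the intermediate value theorem applies on the fibre.\<close>

lemma theta_zero_on_fibre:
  fixes K k :: nat
  assumes K: "0 < K" and x: "x \<in> {period / 8..period / 4}"
  shows "\<exists>z\<in>{- (real k + 3 / 4) * pi / (16 * real K)..- (real k + 1 / 4) * pi / (16 * real K)}.
    theta (16 * K) 0 0 (x, (t - z) / x, z) = 0"
proof -
  let ?n = "16 * K"
  let ?lo = "- (real k + 3 / 4) * pi / (16 * real K)" and ?hi = "- (real k + 1 / 4) * pi / (16 * real K)"
  have s0: "0 < period" by simp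
  have x0: "0 < x" "x \<le> period / 4" using x s0 by (auto intro: less_le_trans[of _ "period / 8"])
  let ?e = "exp (- real ?n * x\<^sup>2 / 2)"
  define f where "f = (\<lambda>z. (- 1) ^ k * theta ?n 0 0 (x, (t - z) / x, z))"
  have n16: "16 \<le> ?n" using K by simp
  have dom: "\<bar>f z - ?e * ((- 1) ^ k * cos (real ?n * z))\<bar> \<le> ?e / 2" for z
  proof -
    have "f z - ?e * ((- 1) ^ k * cos (real ?n * z)) = (- 1) ^ k * (theta ?n 0 0 (x, (t - z) / x, z) - ?e * cos (real ?n * z))"
      by (simp add: f_def right_diff_distrib)
    then show ?thesis
      using theta_dominant_term[OF n16 less_imp_le[OF x0(1)] x0(2), of "(t - z) / x" z]
      by (simp add: abs_mult power_abs)
  qed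
  have half: "1 / 2 < sqrt 2 / 2" by simp
  have sgn: "(- 1) ^ k * ((- 1) ^ k * r) = r" for r :: real
    by (simp add: mult.assoc[symmetric] power_mult_distrib[symmetric])
  have lohi: "?lo \<le> ?hi" by (intro divide_right_mono mult_right_mono) auto
  have nlo: "real ?n * ?lo = - (real k * pi + 3 * pi / 4)" and nhi: "real ?n * ?hi = - (real k * pi + pi / 4)"
    using K by (simp_all add: field_simps)
  have "3 * pi / 4 = pi - pi / 4" by simp
  then have c34: "cos (3 * pi / 4) = - (sqrt 2 / 2)" by (simp only: cos_diff cos_pi sin_pi cos_45)
  have e: "?e / 2 < ?e * (sqrt 2 / 2)"
    using mult_strict_left_mono[OF half exp_gt_zero[of "- real ?n * x\<^sup>2 / 2"]] by (simp only: times_divide_eq_right mult_1_right)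
  have "cos (real ?n * ?lo) = (- 1) ^ k * (- (sqrt 2 / 2))"
    unfolding nlo cos_minus cos_add cos_npi sin_npi c34 by (simp only: mult_zero_left diff_zero)
  with dom[of ?lo] have "\<bar>f ?lo - ?e * (- (sqrt 2 / 2))\<bar> \<le> ?e / 2" by (simp only: sgn)
  with e have flo: "f ?lo \<le> 0" unfolding mult_minus_right by linarith
  have "cos (real ?n * ?hi) = (- 1) ^ k * (sqrt 2 / 2)"
    unfolding nhi cos_minus cos_add cos_npi sin_npi cos_45 by (simp only: mult_zero_left diff_zero)
  with dom[of ?hi] have "\<bar>f ?hi - ?e * (sqrt 2 / 2)\<bar> \<le> ?e / 2" by (simp only: sgn)
  with e have fhi: "0 \<le> f ?hi" by linarith
  have cont: "continuous_on UNIV (theta ?n 0 0)" using Ck_theta[of ?n 0 0 0] K by simp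
  have "continuous_on {?lo..?hi} f"
    unfolding f_def using x0(1) by (intro continuous_intros continuous_on_compose2[OF cont _ subset_UNIV]) auto
  then obtain z where "?lo \<le> z" "z \<le> ?hi" "f z = 0"
    using IVT'[OF flo fhi lohi] by blast
  then show ?thesis by (intro bexI[of _ z]) (auto simp: f_def)
qed

definition sine_mfd :: "nat \<Rightarrow> heis_mfd \<Rightarrow> real" where
  "sine_mfd k q = sin (period * real k * fst (rep_mfd q))"

lemma sine_mfd_proj: "sine_mfd k (proj_mfd p) = sin (period * real k * fst p)"
proof -
  obtain g where g: "g \<in> heis_lattice" "rep_mfd (proj_mfd p) = heis_mult g p"
    using proj_mfd_eq_iff[of p "rep_mfd (proj_mfd p)"] by auto
  obtain a b c where "g = (period * of_int a, period * of_int b, 2 * pi * of_int c)"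
    using g(1) unfolding heis_lattice_def by blast
  then have "fst (heis_mult g p) = period * of_int a + fst p" by (cases p) simp
  moreover have "period * real k * (period * of_int a + fst p) = period * real k * fst p + of_int (int k * a) * (2 * pi)"
  proof -
    have "period * real k * (period * of_int a) = (period * period) * (real k * of_int a)" by (simp only: mult_ac)
    also have "period * period = 2 * pi" by simp
    finally show ?thesis by (simp add: distrib_left mult_ac)
  qed
  ultimately show ?thesis
    unfolding sine_mfd_def g(2) by (simp only: sin.plus_of_int[where 'a = real, unfolded of_real_eq_id id_apply])
qed

lemma sine_has_derivative:
  "((\<lambda>p::heis. sin (w * fst p + c)) has_derivative (\<lambda>h. fst h * w * sin (w * fst p + (c + pi / 2)))) (at p)"
proof -
  have "sin (w * fst p + (c + pi / 2)) = cos (w * fst p + c)"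
    unfolding add.assoc[symmetric] sin_add sin_pi_half cos_pi_half by simp
  then show ?thesis by (auto intro!: derivative_eq_intros)
qed

lemma Ck_sine: "Ck l (\<lambda>p::heis. sin (w * fst p + c))"
proof (induction l arbitrary: c)
  case 0
  show ?case by (simp, intro continuous_intros)
next
  case (Suc l)
  show ?case
    by (rule Ck_SucI[where D = "\<lambda>p h. fst h * w * sin (w * fst p + (c + pi / 2))"], rule sine_has_derivative)
      (intro Ck_mult Ck_const Suc)
qed

lemma mfd_smooth_sine: "mfd_smooth (sine_mfd k)"
  using Ck_sine[of _ "period * real k" 0] by (simp add: mfd_smooth_def sine_mfd_proj)

lemma sub_laplacian_sine:
  "mfd_deriv X1 (mfd_deriv X1 (sine_mfd k)) q + mfd_deriv Y1 (mfd_deriv Y1 (sine_mfd k)) q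
    = - (period * real k)\<^sup>2 * sine_mfd k q"
proof -
  let ?w = "period * real k"
  obtain p where q: "q = proj_mfd p" by (metis proj_rep_mfd)
  have Y: "fst (Y1 p) = 0" for p by (cases p) simp
  have lift: "(\<lambda>p. sine_mfd k (proj_mfd p)) = (\<lambda>p. sin (?w * fst p + 0))" by (simp add: sine_mfd_proj)
  have D: "mfd_deriv V (sine_mfd k) (proj_mfd p) = fst (V p) * ?w * sin (?w * fst p + (0 + pi / 2))"
    if "V = X1 \<or> V = Y1" for V p
    by (rule mfd_deriv_eqI[OF mfd_smooth_sine that]) (unfold lift, rule sine_has_derivative)
  have DX: "(\<lambda>p. mfd_deriv X1 (sine_mfd k) (proj_mfd p)) = (\<lambda>p. ?w * sin (?w * fst p + (0 + pi / 2)))"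
    by (rule ext) (simp add: D X1_eq)
  have DY: "(\<lambda>p. mfd_deriv Y1 (sine_mfd k) (proj_mfd p)) = (\<lambda>p. 0)"
    by (rule ext) (simp add: D Y)
  have "mfd_deriv X1 (mfd_deriv X1 (sine_mfd k)) (proj_mfd p)
      = ?w * (fst (X1 p) * ?w * sin (?w * fst p + ((0 + pi / 2) + pi / 2)))"
    by (rule mfd_deriv_eqI[OF mfd_smooth_deriv[OF mfd_smooth_sine]], simp, simp, unfold DX)
      (rule has_derivative_mult_right, rule sine_has_derivative)
  moreover have "mfd_deriv Y1 (mfd_deriv Y1 (sine_mfd k)) (proj_mfd p) = 0"
    by (rule mfd_deriv_eqI[OF mfd_smooth_deriv[OF mfd_smooth_sine], where D = "\<lambda>h. 0"], simp, simp, unfold DY)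
      (rule has_derivative_const)
  moreover have "sin (?w * fst p + ((0 + pi / 2) + pi / 2)) = - sin (?w * fst p)" by simp
  ultimately show ?thesis
    unfolding q sine_mfd_proj X1_eq fst_conv by (simp add: power2_eq_square)
qed

lemma nodal_set_sine:
  assumes k: "0 < k"
  shows "nodal_set UNIV (sine_mfd k) \<subseteq> (\<Union>l<2 * k. {proj_mfd (real l * pi / (period * real k), y, z) | y z. True})"
proof
  fix q assume "q \<in> nodal_set UNIV (sine_mfd k)"
  then have zero: "sine_mfd k q = 0" by (simp add: nodal_set_def)
  obtain x y z where p: "(x, y, z) \<in> heis_fund_dom" "q = proj_mfd (x, y, z)"
    using heis_fund_dom_representative[of q] by (metis prod_cases3)
  have x: "0 \<le> x" "x < period" using p(1) by (auto simp: heis_fund_dom_def)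
  have w: "0 < period * real k" using k by simp
  have "sin (period * real k * x) = 0" using zero unfolding p(2) sine_mfd_proj by simp
  then obtain i :: int where i: "period * real k * x = of_int i * pi" using sin_zero_iff_int2 by blast
  have "0 \<le> of_int i * pi" using i x w by (metis less_imp_le mult_nonneg_nonneg)
  then have i0: "0 \<le> i" using pi_gt_zero by (auto simp: zero_le_mult_iff)
  have "of_int i * pi < period * real k * period" unfolding i[symmetric] using x w by (intro mult_strict_left_mono)
  also have "\<dots> = (period * period) * real k" by (simp only: mult_ac)
  also have "\<dots> = of_int (2 * int k) * pi" by simp
  finally have "i < 2 * int k" by (simp only: mult_less_cancel_right_pos[OF pi_gt_zero] of_int_less_iff)
  then have "nat i < 2 * k" using i0 by simp
  moreover have "x = real (nat i) * pi / (period * real k)"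
  proof -
    have "x * (period * real k) = of_int i * pi" using i by (simp only: mult_ac)
    then have "x = of_int i * pi / (period * real k)" by (rule eq_divide_imp[OF less_imp_neq[OF w, symmetric]])
    then show ?thesis using i0 by simp
  qed
  ultimately show "q \<in> (\<Union>l<2 * k. {proj_mfd (real l * pi / (period * real k), y, z) | y z. True})"
    unfolding p(2) by blast
qed

lemma hausdorff_measure_mono: "A \<subseteq> B \<Longrightarrow> hausdorff_measure d k A \<le> hausdorff_measure d k B"
  unfolding hausdorff_measure_def by (intro SUP_mono' Inf_superset_mono) blast

theorem theorem3:
  shows "\<exists>(\<Omega> :: heis_mfd set) (c\<^sub>1 :: real) (c\<^sub>2 :: real)
      (\<phi>\<^sub>1 :: nat \<Rightarrow> heis_mfd \<Rightarrow> real) (\<phi>\<^sub>2 :: nat \<Rightarrow> heis_mfd \<Rightarrow> real)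
      (ev\<^sub>1 :: nat \<Rightarrow> real) (ev\<^sub>2 :: nat \<Rightarrow> real).
    open \<Omega> \<and> c\<^sub>1 > 0 \<and> c\<^sub>2 > 0 \<and>
    (\<forall>m. continuous_on (closure \<Omega>) (\<phi>\<^sub>1 m) \<and> eigenfunction \<Omega> (ev\<^sub>1 m) (\<phi>\<^sub>1 m)) \<and>
    (\<forall>m. continuous_on (closure \<Omega>) (\<phi>\<^sub>2 m) \<and> eigenfunction \<Omega> (ev\<^sub>2 m) (\<phi>\<^sub>2 m)) \<and>
    filterlim ev\<^sub>1 at_top sequentially \<and>
    filterlim ev\<^sub>2 at_top sequentially \<and>
    (\<forall>m. hausdorff_measure sr_dist 3 (nodal_set \<Omega> (\<phi>\<^sub>1 m)) \<le> ennreal (c\<^sub>1 * sqrt (ev\<^sub>1 m))) \<and>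
    (\<forall>m. ennreal (c\<^sub>2 * ev\<^sub>2 m) \<le> hausdorff_measure sr_dist 3 (nodal_set \<Omega> (\<phi>\<^sub>2 m)))"
proof -
  let ?C = "period + 4 * pi * sqrt 2"
  define ev1 :: "nat \<Rightarrow> real" where "ev1 = (\<lambda>m. (period * real (Suc m))\<^sup>2)"
  \<comment> \<open>With \<open>n = 16 * K\<close> the slabs of height \<open>pi / n\<close> between \<open>z = - pi / 16\<close> and \<open>z = 0\<close> are exactly \<open>K\<close> in number.\<close>
  define ev2 :: "nat \<Rightarrow> real" where "ev2 = (\<lambda>m. real (16 * Suc m))"
  have C: "0 < ?C" by (simp add: add_pos_pos)
  have e1: "eigenfunction UNIV (ev1 m) (sine_mfd (Suc m))" for m
  proof (rule smooth_eigenfunction[OF mfd_smooth_sine])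
    show "sine_mfd (Suc m) (proj_mfd (pi / 2 / (period * real (Suc m)), 0, 0)) \<noteq> 0"
      unfolding sine_mfd_proj fst_conv by (simp del: of_nat_Suc)
  qed (simp add: sub_laplacian_sine ev1_def)
  have e2: "eigenfunction UNIV (ev2 m) (theta_mfd (16 * Suc m))" for m
  proof (rule smooth_eigenfunction[OF mfd_smooth_theta])
    let ?e = "exp (- real (16 * Suc m) * (0::real)\<^sup>2 / 2)"
    have "\<bar>theta (16 * Suc m) 0 0 (0, 0, 0) - ?e * cos (real (16 * Suc m) * 0)\<bar> \<le> ?e / 2"
      by (rule theta_dominant_term) auto
    then show "theta_mfd (16 * Suc m) (proj_mfd (0, 0, 0)) \<noteq> 0" unfolding theta_mfd_proj by auto
  qed (simp_all add: sub_laplacian_theta ev2_def)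
  have h1: "hausdorff_measure sr_dist 3 (nodal_set UNIV (sine_mfd (Suc m))) \<le> ennreal (2 * ?C ^ 3 / period * sqrt (ev1 m))" for m
  proof -
    have "hausdorff_measure sr_dist 3 (nodal_set UNIV (sine_mfd (Suc m)))
        \<le> hausdorff_measure sr_dist 3 (\<Union>l<2 * Suc m. {proj_mfd (real l * pi / (period * real (Suc m)), y, z) | y z. True})"
      by (rule hausdorff_measure_mono[OF nodal_set_sine]) simp
    also have "\<dots> \<le> ennreal (real (2 * Suc m) * ?C ^ 3)" by (rule hausdorff_measure_vertical_planes_le)
    also have "real (2 * Suc m) * ?C ^ 3 = 2 * ?C ^ 3 / period * sqrt (ev1 m)"
    proof -
      have "sqrt (ev1 m) = period * real (Suc m)" unfolding ev1_def by (simp only: real_sqrt_abs) simp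
      then show ?thesis by simp
    qed
    finally show ?thesis .
  qed
  have h2: "ennreal (period * pi / 16384 * ev2 m) \<le> hausdorff_measure sr_dist 3 (nodal_set UNIV (theta_mfd (16 * Suc m)))" for m
  proof -
    have "ennreal (period * pi / 1024 * real (Suc m)) \<le> hausdorff_measure sr_dist 3 (nodal_set UNIV (theta_mfd (16 * Suc m)))"
    proof (rule hausdorff_measure_sheets_ge)
      fix x t k assume "x \<in> {period / 8..period / 4}"
      from theta_zero_on_fibre[OF _ this, of "Suc m" k t]
      show "\<exists>z\<in>{- (real k + 3 / 4) * pi / (16 * real (Suc m))..- (real k + 1 / 4) * pi / (16 * real (Suc m))}.
          proj_mfd (x, (t - z) / x, z) \<in> nodal_set UNIV (theta_mfd (16 * Suc m))"
        unfolding nodal_set_def closure_UNIV mem_Collect_eq theta_mfd_proj by blast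
    qed simp
    moreover have "period * pi / 16384 * ev2 m = period * pi / 1024 * real (Suc m)" by (simp add: ev2_def)
    ultimately show ?thesis by (simp only:)
  qed
  have l1: "filterlim ev1 at_top sequentially"
  proof (rule filterlim_at_top_mono[OF filterlim_real_sequentially])
    have "real m \<le> ev1 m" for m
    proof -
      have "real m \<le> real (Suc m) * real (Suc m)" by (simp add: algebra_simps)
      also have "\<dots> \<le> (2 * pi) * (real (Suc m) * real (Suc m))"
        using pi_gt3 mult_right_mono[of 1 "2 * pi" "real (Suc m) * real (Suc m)"] by simp
      also have "\<dots> = ev1 m" by (simp add: ev1_def power_mult_distrib power2_eq_square)
      finally show ?thesis .
    qed
    then show "\<forall>\<^sub>F m in sequentially. real m \<le> ev1 m" by simp
  qed
  have l2: "filterlim ev2 at_top sequentially"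
    by (rule filterlim_at_top_mono[OF filterlim_real_sequentially]) (simp add: ev2_def)
  have "open (UNIV :: heis_mfd set)" "0 < 2 * ?C ^ 3 / period" "0 < period * pi / 16384" using C by simp_all
  moreover have "continuous_on (closure UNIV) (sine_mfd (Suc m))" "continuous_on (closure UNIV) (theta_mfd (16 * Suc m))" for m
    using mfd_smooth_continuous[OF mfd_smooth_sine] mfd_smooth_continuous[OF mfd_smooth_theta] by simp_all
  ultimately show ?thesis using e1 e2 l1 l2 h1 h2
    by (intro exI[of _ UNIV] exI[of _ "2 * ?C ^ 3 / period"] exI[of _ "period * pi / 16384"]
      exI[of _ "\<lambda>m. sine_mfd (Suc m)"] exI[of _ "\<lambda>m. theta_mfd (16 * Suc m)"] exI[of _ ev1] exI[of _ ev2] conjI allI)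
qed

end
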